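(* Let $(X_i)_{i\in\mathbb{Z}}$ be the strongly stationary subcritical Galton--Watson process with regularly varying immigration described in the context, let $(a_n)_{n\in\mathbb{N}}$ be a sequence of positive real numbers with $\lim_{n\to\infty}a_n=\infty$ and $\lim_{n\to\infty} n\,\mathbb{P}(X_0>a_n)=1$, and let $$\widehat{\mu_A}^{(n)}:=\frac{\sum_{i=1}^n X_{i-1}(X_i-\mu_B)}{\sum_{i=1}^n X_{i-1}^2}$$ on the event $\{\sum_{i=1}^n X_{i-1}^2>0\}$ (whose probability tends to $1$ as $n\to\infty$) be the conditional least squares estimator of $\mu_A$ based on $X_0,X_1,\dots,X_n$ (with $\mu_B$ known). Then $$\sqrt{a_n}\,\bigl(\widehat{\mu_A}^{(n)}-\mu_A\bigr)\ \stackrel{d}{\longrightarrow}\ \frac{V^{(2)}}{V^{(1)}}\qquad\text{as } n\to\infty,$$ where $(V^{(1)},V^{(2)})$ is a random vector with $\mathbb{P}(V^{(1)}>0)=1$ and with joint characteristic function $$\mathbb{E}\bigl[\mathrm{e}^{\mathrm{i}(sV^{(1)}+tV^{(2)})}\bigr]=\exp\biggl\{(1-\mu_A^\alpha)\int_0^\infty\biggl(\exp\biggl\{\frac{\mathrm{i}s}{1-\mu_A^2}y^2-\frac{\sigma_A^2t^2}{2(1-\mu_A^3)}y^3\biggr\}-1\biggr)\alpha y^{-\alpha-1}\,\mathrm{d}y\biggr\},\qquad s,t\in\mathbb{R}.$$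
   Context: Setting: $\{A,A_j^{(i)}:j\in\mathbb{N},\,i\in\mathbb{Z}\}$ are i.i.d. nonnegative integer-valued random variables, independent of the i.i.d. family $\{B,B_i:i\in\mathbb{Z}\}$ of nonnegative integer-valued random variables. Assume $\mu_A:=\mathbb{E}[A]\in(0,1)$, $\sigma_A^2:=\mathrm{Var}(A)\in(0,\infty)$, and that $B$ is regularly varying with tail index $\alpha\in(1,2)$, i.e. $\lim_{x\to\infty}\mathbb{P}(B>qx)/\mathbb{P}(B>x)=q^{-\alpha}$ for all $q\in(0,\infty)$. In particular $\mu_B:=\mathbb{E}[B]\in(0,\infty)$. $(X_i)_{i\in\mathbb{Z}}$ is the strongly stationary process satisfying $X_i=\sum_{j=1}^{X_{i-1}}A_j^{(i)}+B_i$ for all $i\in\mathbb{Z}$ (the strongly stationary extension to $\mathbb{Z}$ of the corresponding Markov chain; $X_{i-1}$ is independent of $\{A_j^{(k)},B_k:j\in\mathbb{N},k\ge i\}$). $\stackrel{d}{\longrightarrow}$ denotes convergence in distribution. *)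

theory Defs
  imports "HOL-Probability.Probability"
begin

definition regularly_varying :: "real \<Rightarrow> nat pmf \<Rightarrow> bool" where
  "regularly_varying \<alpha> p \<longleftrightarrow>
     (\<forall>q>0. ((\<lambda>x::real. measure_pmf.prob p {k. real k > q * x} / measure_pmf.prob p {k. real k > x})
        \<longlongrightarrow> q powr (- \<alpha>)) at_top)"
  \<comment> \<open>If the tail vanished eventually, the quotient would be 0 by the convention on division,
      contradicting the case q = 1; so the definition forces an unbounded distribution.\<close>

definition strongly_stationary :: "'a measure \<Rightarrow> (int \<Rightarrow> 'a \<Rightarrow> nat) \<Rightarrow> bool" where
  "strongly_stationary M X \<longleftrightarrow>
     (\<forall>i. X i \<in> measurable M (count_space UNIV)) \<and>
     (\<forall>h. distr M (\<Pi>\<^sub>M i\<in>UNIV. count_space UNIV) (\<lambda>\<omega> i. X (i + h) \<omega>) =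
          distr M (\<Pi>\<^sub>M i\<in>UNIV. count_space UNIV) (\<lambda>\<omega> i. X i \<omega>))"

text \<open>The offspring variables \<open>A j i\<close> (with \<open>j \<ge> 1\<close>) and the immigration variables \<open>B i\<close> as one family,
  so that their joint independence can be expressed by \<^const>\<open>prob_space.indep_vars\<close>.\<close>

definition innovation ::
  "(nat \<Rightarrow> int \<Rightarrow> 'a \<Rightarrow> nat) \<Rightarrow> (int \<Rightarrow> 'a \<Rightarrow> nat) \<Rightarrow> (nat \<times> int) + int \<Rightarrow> 'a \<Rightarrow> nat" where
  "innovation A B = case_sum (\<lambda>(j, i). A j i) B"

definition innovation_sigma ::
  "'a measure \<Rightarrow> (nat \<Rightarrow> int \<Rightarrow> 'a \<Rightarrow> nat) \<Rightarrow> (int \<Rightarrow> 'a \<Rightarrow> nat) \<Rightarrow> int \<Rightarrow> 'a set set" where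
  "innovation_sigma M A B i =
     sigma_sets (space M) {innovation A B k -` S \<inter> space M | k S. k \<in> ({1..} \<times> {i..}) <+> {i..}}"
  \<comment> \<open>the sigma-algebra generated by all \<open>A j k\<close> and \<open>B k\<close> with \<open>j \<ge> 1\<close> and \<open>k \<ge> i\<close>\<close>

text \<open>A strongly stationary Galton--Watson process with immigration, indexed by the integers, with
  offspring law \<open>p_A\<close> and immigration law \<open>p_B\<close>. The recursion is required almost surely only.
  The last clause says that the process is non-anticipating, as is the stationary extension
  of the corresponding Markov chain.\<close>

definition stationary_GWI ::
  "'a measure \<Rightarrow> nat pmf \<Rightarrow> nat pmf \<Rightarrow> (nat \<Rightarrow> int \<Rightarrow> 'a \<Rightarrow> nat) \<Rightarrow> (int \<Rightarrow> 'a \<Rightarrow> nat) \<Rightarrow>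
     (int \<Rightarrow> 'a \<Rightarrow> nat) \<Rightarrow> bool" where
  "stationary_GWI M p_A p_B A B X \<longleftrightarrow>
     prob_space M \<and>
     prob_space.indep_vars M (\<lambda>_. count_space UNIV) (innovation A B) (({1..} \<times> UNIV) <+> UNIV) \<and>
     (\<forall>j\<ge>1. \<forall>i. distr M (count_space UNIV) (A j i) = measure_pmf p_A) \<and>
     (\<forall>i. distr M (count_space UNIV) (B i) = measure_pmf p_B) \<and>
     strongly_stationary M X \<and>
     (\<forall>i. AE \<omega> in M. X i \<omega> = (\<Sum>j=1..X (i - 1) \<omega>. A j i \<omega>) + B i \<omega>) \<and>
     (\<forall>i. prob_space.indep_set M {X (i - 1) -` S \<inter> space M | S. True} (innovation_sigma M A B i))"

definition cls_denominator :: "(int \<Rightarrow> 'a \<Rightarrow> nat) \<Rightarrow> nat \<Rightarrow> 'a \<Rightarrow> real" where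
  "cls_denominator X n \<omega> = (\<Sum>i=1..int n. (real (X (i - 1) \<omega>))\<^sup>2)"

definition cls_numerator :: "real \<Rightarrow> (int \<Rightarrow> 'a \<Rightarrow> nat) \<Rightarrow> nat \<Rightarrow> 'a \<Rightarrow> real" where
  "cls_numerator \<mu>\<^sub>B X n \<omega> = (\<Sum>i=1..int n. real (X (i - 1) \<omega>) * (real (X i \<omega>) - \<mu>\<^sub>B))"

text \<open>The estimator is prescribed only where the denominator is positive; elsewhere it may take
  arbitrary values, subject to measurability.\<close>

definition is_cls_estimator ::
  "'a measure \<Rightarrow> real \<Rightarrow> (int \<Rightarrow> 'a \<Rightarrow> nat) \<Rightarrow> (nat \<Rightarrow> 'a \<Rightarrow> real) \<Rightarrow> bool" where
  "is_cls_estimator M \<mu>\<^sub>B X muhat \<longleftrightarrow>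
     (\<forall>n\<ge>1. muhat n \<in> borel_measurable M \<and>
        (\<forall>\<omega>\<in>space M. cls_denominator X n \<omega> > 0 \<longrightarrow>
           muhat n \<omega> = cls_numerator \<mu>\<^sub>B X n \<omega> / cls_denominator X n \<omega>))"

end

theory Submission
  imports Defs
begin

text \<open>Write \<open>\<mu>\<close>, \<open>\<sigma>\<^sup>2\<close> for the offspring mean and variance, \<open>a\<close> for \<open>a n\<close>, and put
  \<open>D = (\<Sum>X\<^sub>i\<^sub>-\<^sub>1\<^sup>2) / a\<^sup>2\<close> and
  \<open>R = (\<Sum>X\<^sub>i\<^sub>-\<^sub>1 (X\<^sub>i - \<mu> X\<^sub>i\<^sub>-\<^sub>1 - \<mu>\<^sub>B)) / a\<^sup>3\<^sup>/\<^sup>2\<close>. Where the denominator is positive, the normalised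
  estimation error is \<open>R / D\<close>, so everything rests on the joint limit of \<open>(D, R)\<close>.

  Large values come from single immigration jumps. A jump of height \<open>a y\<close> is followed by the values
  \<open>a y\<close>, \<open>\<mu> a y\<close>, \<open>\<mu>\<^sup>2 a y\<close>, and so on, up to fluctuations. It contributes \<open>y\<^sup>2 / (1 - \<mu>\<^sup>2)\<close> to \<open>D\<close>, and
  to \<open>R\<close> a centred Gaussian amount of variance \<open>\<sigma>\<^sup>2 y\<^sup>3 / (1 - \<mu>\<^sup>3)\<close>. The characteristic function of
  this contribution is \<open>limit_cf s t y\<close>, written \<open>g y\<close> here. It satisfies
  \<open>g y = exp (\<i> s y\<^sup>2 - \<sigma>\<^sup>2 t\<^sup>2 y\<^sup>3 / 2) * g (\<mu> y)\<close>: the first generation splits off, and the rest looks like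
  a cluster started at \<open>\<mu> y\<close>.

  This makes \<open>g\<close> an almost exact multiplicative corrector. Let \<open>u\<^sub>k\<close> be the expectation of
  \<open>exp (\<i> (partial sum up to time k)) * g (X\<^sub>k / a)\<close>, where the factor \<open>g\<close> anticipates the contributions
  still to be made by the population at time \<open>k\<close>, and let \<open>w\<close> be the expectation of \<open>g (B / a)\<close>. Then
  \<open>u\<^sub>k\<^sub>+\<^sub>1\<close> equals \<open>w u\<^sub>k\<close> up to an error of at most the expectation of \<open>norm (remainder X\<^sub>0)\<close>, a quantity that
  involves one transition of the chain only (\<open>corrected_cf_step\<close>). The lemma \<open>remainder_bound\<close> estimates
  it from three facts: the central limit theorem for offspring, the bound
  \<open>L * \<bar>y\<^sup>2 - z\<^sup>2\<bar>\<close> for \<open>norm (g y - g z)\<close>, and the bound \<open>4 L h b\<close> for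
  \<open>norm (g (h + b) - g h * g b)\<close>, by which a present population and a new immigration wave act
  independently. After summation over \<open>n\<close> steps the error still vanishes
  (\<open>expected_remainder_tendsto_0\<close>), so the characteristic function of \<open>(D, R)\<close> has the same limit as
  \<open>w ^ n\<close>. Since \<open>n * (w - 1)\<close> converges to \<open>1 - \<mu> powr \<alpha>\<close> times the Levy integral of \<open>g - 1\<close>
  (\<open>scaled_expectation_tendsto_levy_integral\<close>), \<open>w ^ n\<close> converges to the claimed characteristic function.
  The constant \<open>1 - \<mu> powr \<alpha>\<close> arises because \<open>a\<close> is normalised by the tail of \<open>X\<^sub>0\<close>, which is
  asymptotically \<open>1 / (1 - \<mu> powr \<alpha>)\<close> times the tail of \<open>B\<close> (\<open>tail_ratio\<close>).

  The limit vector is built from the points \<open>y\<^sub>j\<close> of a Poisson process with intensity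
  \<open>(1 - \<mu> powr \<alpha>)\<close> times the Levy measure: \<open>V1\<close> is a multiple of \<open>\<Sum>y\<^sub>j\<^sup>2\<close>, and \<open>V2\<close> is an
  independent standard Gaussian variable times the square root of a multiple of \<open>\<Sum>y\<^sub>j\<^sup>3\<close>
  (\<open>exists_stable_vector\<close>). The ratio follows from the linear combinations: almost surely
  \<open>V2 / V1 \<le> x\<close> means \<open>V2 - x V1 \<le> 0\<close>, and \<open>R / D \<le> x\<close> means \<open>R - x D \<le> 0\<close> outside an
  event of vanishing probability, so Levy's continuity theorem for
  \<open>R - x D\<close> gives the convergence of the distribution functions.\<close>

section \<open>Expectations of discrete laws and offspring sums\<close>

text \<open>Gives access to Fubini's theorem for \<open>pair_pmf\<close>. Countability makes every subset of the product
  measurable.\<close>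

lemma measure_pair_pmf_countable:
  fixes p :: "'a::countable pmf" and q :: "'b::countable pmf"
  shows "measure_pmf (pair_pmf p q) = measure_pmf p \<Otimes>\<^sub>M measure_pmf q"
proof (rule measure_eqI_countable)
  interpret P: pair_sigma_finite "measure_pmf p" "measure_pmf q" ..
  show "sets (measure_pmf p \<Otimes>\<^sub>M measure_pmf q) = Pow UNIV"
  proof -
    have "sets (measure_pmf p \<Otimes>\<^sub>M measure_pmf q) = sets (count_space UNIV \<Otimes>\<^sub>M count_space UNIV)"
      by (intro sets_pair_measure_cong) auto
    also have "\<dots> = Pow UNIV"
      by (subst sets_pair_countable) auto
    finally show ?thesis .
  qed
  fix x :: "'a \<times> 'b"
  show "emeasure (measure_pmf (pair_pmf p q)) {x} = emeasure (measure_pmf p \<Otimes>\<^sub>M measure_pmf q) {x}"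
  proof (cases x)
    case (Pair a b)
    have "emeasure (measure_pmf p \<Otimes>\<^sub>M measure_pmf q) ({a} \<times> {b}) = pmf p a * pmf q b"
      by (subst measure_pmf.emeasure_pair_measure_Times) (auto simp: emeasure_pmf_single ennreal_mult)
    then show ?thesis
      by (simp add: Pair emeasure_pmf_single pmf_pair)
  qed
qed auto

lemma
  fixes p :: "'a::countable pmf" and q :: "'b::countable pmf"
    and f :: "'a \<Rightarrow> 'c::{real_normed_field, banach, second_countable_topology}"
  assumes f: "integrable p f" and g: "integrable q g"
  shows integrable_pair_pmf_mult: "integrable (pair_pmf p q) (\<lambda>(a, b). f a * g b)"
    and expectation_pair_pmf_mult:
      "(LINT x|pair_pmf p q. (case x of (a, b) \<Rightarrow> f a * g b)) = (LINT a|p. f a) * (LINT b|q. g b)"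
proof -
  interpret P: pair_sigma_finite "measure_pmf p" "measure_pmf q" ..
  have meas: "(\<lambda>(a, b). f a * g b) \<in> borel_measurable (measure_pmf p \<Otimes>\<^sub>M measure_pmf q)"
    by (subst measure_pair_pmf_countable[symmetric]) simp
  have int: "integrable (measure_pmf p \<Otimes>\<^sub>M measure_pmf q) (\<lambda>(a, b). f a * g b)"
  proof (rule P.Fubini_integrable[OF meas])
    show "integrable p (\<lambda>x. \<integral>y. norm (case (x, y) of (a, b) \<Rightarrow> f a * g b) \<partial>q)"
      using f g by (simp add: norm_mult)
    show "AE x in p. integrable q (\<lambda>y. case (x, y) of (a, b) \<Rightarrow> f a * g b)"
      using f g by simp
  qed
  show "integrable (pair_pmf p q) (\<lambda>(a, b). f a * g b)"
    using int by (simp add: measure_pair_pmf_countable)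
  have "(LINT x|pair_pmf p q. (case x of (a, b) \<Rightarrow> f a * g b)) = (LINT a|p. LINT b|q. f a * g b)"
    using P.integral_fst'[OF int] by (simp add: measure_pair_pmf_countable)
  then show "(LINT x|pair_pmf p q. (case x of (a, b) \<Rightarrow> f a * g b)) = (LINT a|p. f a) * (LINT b|q. g b)"
    by simp
qed

lemma
  fixes p :: "'a pmf" and q :: "'b pmf" and f :: "'a \<Rightarrow> 'c::{banach, second_countable_topology}"
    and g :: "'b \<Rightarrow> 'd::{banach, second_countable_topology}"
  shows integrable_pair_pmf_fst: "integrable p f \<Longrightarrow> integrable (pair_pmf p q) (\<lambda>x. f (fst x))"
    and integrable_pair_pmf_snd: "integrable q g \<Longrightarrow> integrable (pair_pmf p q) (\<lambda>x. g (snd x))"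
  using integrable_map_pmf_eq[of fst "pair_pmf p q" f] integrable_map_pmf_eq[of snd "pair_pmf p q" g]
  by (simp_all add: map_fst_pair_pmf map_snd_pair_pmf)

lemma integrable_pmf_bounded:
  fixes f :: "'a \<Rightarrow> 'c::{banach, second_countable_topology}"
  assumes "\<And>x. norm (f x) \<le> C"
  shows "integrable (measure_pmf p) f"
  by (rule measure_pmf.integrable_const_bound[where B=C]) (use assms in auto)

lemma norm_expectation_le:
  fixes f :: "'a \<Rightarrow> 'c::{banach, second_countable_topology}"
  assumes "\<And>x. norm (f x) \<le> C"
  shows "norm (measure_pmf.expectation p f) \<le> C"
proof -
  have "norm (measure_pmf.expectation p f) \<le> measure_pmf.expectation p (\<lambda>x. norm (f x))"
    by (rule integral_norm_bound)
  also have "\<dots> \<le> measure_pmf.expectation p (\<lambda>x. C)"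
    using assms order_trans[OF norm_ge_zero assms]
    by (intro integral_mono integrable_pmf_bounded[where C=C]) auto
  finally show ?thesis by simp
qed

text \<open>The law of total expectation, restricted to bounded integrands so that no integrability has to be
  discussed.\<close>

lemma expectation_bind_pmf_real:
  fixes h :: "'b \<Rightarrow> real"
  assumes h: "\<And>x. \<bar>h x\<bar> \<le> C"
  shows "measure_pmf.expectation (bind_pmf p f) h = measure_pmf.expectation p (\<lambda>x. measure_pmf.expectation (f x) h)"
  unfolding measure_pmf_bind
  by (rule integral_bind[where K="count_space UNIV" and B=C and B'=1])
     (use h in \<open>auto simp: measure_pmf.emeasure_space_1 measure_pmf_in_subprob_algebra
        intro: measure_pmf.finite_measure_axioms\<close>)

lemma expectation_bind_pmf:
  fixes h :: "'b \<Rightarrow> complex"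
  assumes h: "\<And>x. norm (h x) \<le> C"
  shows "measure_pmf.expectation (bind_pmf p f) h = measure_pmf.expectation p (\<lambda>x. measure_pmf.expectation (f x) h)"
proof (rule complex_eqI)
  have i: "integrable (measure_pmf q) h" for q :: "'b pmf"
    by (rule integrable_pmf_bounded[OF h])
  have i2: "integrable p (\<lambda>x. measure_pmf.expectation (f x) h)"
    by (rule integrable_pmf_bounded[where C=C]) (rule norm_expectation_le[OF h])
  have "\<bar>Re (h x)\<bar> \<le> C" "\<bar>Im (h x)\<bar> \<le> C" for x
    using h[of x] abs_Re_le_cmod[of "h x"] abs_Im_le_cmod[of "h x"] by linarith+
  note b = this
  show "Re (measure_pmf.expectation (bind_pmf p f) h) =
      Re (measure_pmf.expectation p (\<lambda>x. measure_pmf.expectation (f x) h))"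
    using expectation_bind_pmf_real[of "\<lambda>x. Re (h x)" C p f, OF b(1)]
    by (simp add: integral_Re[OF i] integral_Re[OF i2] del: expectation_pair_pmf_fst)
  show "Im (measure_pmf.expectation (bind_pmf p f) h) =
      Im (measure_pmf.expectation p (\<lambda>x. measure_pmf.expectation (f x) h))"
    using expectation_bind_pmf_real[of "\<lambda>x. Im (h x)" C p f, OF b(2)]
    by (simp add: integral_Im[OF i] integral_Im[OF i2])
qed

primrec offspring_sum :: "nat pmf \<Rightarrow> nat \<Rightarrow> nat pmf" where
  "offspring_sum p 0 = return_pmf 0"
| "offspring_sum p (Suc x) = map_pmf (\<lambda>(s, k). s + k) (pair_pmf (offspring_sum p x) p)"

text \<open>The transition kernel of the Galton--Watson chain with immigration.\<close>

definition gwi_step :: "nat pmf \<Rightarrow> nat pmf \<Rightarrow> nat \<Rightarrow> nat pmf" where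
  "gwi_step pA pB x = map_pmf (\<lambda>(s, b). s + b) (pair_pmf (offspring_sum pA x) pB)"

text \<open>The centring \<open>m\<close> is arbitrary; with \<open>m\<close> the mean, the base of the power is close to a Gaussian
  characteristic function.\<close>

lemma offspring_sum_char:
  "measure_pmf.expectation (offspring_sum p x) (\<lambda>s. iexp (l * (real s - m * real x))) =
     (measure_pmf.expectation p (\<lambda>k. iexp (l * (real k - m)))) ^ x"
proof (induction x)
  case (Suc x)
  have *: "iexp (l * (real (s + k) - m * real (Suc x))) =
     iexp (l * (real s - m * real x)) * iexp (l * (real k - m))" for s k
    by (simp add: exp_add[symmetric] algebra_simps)
  have "measure_pmf.expectation (offspring_sum p (Suc x)) (\<lambda>s. iexp (l * (real s - m * real (Suc x)))) =
     measure_pmf.expectation (pair_pmf (offspring_sum p x) p)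
       (\<lambda>(s, k). iexp (l * (real s - m * real x)) * iexp (l * (real k - m)))"
    by (simp only: offspring_sum.simps integral_map_pmf case_prod_unfold *)
  also have "\<dots> = (measure_pmf.expectation p (\<lambda>k. iexp (l * (real k - m)))) ^ Suc x"
    by (subst expectation_pair_pmf_mult)
       (auto intro!: integrable_pmf_bounded[where C=1] simp del: of_real_diff of_real_mult simp: Suc.IH mult.commute)
  finally show ?case .
qed auto

lemma
  assumes i2: "integrable (measure_pmf p) (\<lambda>k. (real k)\<^sup>2)"
    and m: "m = measure_pmf.expectation p real"
    and v: "v = measure_pmf.variance p real"
  shows integrable_offspring_sum_square: "integrable (offspring_sum p x) (\<lambda>s. (real s)\<^sup>2)"
    and expectation_offspring_sum: "measure_pmf.expectation (offspring_sum p x) real = m * x"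
    and variance_offspring_sum:
      "measure_pmf.expectation (offspring_sum p x) (\<lambda>s. (real s - m * x)\<^sup>2) = v * x"
proof -
  have i1: "integrable q real" if "integrable (measure_pmf q) (\<lambda>k. (real k)\<^sup>2)" for q
    by (rule measure_pmf.square_integrable_imp_integrable[OF _ that]) simp
  have ic: "integrable q (\<lambda>k. (real k - c)\<^sup>2)" if "integrable (measure_pmf q) (\<lambda>k. (real k)\<^sup>2)" for q c
    using that i1[OF that] by (simp add: power2_diff)
  have "integrable (offspring_sum p x) (\<lambda>s. (real s)\<^sup>2) \<and>
    measure_pmf.expectation (offspring_sum p x) real = m * x \<and>
    measure_pmf.expectation (offspring_sum p x) (\<lambda>s. (real s - m * x)\<^sup>2) = v * x"
  proof (induction x)
    case 0
    show ?case by (simp add: integrable_measure_pmf_finite)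
  next
    case (Suc x)
    let ?q = "offspring_sum p x" and ?P = "pair_pmf (offspring_sum p x) p"
    have I2: "integrable ?q (\<lambda>s. (real s)\<^sup>2)" and E: "measure_pmf.expectation ?q real = m * x"
      and V: "measure_pmf.expectation ?q (\<lambda>s. (real s - m * x)\<^sup>2) = v * x"
      using Suc by auto
    note I1 = i1[OF I2] and j1 = i1[OF i2]
    note [simp] = integrable_pair_pmf_fst[of ?q real p] integrable_pair_pmf_snd[of p real ?q]
      integrable_pair_pmf_fst[of ?q "\<lambda>s. (real s)\<^sup>2" p] integrable_pair_pmf_snd[of p "\<lambda>s. (real s)\<^sup>2" ?q]
      integrable_pair_pmf_fst[of ?q "\<lambda>s. (real s - m*x)\<^sup>2" p] integrable_pair_pmf_snd[of p "\<lambda>s. (real s - m)\<^sup>2" ?q]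
      I1 j1 I2 i2 ic
    have E1: "measure_pmf.expectation (offspring_sum p (Suc x)) real = m * real (Suc x)"
      using expectation_pair_pmf_fst[of ?q p real] expectation_pair_pmf_snd[of ?q p real]
      by (simp add: case_prod_unfold E m[symmetric] algebra_simps)
    have I2': "integrable (offspring_sum p (Suc x)) (\<lambda>s. (real s)\<^sup>2)"
      using integrable_pair_pmf_mult[OF I1 j1]
      by (simp add: case_prod_unfold power2_sum mult.assoc)
    have c: "integrable ?P (\<lambda>(s,k). (real s - m * x) * (real k - m))"
      "measure_pmf.expectation ?P (\<lambda>(s,k). (real s - m * x) * (real k - m)) = 0"
      using integrable_pair_pmf_mult[of ?q "\<lambda>s. real s - m * x" p "\<lambda>k. real k - m"]
        expectation_pair_pmf_mult[of ?q "\<lambda>s. real s - m * x" p "\<lambda>k. real k - m"]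
      by (simp_all add: m[symmetric])
    have "measure_pmf.expectation (offspring_sum p (Suc x)) (\<lambda>s. (real s - m * Suc x)\<^sup>2) =
      measure_pmf.expectation ?P (\<lambda>z. (real (fst z) - m * x)\<^sup>2 + (real (snd z) - m)\<^sup>2
         + 2 * ((real (fst z) - m * x) * (real (snd z) - m)))"
    proof -
      have "(real (fst z + snd z) - m * real (Suc x))\<^sup>2 = (real (fst z) - m * x)\<^sup>2 + (real (snd z) - m)\<^sup>2
         + 2 * ((real (fst z) - m * x) * (real (snd z) - m))" for z
        by (simp add: power2_eq_square algebra_simps)
      then show ?thesis
        by (simp only: offspring_sum.simps integral_map_pmf case_prod_unfold)
    qed
    also have "\<dots> = measure_pmf.expectation ?P (\<lambda>z. (real (fst z) - m * x)\<^sup>2)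
        + measure_pmf.expectation ?P (\<lambda>z. (real (snd z) - m)\<^sup>2)
        + 2 * measure_pmf.expectation ?P (\<lambda>(s,k). (real s - m * x) * (real k - m))"
      using c(1) by (simp add: case_prod_unfold)
    also have "\<dots> = v * x + v"
      unfolding c(2) expectation_pair_pmf_fst[of ?q p "\<lambda>s. (real s - m * x)\<^sup>2"]
        expectation_pair_pmf_snd[of ?q p "\<lambda>s. (real s - m)\<^sup>2"] V
      by (simp add: v m[symmetric])
    finally show ?case using E1 I2' by (simp add: algebra_simps)
  qed
  then show "integrable (offspring_sum p x) (\<lambda>s. (real s)\<^sup>2)"
    "measure_pmf.expectation (offspring_sum p x) real = m * x"
    "measure_pmf.expectation (offspring_sum p x) (\<lambda>s. (real s - m * x)\<^sup>2) = v * x" by auto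
qed

section \<open>Regularly varying tails\<close>

definition tail :: "nat pmf \<Rightarrow> real \<Rightarrow> real" where
  "tail p x = measure_pmf.prob p {k. real k > x}"

lemma tail_nonneg [simp]: "0 \<le> tail p x"
  by (simp add: tail_def)

lemma tail_le_1 [simp]: "tail p x \<le> 1"
  by (simp add: tail_def)

lemma tail_antimono: "x \<le> y \<Longrightarrow> tail p y \<le> tail p x"
  unfolding tail_def by (intro measure_pmf.finite_measure_mono) auto

lemma tail_eq_expectation: "tail p x = measure_pmf.expectation p (\<lambda>k. indicat_real {k. real k > x} k)"
  by (simp add: tail_def)

lemma integrable_indicator_pmf: "integrable (measure_pmf p) (\<lambda>k. c * indicat_real S k)"
  by (intro integrable_pmf_bounded[where C="\<bar>c\<bar>"]) (auto simp: indicator_def)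

lemma integrable_indicat_real_pmf [simp]: "integrable (measure_pmf p) (indicat_real S)"
  using integrable_indicator_pmf[of p 1 S] by simp

lemma tail_tendsto_0: "(tail p \<longlongrightarrow> 0) at_top"
proof -
  have "(\<lambda>n. measure_pmf.prob p {k. k > n}) \<longlonglongrightarrow> measure_pmf.prob p (\<Inter>n. {k. k > n})"
    by (intro measure_pmf.finite_Lim_measure_decseq) (auto simp: decseq_def)
  also have "(\<Inter>n. {k::nat. k > n}) = {}"
    by auto
  finally have "(\<lambda>n. tail p (real n)) \<longlonglongrightarrow> 0"
    by (simp add: tail_def)
  note lim = this
  show ?thesis
  proof (rule order_tendstoI)
    fix e :: real assume "0 < e"
    then obtain N where N: "tail p (real N) < e"
      using order_tendstoD(2)[OF lim] by (meson eventually_sequentially order_refl)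
    show "eventually (\<lambda>x. tail p x < e) at_top"
      using eventually_ge_at_top[of "real N"]
      by eventually_elim (use N tail_antimono[of "real N"] in \<open>auto intro: le_less_trans\<close>)
  qed (auto intro!: always_eventually less_le_trans[OF _ tail_nonneg])
qed

lemma regularly_varying_alt:
  "regularly_varying \<alpha> p \<longleftrightarrow> (\<forall>q>0. ((\<lambda>x. tail p (q * x) / tail p x) \<longlongrightarrow> q powr (-\<alpha>)) at_top)"
  by (simp add: regularly_varying_def tail_def)

lemma regularly_varyingD:
  "regularly_varying \<alpha> p \<Longrightarrow> 0 < q \<Longrightarrow> ((\<lambda>x. tail p (q * x) / tail p x) \<longlongrightarrow> q powr (-\<alpha>)) at_top"
  by (simp add: regularly_varying_alt)

text \<open>If the tail vanished somewhere, it would vanish from there on, and the ratio for \<open>q = 1\<close> would tend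
  to 0 instead of 1.\<close>

lemma regularly_varying_tail_pos:
  assumes "regularly_varying \<alpha> p"
  shows "0 < tail p x"
proof (rule ccontr)
  assume "\<not> 0 < tail p x"
  then have z: "tail p x = 0"
    using tail_nonneg[of p x] by simp
  have "eventually (\<lambda>y. tail p (1 * y) / tail p y = 0) at_top"
    using eventually_ge_at_top[of x]
    by eventually_elim (metis z tail_antimono tail_nonneg antisym div_by_0 mult_1)
  then have "((\<lambda>y. tail p (1 * y) / tail p y) \<longlongrightarrow> 0) at_top"
    by (rule tendsto_eventually)
  from tendsto_unique[OF _ this regularly_varyingD[OF assms, of 1]] show False
    by simp
qed

lemma regularly_varying_eventually_le:
  assumes "regularly_varying \<alpha> p" "0 < q" "q powr (-\<alpha>) < c"
  shows "eventually (\<lambda>x. tail p (q * x) \<le> c * tail p x) at_top"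
  using order_tendstoD(2)[OF regularly_varyingD[OF assms(1,2)] assms(3)]
  by eventually_elim (use regularly_varying_tail_pos[OF assms(1)] in \<open>simp add: divide_simps less_imp_le\<close>)

lemma regularly_varying_eventually_ge:
  assumes "regularly_varying \<alpha> p" "0 < q" "c < q powr (-\<alpha>)"
  shows "eventually (\<lambda>x. c * tail p x \<le> tail p (q * x)) at_top"
  using order_tendstoD(1)[OF regularly_varyingD[OF assms(1,2)] assms(3)]
  by eventually_elim (use regularly_varying_tail_pos[OF assms(1)] in \<open>simp add: divide_simps less_imp_le\<close>)

text \<open>Growth estimates for regularly varying tails compare \<open>z\<close> with \<open>2 * z\<close> only; this rule extends them to
  all large \<open>z\<close>.\<close>

lemma dyadic_induct:
  fixes z0 :: real
  assumes z0: "0 < z0" and base: "\<And>z. z0 \<le> z \<Longrightarrow> z \<le> 2 * z0 \<Longrightarrow> P z"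
    and step: "\<And>z. z0 \<le> z \<Longrightarrow> P z \<Longrightarrow> P (2 * z)" and z: "z0 \<le> z"
  shows "P z"
proof -
  have "\<forall>z. z0 \<le> z \<longrightarrow> z \<le> 2 ^ Suc n * z0 \<longrightarrow> P z" for n
  proof (induction n)
    case (Suc n)
    show ?case
    proof (intro allI impI)
      fix z assume z: "z0 \<le> z" "z \<le> 2 ^ Suc (Suc n) * z0"
      show "P z"
      proof (cases "z \<le> 2 * z0")
        case False
        then have "P (z / 2)" using z Suc by auto
        from step[OF _ this] False show ?thesis by simp
      qed (use base z in auto)
    qed
  qed (use base in auto)
  moreover obtain n where "z / z0 < 2 ^ n"
    using real_arch_pow[of 2 "z / z0"] by auto
  then have "z \<le> 2 ^ Suc n * z0"
    using z0 z by (simp add: divide_simps)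
  ultimately show ?thesis using z by blast
qed

lemma filterlim_powr_at_top:
  fixes d :: real
  assumes d: "0 < d"
  shows "filterlim (\<lambda>z::real. z powr d) at_top at_top"
  unfolding filterlim_at_top
proof
  fix Z :: real
  show "eventually (\<lambda>z. Z \<le> z powr d) at_top"
    using eventually_ge_at_top[of "(max Z 1) powr (1 / d)"]
  proof eventually_elim
    case (elim z)
    have "max Z 1 = ((max Z 1) powr (1 / d)) powr d" using d by (simp add: powr_powr)
    also have "\<dots> \<le> z powr d" using elim d by (intro powr_mono2) auto
    finally show ?case by simp
  qed
qed

text \<open>One half of Karamata's theorem. Doubling \<open>z\<close> increases the truncated second moment by at most
  \<open>3 * z\<^sup>2 * tail p z\<close>, while \<open>z\<^sup>2 * tail p z\<close> itself grows by a factor \<open>4 * r > 1\<close>, because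
  \<open>tail p (2 * z) \<ge> r * tail p z\<close> with \<open>1 / 4 < r < 2 powr (- \<alpha>)\<close>. The bound therefore propagates as
  soon as \<open>C + 3 \<le> 4 * r * C\<close>.\<close>

lemma truncated_second_moment_le:
  assumes rv: "regularly_varying \<alpha> p" and a: "\<alpha> < 2"
  obtains C where "0 < C"
    "eventually (\<lambda>z. measure_pmf.expectation p (\<lambda>k. (min (real k) z)\<^sup>2) \<le> C * (z\<^sup>2 * tail p z)) at_top"
proof -
  define r :: real where "r = 2 powr (- (\<alpha> + 2) / 2)"
  have r: "r < 2 powr (-\<alpha>)" "1 / 4 < r"
  proof -
    have "2 powr (-2) < r" unfolding r_def using a by (intro powr_less_mono) auto
    then show "1 / 4 < r" by (simp add: powr_minus powr_numeral)
  qed (use a in \<open>auto simp: r_def intro!: powr_less_mono\<close>)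
  obtain z0 where z0: "0 < z0" "\<And>z. z0 \<le> z \<Longrightarrow> r * tail p z \<le> tail p (2 * z)"
  proof -
    obtain N where "\<And>z. N \<le> z \<Longrightarrow> r * tail p z \<le> tail p (2 * z)"
      using regularly_varying_eventually_ge[OF rv _ r(1)] by (auto simp: eventually_at_top_linorder)
    then show ?thesis by (intro that[of "max N 1"]) auto
  qed
  have pos: "0 < tail p z" for z by (rule regularly_varying_tail_pos[OF rv])
  define I where "I z = measure_pmf.expectation p (\<lambda>k. (min (real k) z)\<^sup>2)" for z
  have int: "integrable p (\<lambda>k. (min (real k) z)\<^sup>2)" if "0 \<le> z" for z
    using that by (intro integrable_pmf_bounded[where C="z\<^sup>2"]) (auto simp: power_mono)
  have I_le: "I z \<le> z\<^sup>2" if "0 \<le> z" for z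
  proof -
    have "I z \<le> measure_pmf.expectation p (\<lambda>k. z\<^sup>2)"
      unfolding I_def using that by (intro integral_mono int) (auto simp: power_mono)
    then show ?thesis by simp
  qed
  have I_step: "I (2 * z) \<le> I z + 3 * z\<^sup>2 * tail p z" if "0 \<le> z" for z
  proof -
    have "I (2 * z) \<le> measure_pmf.expectation p (\<lambda>k. (min (real k) z)\<^sup>2 + 3 * z\<^sup>2 * indicator {k. real k > z} k)"
      unfolding I_def
    proof (intro integral_mono int Bochner_Integration.integrable_add)
      show "integrable p (\<lambda>k. 3 * z\<^sup>2 * indicat_real {k. real k > z} k)"
        by (intro integrable_pmf_bounded[where C="3 * z\<^sup>2"]) (auto simp: indicator_def)
      fix k :: nat
      have "(min (real k) (2 * z))\<^sup>2 \<le> (2 * z)\<^sup>2"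
        using that by (intro power_mono) auto
      then show "(min (real k) (2 * z))\<^sup>2 \<le> (min (real k) z)\<^sup>2 + 3 * z\<^sup>2 * indicat_real {k. real k > z} k"
        using that by (auto simp: indicator_def min_def power2_eq_square)
    qed (use that in auto)
    also have "\<dots> = I z + 3 * z\<^sup>2 * tail p z"
      unfolding I_def using int[OF that]
      by (subst Bochner_Integration.integral_add) (auto simp: tail_def integrable_indicator_pmf)
    finally show ?thesis .
  qed
  define C where "C = max (1 / tail p (2 * z0)) (3 / (4 * r - 1))"
  have C: "1 / tail p (2 * z0) \<le> C" "3 \<le> (4 * r - 1) * C" "0 < C"
  proof -
    have "(4 * r - 1) * (3 / (4 * r - 1)) \<le> (4 * r - 1) * C"
      using r by (intro mult_left_mono) (auto simp: C_def)
    moreover have "d * (3 / d) = 3" if "d \<noteq> 0" for d :: real using that by simp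
    from this[of "4 * r - 1"] have "(4 * r - 1) * (3 / (4 * r - 1)) = 3" using r by auto
    ultimately show "3 \<le> (4 * r - 1) * C" by (simp only:)
    show "0 < C" using pos[of "2*z0"] by (auto simp: C_def less_max_iff_disj)
  qed (simp add: C_def)
  have "I z \<le> C * (z\<^sup>2 * tail p z)" if "z0 \<le> z" for z
    using z0(1) _ _ that
  proof (rule dyadic_induct)
    fix z assume z: "z0 \<le> z" "z \<le> 2 * z0"
    have "1 = (1 / tail p (2 * z0)) * tail p (2 * z0)" using pos[of "2*z0"] by simp
    also have "\<dots> \<le> C * tail p z"
      using C pos[of "2*z0"] z by (intro mult_mono tail_antimono) auto
    finally have "z\<^sup>2 * 1 \<le> z\<^sup>2 * (C * tail p z)" by (intro mult_left_mono) auto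
    then have "z\<^sup>2 \<le> C * (z\<^sup>2 * tail p z)" by (simp only: mult_1_right mult.left_commute)
    with I_le[of z] z z0 show "I z \<le> C * (z\<^sup>2 * tail p z)" by linarith
  next
    fix z assume z: "z0 \<le> z" and IH: "I z \<le> C * (z\<^sup>2 * tail p z)"
    have "I (2 * z) \<le> (C + 3) * (z\<^sup>2 * tail p z)"
      using I_step[of z] z z0 IH by (simp add: algebra_simps)
    also have "\<dots> \<le> (4 * r * C) * (z\<^sup>2 * tail p z)"
      using C by (intro mult_right_mono) (auto simp: algebra_simps)
    also have "\<dots> = 4 * C * z\<^sup>2 * (r * tail p z)" by simp
    also have "\<dots> \<le> 4 * C * z\<^sup>2 * tail p (2 * z)"
      using C z0(2)[OF z] by (intro mult_left_mono) auto
    finally show "I (2 * z) \<le> C * ((2 * z)\<^sup>2 * tail p (2 * z))"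
      by (simp add: power2_eq_square algebra_simps)
  qed
  then show ?thesis
    using C(3) that[of C] unfolding I_def eventually_at_top_linorder by auto
qed

text \<open>For \<open>\<alpha> < b < 2\<close> the tail loses at most a factor \<open>2 powr (- b)\<close> per doubling, so it dominates a
  multiple of \<open>z powr (- b)\<close>. In particular an error of order \<open>1 / z\<^sup>2\<close> is negligible against the tail.\<close>

lemma square_times_tail_at_top:
  assumes rv: "regularly_varying \<alpha> p" and a: "\<alpha> < 2"
  shows "filterlim (\<lambda>z. z\<^sup>2 * tail p z) at_top at_top"
proof -
  define b where "b = (\<alpha> + 2) / 2"
  have b: "2 powr (-b) < 2 powr (-\<alpha>)" "b < 2"
    using a by (auto simp: b_def intro!: powr_less_mono)
  obtain z0 where z0: "0 < z0" "\<And>z. z0 \<le> z \<Longrightarrow> 2 powr (-b) * tail p z \<le> tail p (2 * z)"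
  proof -
    obtain N where "\<And>z. N \<le> z \<Longrightarrow> 2 powr (-b) * tail p z \<le> tail p (2 * z)"
      using regularly_varying_eventually_ge[OF rv _ b(1)] by (auto simp: eventually_at_top_linorder)
    then show ?thesis by (intro that[of "max N 1"]) auto
  qed
  have pos: "0 < tail p z" for z by (rule regularly_varying_tail_pos[OF rv])
  define c where "c = tail p (2 * z0) * min (z0 powr b) ((2 * z0) powr b)"
  have c: "0 < c" using pos z0 by (auto simp: c_def)
  have *: "c \<le> tail p z * z powr b" if "z0 \<le> z" for z
    using z0(1) _ _ that
  proof (rule dyadic_induct)
    fix z assume z: "z0 \<le> z" "z \<le> 2 * z0"
    have "min (z0 powr b) ((2 * z0) powr b) \<le> z powr b"
    proof (cases "0 \<le> b")
      case True
      then show ?thesis using z z0 by (intro min.coboundedI1 powr_mono2) auto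
    next
      case False
      then show ?thesis using z z0 by (intro min.coboundedI2 powr_mono2') auto
    qed
    then show "c \<le> tail p z * z powr b"
      unfolding c_def using z pos z0 by (intro mult_mono tail_antimono) auto
  next
    fix z assume z: "z0 \<le> z" and IH: "c \<le> tail p z * z powr b"
    have "tail p z * z powr b = (2 powr (-b) * tail p z) * (2 * z) powr b"
      using z z0 by (simp add: powr_mult powr_minus)
    also have "\<dots> \<le> tail p (2 * z) * (2 * z) powr b"
      using z0(2)[OF z] by (intro mult_right_mono) auto
    finally show "c \<le> tail p (2 * z) * (2 * z) powr b" using IH by simp
  qed
  have lim: "filterlim (\<lambda>z::real. c * z powr (2 - b)) at_top at_top"
    using b c by (intro filterlim_tendsto_pos_mult_at_top[OF tendsto_const] filterlim_powr_at_top) auto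
  show ?thesis
  proof (rule filterlim_at_top_mono[OF lim])
    show "eventually (\<lambda>z. c * z powr (2 - b) \<le> z\<^sup>2 * tail p z) at_top"
      using eventually_ge_at_top[of z0]
    proof eventually_elim
      case (elim z)
      have "c * z powr (2 - b) \<le> tail p z * z powr b * z powr (2 - b)"
        using *[OF elim] by (intro mult_right_mono) auto
      also have "\<dots> = z\<^sup>2 * tail p z"
        using elim z0 by (simp add: powr_add[symmetric] powr_numeral)
      finally show ?case .
    qed
  qed
qed

text \<open>The other half of Karamata's theorem. The dyadic block above \<open>2 ^ m * z\<close> contributes at most
  \<open>(2 * r) ^ m * z * tail p z\<close> with \<open>r < 1 / 2\<close>, which is possible because \<open>\<alpha> > 1\<close>; the geometric series
  converges.\<close>

lemma tail_first_moment_le: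
  assumes rv: "regularly_varying \<alpha> p" and a: "1 < \<alpha>"
  obtains C where "0 < C" "integrable p real"
    "eventually (\<lambda>z. measure_pmf.expectation p (\<lambda>k. real k * indicator {k. real k > z} k) \<le> C * (z * tail p z)) at_top"
proof -
  define r :: real where "r = 2 powr (- (\<alpha> + 1) / 2)"
  have r: "2 powr (-\<alpha>) < r" "r < 1 / 2" "0 < r"
  proof -
    have "r < 2 powr (-1)" unfolding r_def using a by (intro powr_less_mono) auto
    then show "r < 1 / 2" by (simp add: powr_minus)
  qed (use a in \<open>auto simp: r_def intro!: powr_less_mono\<close>)
  obtain z0 where z0: "0 < z0" "\<And>z. z0 \<le> z \<Longrightarrow> tail p (2 * z) \<le> r * tail p z"
  proof -
    obtain N where "\<And>z. N \<le> z \<Longrightarrow> tail p (2 * z) \<le> r * tail p z"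
      using regularly_varying_eventually_le[OF rv _ r(1)] by (auto simp: eventually_at_top_linorder)
    then show ?thesis by (intro that[of "max N 1"]) auto
  qed
  define C where "C = 1 / (1 - 2 * r)"
  have C: "0 < C" "1 + C * (2 * r) = C" using r by (auto simp: C_def field_simps)
  have geo: "tail p (2 ^ m * z) \<le> r ^ m * tail p z" if "z0 \<le> z" for m z
  proof (induction m)
    case (Suc m)
    have "1 * z0 \<le> 2 ^ m * z" using that z0(1) by (intro mult_mono) auto
    then have "tail p (2 * (2 ^ m * z)) \<le> r * tail p (2 ^ m * z)" by (intro z0) auto
    also have "\<dots> \<le> r * (r ^ m * tail p z)" using Suc r by (intro mult_left_mono) auto
    finally show ?case by (simp add: algebra_simps)
  qed simp
  \<comment> \<open>\<open>D\<close> cuts the excess over \<open>z\<close> off at \<open>2 ^ m * z\<close>; its limit for \<open>m \<rightarrow> \<infinity>\<close> is the full excess.\<close>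
  define D where "D m z k = min (real k) (2 ^ m * z) - min (real k) z" for m z k
  have int: "integrable p (\<lambda>k. min (real k) z)" if "0 \<le> z" for z
    using that by (intro integrable_pmf_bounded[where C=z]) auto
  have intD: "integrable p (D m z)" if "0 \<le> z" for m z
    unfolding D_def using that by (intro Bochner_Integration.integrable_diff int) auto
  have bound: "measure_pmf.expectation p (D m z) \<le> (\<Sum>j<m. (2 * r) ^ j) * (z * tail p z)" if z: "z0 \<le> z" for m z
  proof (induction m)
    case (Suc m)
    have z': "0 \<le> z" using z z0 by simp
    have "measure_pmf.expectation p (D (Suc m) z) \<le>
      measure_pmf.expectation p (\<lambda>k. D m z k + 2 ^ m * z * indicator {k. real k > 2 ^ m * z} k)"
    proof (intro integral_mono intD Bochner_Integration.integrable_add)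
      show "integrable p (\<lambda>k. 2 ^ m * z * indicat_real {k. real k > 2 ^ m * z} k)"
        using z' by (intro integrable_pmf_bounded[where C="2 ^ m * z"]) (auto simp: indicator_def)
      have "0 \<le> 2 ^ m * z" using z' by simp
      then show "D (Suc m) z k \<le> D m z k + 2 ^ m * z * indicat_real {k. real k > 2 ^ m * z} k" for k
        by (auto simp: D_def indicator_def min_def mult.commute mult.left_commute)
    qed (use z' in auto)
    also have "\<dots> = measure_pmf.expectation p (D m z) + 2 ^ m * z * tail p (2 ^ m * z)"
      using intD[OF z', of m] z'
      by (subst Bochner_Integration.integral_add) (auto simp: tail_def integrable_indicator_pmf)
    also have "\<dots> \<le> (\<Sum>j<m. (2 * r) ^ j) * (z * tail p z) + 2 ^ m * z * (r ^ m * tail p z)"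
      using Suc geo[OF z, of m] z' by (intro add_mono mult_left_mono) auto
    finally show ?case by (simp add: algebra_simps power_mult_distrib)
  qed (simp add: D_def)
  have geosum: "(\<Sum>j<m. (2 * r) ^ j) \<le> C" for m
  proof (induction m)
    case (Suc m)
    have "(\<Sum>j<Suc m. (2 * r) ^ j) = 1 + (\<Sum>j<m. (2 * r) ^ j) * (2 * r)"
      by (subst sum.lessThan_Suc_shift) (simp add: sum_distrib_left ac_simps)
    also have "\<dots> \<le> 1 + C * (2 * r)" using Suc r by (intro add_left_mono mult_right_mono) auto
    finally show ?case using C by simp
  qed (use C in auto)
  have main: "integrable p (\<lambda>k. real k - min (real k) z) \<and>
     measure_pmf.expectation p (\<lambda>k. real k - min (real k) z) \<le> C * (z * tail p z)" if z: "z0 \<le> z" for z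
  proof -
    have z': "0 < z" using z z0 by simp
    have inc: "D m z k \<le> D m' z k" if "m \<le> m'" for m m' k
    proof -
      have "2 ^ m * z \<le> 2 ^ m' * z" using that z' by (intro mult_right_mono power_increasing) auto
      then show ?thesis by (auto simp: D_def min_def)
    qed
    have le: "measure_pmf.expectation p (D m z) \<le> C * (z * tail p z)" for m
      by (rule order_trans[OF bound[OF z] mult_right_mono[OF geosum]]) (use z' in simp)
    have incE: "incseq (\<lambda>m. measure_pmf.expectation p (D m z))"
      using z' by (intro incseq_SucI integral_mono intD inc) auto
    obtain L where L: "(\<lambda>m. measure_pmf.expectation p (D m z)) \<longlonglongrightarrow> L"
    proof (rule incseq_convergent[OF incE])
      show "\<forall>m. measure_pmf.expectation p (D m z) \<le> C * (z * tail p z)" using le by blast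
    qed (rule that)
    have "L \<le> C * (z * tail p z)" by (rule LIMSEQ_le_const2[OF L]) (use le in auto)
    moreover have lim: "(\<lambda>m. D m z k) \<longlonglongrightarrow> real k - min (real k) z" for k
    proof (rule tendsto_eventually)
      obtain m where "real k / z < 2 ^ m" using real_arch_pow[of 2 "real k / z"] by auto
      then have "real k \<le> 2 ^ m * z" using z' by (simp add: divide_simps)
      then show "eventually (\<lambda>m. D m z k = real k - min (real k) z) sequentially"
        by (intro eventually_sequentiallyI[of m])
          (metis D_def diff_left_mono dual_order.trans inc min.absorb1 min.cobounded1 order_antisym diff_right_mono)
    qed
    ultimately show ?thesis
      using integrable_monotone_convergence[of p "\<lambda>m. D m z" "\<lambda>k. real k - min (real k) z" L]
        integral_monotone_convergence[of p "\<lambda>m. D m z" "\<lambda>k. real k - min (real k) z" L]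
        intD[of z] z' inc L by (auto simp: mono_def)
  qed
  have int1: "integrable p real"
    using Bochner_Integration.integrable_add[OF main[OF order_refl, THEN conjunct1] int[of z0]] z0 by simp
  have "measure_pmf.expectation p (\<lambda>k. real k * indicator {k. real k > z} k) \<le> (C + 1) * (z * tail p z)"
    if "z0 \<le> z" for z
  proof -
    have "measure_pmf.expectation p (\<lambda>k. real k * indicator {k. real k > z} k) =
      measure_pmf.expectation p (\<lambda>k. (real k - min (real k) z) + z * indicator {k. real k > z} k)"
      by (intro Bochner_Integration.integral_cong) (auto simp: indicator_def)
    also have "\<dots> = measure_pmf.expectation p (\<lambda>k. (real k - min (real k) z)) + z * tail p z"
      using main[OF that] that z0
      by (subst Bochner_Integration.integral_add) (auto simp: tail_def integrable_indicator_pmf)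
    finally show ?thesis using main[OF that] by (simp add: algebra_simps)
  qed
  then show ?thesis
    using C(1) int1 by (intro that[of "C + 1"]) (auto simp: eventually_at_top_linorder)
qed

lemma regularly_varying_transfer:
  assumes rv: "regularly_varying \<alpha> p" and c: "c \<noteq> 0" and lim: "((\<lambda>x. tail q x / tail p x) \<longlongrightarrow> c) at_top"
  shows "regularly_varying \<alpha> q"
  unfolding regularly_varying_alt
proof (intro allI impI)
  fix s :: real assume s: "0 < s"
  have pos: "0 < tail p z" for z by (rule regularly_varying_tail_pos[OF rv])
  have "filterlim (\<lambda>x. s * x) at_top at_top"
    using s by (intro filterlim_tendsto_pos_mult_at_top[OF tendsto_const] filterlim_ident)
  from filterlim_compose[OF lim this]
  have "((\<lambda>x. (tail q (s * x) / tail p (s * x)) * (tail p (s * x) / tail p x) / (tail q x / tail p x))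
      \<longlongrightarrow> c * s powr (-\<alpha>) / c) at_top"
    using c by (intro tendsto_intros lim regularly_varyingD[OF rv s])
  moreover have "(tail q (s * x) / tail p (s * x)) * (tail p (s * x) / tail p x) / (tail q x / tail p x) =
     tail q (s * x) / tail q x" for x
    using pos[of x] pos[of "s * x"] by simp
  moreover have "c * s powr (-\<alpha>) / c = s powr (-\<alpha>)"
    using c by simp
  ultimately show "((\<lambda>x. tail q (s * x) / tail q x) \<longlongrightarrow> s powr (-\<alpha>)) at_top"
    by (simp only:)
qed

lemma regularly_varying_scaled_tail:
  assumes rv: "regularly_varying \<alpha> p" and a: "filterlim a at_top sequentially"
    and lim: "(\<lambda>n. real n * tail p (a n)) \<longlonglongrightarrow> c" and y: "0 < y"
  shows "(\<lambda>n. real n * tail p (y * a n)) \<longlonglongrightarrow> c * y powr (-\<alpha>)"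
proof -
  have pos: "0 < tail p z" for z by (rule regularly_varying_tail_pos[OF rv])
  have "(\<lambda>n. (real n * tail p (a n)) * (tail p (y * a n) / tail p (a n))) \<longlonglongrightarrow> c * y powr (-\<alpha>)"
    by (intro tendsto_mult lim filterlim_compose[OF regularly_varyingD[OF rv y] a])
  moreover have "(real n * tail p (a n)) * (tail p (y * a n) / tail p (a n)) = real n * tail p (y * a n)" for n
    using pos[of "a n"] by simp
  ultimately show ?thesis by simp
qed

section \<open>The tail of the stationary law\<close>

text \<open>Iterating the hypothesis on \<open>F\<close> yields a geometric series in \<open>rho\<close> and a term \<open>F (q ^ m * x)\<close> that
  vanishes.\<close>

lemma geometric_upper_bound:
  fixes F b :: "real \<Rightarrow> real"
  assumes q: "1 \<le> q" and rho: "0 \<le> rho" "rho < 1" and c: "0 \<le> c" and x0: "0 < x0" and x: "x0 \<le> x"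
    and F: "\<And>x. x0 \<le> x \<Longrightarrow> F x \<le> F (q * x) + c * b x"
    and b: "\<And>x. x0 \<le> x \<Longrightarrow> b (q * x) \<le> rho * b x"
    and lim: "(\<lambda>m. F (q ^ m * x)) \<longlonglongrightarrow> 0" and pos: "0 \<le> b x"
  shows "F x \<le> c * b x / (1 - rho)"
proof -
  have qm: "x0 \<le> q ^ m * x" for m
    using mult_mono[of 1 "q ^ m" x0 x] q x0 x one_le_power[OF q, of m] by auto
  have geo: "b (q ^ m * x) \<le> rho ^ m * b x" for m
  proof (induction m)
    case (Suc m)
    have "b (q * (q ^ m * x)) \<le> rho * b (q ^ m * x)" by (rule b[OF qm])
    also have "\<dots> \<le> rho * (rho ^ m * b x)" by (intro mult_left_mono Suc rho)
    finally show ?case by (simp add: mult.assoc)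
  qed simp
  have it: "F x \<le> F (q ^ m * x) + c * b x * (\<Sum>j<m. rho ^ j)" for m
  proof (induction m)
    case (Suc m)
    have "F (q ^ m * x) \<le> F (q * (q ^ m * x)) + c * b (q ^ m * x)" by (rule F[OF qm])
    also have "\<dots> \<le> F (q * (q ^ m * x)) + c * (rho ^ m * b x)"
      by (intro add_left_mono mult_left_mono geo c)
    finally show ?case using Suc by (simp add: algebra_simps)
  qed simp
  have "(\<lambda>m. F (q ^ m * x) + c * b x * (\<Sum>j<m. rho ^ j)) \<longlonglongrightarrow> 0 + c * b x * (1 / (1 - rho))"
    using rho geometric_sums[of rho] by (intro tendsto_intros lim) (auto simp: sums_def)
  from LIMSEQ_le_const[OF this] show ?thesis using it by auto
qed

text \<open>The counterpart of the upper bound; here the term left after \<open>m\<close> iterations may be dropped because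
  it is nonnegative.\<close>

lemma geometric_lower_bound:
  fixes F b :: "real \<Rightarrow> real"
  assumes q: "1 \<le> q" and rho: "0 \<le> rho" and d: "0 \<le> d" "d * rho < 1" and x0: "0 < x0" and x: "x0 \<le> x"
    and F: "\<And>x. x0 \<le> x \<Longrightarrow> d * (F (q * x) + b x) \<le> F x"
    and b: "\<And>x. x0 \<le> x \<Longrightarrow> rho * b x \<le> b (q * x)"
    and nonneg: "\<And>x. 0 \<le> F x"
  shows "d * b x / (1 - d * rho) \<le> F x"
proof -
  have it: "d * b x * (\<Sum>j<m. (d * rho) ^ j) \<le> F x" if "x0 \<le> x" for m x
    using that
  proof (induction m arbitrary: x)
    case (Suc m)
    have qx: "x0 \<le> q * x" using mult_mono[of 1 q x0 x] q x0 Suc.prems by auto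
    have "d * b x * (\<Sum>j<Suc m. (d * rho) ^ j) = d * (d * (rho * b x) * (\<Sum>j<m. (d * rho) ^ j) + b x)"
      by (subst sum.lessThan_Suc_shift) (simp add: sum_distrib_left algebra_simps)
    also have "\<dots> \<le> d * (d * b (q * x) * (\<Sum>j<m. (d * rho) ^ j) + b x)"
      using d rho by (intro mult_left_mono add_right_mono mult_right_mono b Suc.prems sum_nonneg) auto
    also have "\<dots> \<le> d * (F (q * x) + b x)"
      by (intro mult_left_mono add_right_mono Suc.IH qx d)
    also have "\<dots> \<le> F x" by (rule F[OF Suc.prems])
    finally show ?case .
  qed (simp add: nonneg)
  have "(\<lambda>m. d * b x * (\<Sum>j<m. (d * rho) ^ j)) \<longlonglongrightarrow> d * b x * (1 / (1 - d * rho))"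
    using d rho geometric_sums[of "d * rho"] by (intro tendsto_intros) (auto simp: sums_def)
  from LIMSEQ_le_const2[OF this] show ?thesis using it[OF x] by auto
qed

lemma pmf_chebyshev:
  assumes i: "integrable (measure_pmf p) (\<lambda>k. (real k)\<^sup>2)" and e: "0 < e"
  shows "measure_pmf.prob p {k. e \<le> \<bar>real k - m\<bar>} \<le> measure_pmf.expectation p (\<lambda>k. (real k - m)\<^sup>2) / e\<^sup>2"
proof -
  have i1: "integrable p real"
    by (rule measure_pmf.square_integrable_imp_integrable[OF _ i]) simp
  have "measure_pmf.prob p {k. e \<le> \<bar>real k - m\<bar>} = measure_pmf.expectation p (indicat_real {k. e \<le> \<bar>real k - m\<bar>})"
    by simp
  also have "\<dots> \<le> measure_pmf.expectation p (\<lambda>k. (real k - m)\<^sup>2 / e\<^sup>2)"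
  proof (intro integral_mono)
    show "integrable p (\<lambda>k. (real k - m)\<^sup>2 / e\<^sup>2)"
      using i i1 by (simp add: power2_diff)
    fix k show "indicat_real {k. e \<le> \<bar>real k - m\<bar>} k \<le> (real k - m)\<^sup>2 / e\<^sup>2"
      using e power_mono[of e "\<bar>real k - m\<bar>" 2] by (auto simp: indicator_def divide_simps)
  qed simp
  finally show ?thesis by simp
qed

text \<open>The distributional content of the model: a law \<open>pX\<close> that is invariant under the transition kernel.\<close>

locale gwi_law =
  fixes pA pB pX :: "nat pmf" and \<alpha> \<mu> \<sigma> \<mu>\<^sub>B :: real
  assumes \<mu>: "\<mu> = measure_pmf.expectation pA real" "0 < \<mu>" "\<mu> < 1"
    and \<sigma>: "integrable (measure_pmf pA) (\<lambda>k. (real k)\<^sup>2)" "\<sigma>\<^sup>2 = measure_pmf.variance pA real" "0 < \<sigma>"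
    and \<alpha>: "1 < \<alpha>" "\<alpha> < 2" "regularly_varying \<alpha> pB"
    and \<mu>\<^sub>B: "\<mu>\<^sub>B = measure_pmf.expectation pB real"
    and stationary: "bind_pmf pX (gwi_step pA pB) = pX"
begin

lemma integrable_B: "integrable pB real"
  using tail_first_moment_le[OF \<alpha>(3,1)] by blast

lemma \<mu>\<^sub>B_nonneg: "0 \<le> \<mu>\<^sub>B"
  by (simp add: \<mu>\<^sub>B)

lemma integrable_offspring: "integrable (offspring_sum pA x) real"
  by (rule measure_pmf.square_integrable_imp_integrable[OF _ integrable_offspring_sum_square[OF \<sigma>(1) \<mu>(1) \<sigma>(2)]]) simp

lemmas mean_offspring = expectation_offspring_sum[OF \<sigma>(1) \<mu>(1) \<sigma>(2)]
lemmas variance_offspring = variance_offspring_sum[OF \<sigma>(1) \<mu>(1) \<sigma>(2)]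
lemmas square_integrable_offspring = integrable_offspring_sum_square[OF \<sigma>(1) \<mu>(1) \<sigma>(2)]

lemma
  shows integrable_gwi_step: "integrable (gwi_step pA pB x) real"
    and mean_gwi_step: "measure_pmf.expectation (gwi_step pA pB x) real = \<mu> * x + \<mu>\<^sub>B"
proof -
  note i = integrable_pair_pmf_fst[OF integrable_offspring, of x pB]
    integrable_pair_pmf_snd[OF integrable_B, of "offspring_sum pA x"]
  show "integrable (gwi_step pA pB x) real"
    using i by (simp add: gwi_step_def case_prod_unfold)
  show "measure_pmf.expectation (gwi_step pA pB x) real = \<mu> * x + \<mu>\<^sub>B"
    using i by (simp add: gwi_step_def case_prod_unfold mean_offspring \<mu>\<^sub>B)
qed

text \<open>Since \<open>pX\<close> may have infinite mean a priori, \<open>\<mu> * E X + \<mu>\<^sub>B = E X\<close> cannot be solved for \<open>E X\<close>. Invariance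
  is applied to \<open>min x n\<close> instead: its expectation under one step is at most
  \<open>u x = min (\<mu> * x + \<mu>\<^sub>B) n\<close>, and \<open>min x n - u x\<close> is at least \<open>(1 - \<mu>) * x - \<mu>\<^sub>B\<close> for \<open>x \<le> n\<close> and
  nonnegative beyond.\<close>

lemma truncated_mean_stationary_le:
  "(1 - \<mu>) * measure_pmf.expectation pX (\<lambda>x. real x * indicator {..n} x) \<le> \<mu>\<^sub>B"
proof -
  define h where "h k = min (real k) (real n)" for k
  have h: "\<bar>h k\<bar> \<le> real n" for k by (auto simp: h_def)
  define u where "u x = min (\<mu> * real x + \<mu>\<^sub>B) (real n)" for x
  have u: "\<bar>u x\<bar> \<le> real n" for x using \<mu> \<mu>\<^sub>B_nonneg by (auto simp: u_def)
  have ih: "integrable p h" for p :: "nat pmf" by (rule integrable_pmf_bounded) (use h in auto)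
  have iu: "integrable pX u" by (rule integrable_pmf_bounded) (use u in auto)
  have ii: "integrable pX (\<lambda>x. real x * indicat_real {..n} x)"
    by (rule integrable_pmf_bounded[where C="real n"]) (auto simp: indicator_def)
  have step: "measure_pmf.expectation (gwi_step pA pB x) h \<le> u x" for x
  proof -
    have "measure_pmf.expectation (gwi_step pA pB x) h \<le> \<mu> * x + \<mu>\<^sub>B"
      unfolding mean_gwi_step[symmetric] by (intro integral_mono ih integrable_gwi_step) (auto simp: h_def)
    moreover have "measure_pmf.expectation (gwi_step pA pB x) h \<le> real n"
      using norm_expectation_le[of h "real n" "gwi_step pA pB x"] h by auto
    ultimately show ?thesis by (simp add: u_def)
  qed
  have "measure_pmf.expectation pX h = measure_pmf.expectation pX (\<lambda>x. measure_pmf.expectation (gwi_step pA pB x) h)"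
    using expectation_bind_pmf_real[OF h, of pX "gwi_step pA pB"] by (simp add: stationary)
  also have "\<dots> \<le> measure_pmf.expectation pX u"
    by (intro integral_mono iu step integrable_pmf_bounded[where C="real n"] norm_expectation_le) (use h in auto)
  finally have 1: "measure_pmf.expectation pX h \<le> measure_pmf.expectation pX u" .
  have "measure_pmf.expectation pX (\<lambda>x. (1 - \<mu>) * (real x * indicator {..n} x) - \<mu>\<^sub>B) \<le> measure_pmf.expectation pX (\<lambda>x. h x - u x)"
  proof (intro integral_mono)
    fix x
    show "(1 - \<mu>) * (real x * indicat_real {..n} x) - \<mu>\<^sub>B \<le> h x - u x"
      using \<mu> \<mu>\<^sub>B_nonneg by (auto simp: h_def u_def indicator_def min_def algebra_simps)
  qed (use ih iu ii in auto)
  also have "\<dots> \<le> 0" using 1 ih iu by simp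
  finally show ?thesis using ii by simp
qed

lemma integrable_X: "integrable pX real"
proof -
  let ?f = "\<lambda>n x. real x * indicat_real {..n::nat} x"
  let ?E = "\<lambda>n. measure_pmf.expectation pX (?f n)"
  have i: "integrable pX (?f n)" for n
    by (rule integrable_pmf_bounded[where C="real n"]) (auto simp: indicator_def)
  have mono: "?f n x \<le> ?f m x" if "n \<le> m" for n m x
    using that by (auto simp: indicator_def)
  have le: "?E n \<le> \<mu>\<^sub>B / (1 - \<mu>)" for n
    using truncated_mean_stationary_le[of n] \<mu> by (simp add: field_simps)
  have incE: "incseq ?E"
    by (intro incseq_SucI integral_mono i mono) auto
  obtain L where L: "?E \<longlonglongrightarrow> L"
  proof (rule incseq_convergent[OF incE])
    show "\<forall>n. ?E n \<le> \<mu>\<^sub>B / (1 - \<mu>)" using le by blast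
  qed (rule that)
  show ?thesis
  proof (rule integrable_monotone_convergence[OF i _ _ L])
    show "AE x in pX. mono (\<lambda>n. ?f n x)" using mono by (auto simp: mono_def)
    show "AE x in pX. (\<lambda>n. ?f n x) \<longlonglongrightarrow> real x"
    proof (intro AE_I2 tendsto_eventually)
      fix x show "eventually (\<lambda>n. ?f n x = real x) sequentially"
        by (intro eventually_sequentiallyI[of x]) (auto simp: indicator_def)
    qed
  qed simp
qed

text \<open>The law of the part of the population that descends from the previous generation.\<close>

definition offspring_law :: "nat pmf" where
  "offspring_law = bind_pmf pX (offspring_sum pA)"

lemma stationary_decomposition:
  "pX = map_pmf (\<lambda>(s, b). s + b) (pair_pmf offspring_law pB)"
proof -
  have "map_pmf (\<lambda>(s, b). s + b) (pair_pmf offspring_law pB) = bind_pmf pX (gwi_step pA pB)"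
    unfolding gwi_step_def offspring_law_def pair_pmf_def
    by (simp add: map_bind_pmf bind_assoc_pmf)
  then show ?thesis by (simp add: stationary)
qed

lemma prob_pair_tails:
  "measure_pmf.prob (pair_pmf p q) {(s, b). real s > u \<and> real b > v} = tail p u * tail q v"
proof -
  have "{(s, b). real s > u \<and> real b > v} = {s::nat. real s > u} \<times> {b::nat. real b > v}" by auto
  then show ?thesis
    unfolding tail_def by (simp only:) (rule measure_pmf_prob_product, auto)
qed

lemma prob_pair_tail_fst: "measure_pmf.prob (pair_pmf p q) {(s, b::nat). real (s::nat) > u} = tail p u"
proof -
  have "{(s, b::nat). real (s::nat) > u} = fst -` {s. real s > u}" by auto
  then show ?thesis
    using measure_map_pmf[of fst "pair_pmf p q" "{s. real s > u}"] by (simp only: map_fst_pair_pmf tail_def)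
qed

lemma prob_pair_tail_snd: "measure_pmf.prob (pair_pmf p q) {(s::nat, b). real (b::nat) > u} = tail q u"
proof -
  have "{(s::nat, b). real (b::nat) > u} = snd -` {s. real s > u}" by auto
  then show ?thesis
    using measure_map_pmf[of snd "pair_pmf p q" "{s. real s > u}"] by (simp only: map_snd_pair_pmf tail_def)
qed

lemma tail_stationary:
  "tail pX x = measure_pmf.prob (pair_pmf offspring_law pB) {(s, b). real s + real b > x}"
  unfolding tail_def by (subst stationary_decomposition) (auto intro!: arg_cong[where f="measure_pmf.prob _"])

lemma tail_offspring_law:
  "tail offspring_law y = measure_pmf.expectation pX (\<lambda>x. tail (offspring_sum pA x) y)"
  unfolding tail_eq_expectation offspring_law_def
  by (rule expectation_bind_pmf_real[where C=1]) (auto simp: indicator_def)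

text \<open>If the parent generation is at most \<open>(1 - d) / \<mu> * y\<close>, the offspring sum exceeds \<open>y\<close> only by deviating
  from its mean by \<open>d * y\<close>; Chebyshev's inequality bounds that.\<close>

lemma tail_offspring_law_le:
  assumes d: "0 < d" "d < 1" and y: "0 < y"
  shows "tail offspring_law y \<le> tail pX ((1 - d) / \<mu> * y) + \<sigma>\<^sup>2 * measure_pmf.expectation pX real / (d\<^sup>2 * y\<^sup>2)"
proof -
  let ?S = "{k. real k > (1 - d) / \<mu> * y}"
  have "tail offspring_law y \<le> measure_pmf.expectation pX (\<lambda>x. indicator ?S x + \<sigma>\<^sup>2 * real x / (d\<^sup>2 * y\<^sup>2))"
    unfolding tail_offspring_law
  proof (intro integral_mono)
    fix x :: nat
    show "tail (offspring_sum pA x) y \<le> indicat_real ?S x + \<sigma>\<^sup>2 * real x / (d\<^sup>2 * y\<^sup>2)"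
    proof (cases "x \<in> ?S")
      case True
      then show ?thesis using tail_le_1[of "offspring_sum pA x" y] by (simp add: add_increasing2)
    next
      case False
      then have "\<mu> * x \<le> (1 - d) * y" using \<mu> by (simp add: field_simps)
      then have "tail (offspring_sum pA x) y \<le> measure_pmf.prob (offspring_sum pA x) {k. d * y \<le> \<bar>real k - \<mu> * x\<bar>}"
        unfolding tail_def by (intro measure_pmf.finite_measure_mono) (auto simp: algebra_simps)
      also have "\<dots> \<le> \<sigma>\<^sup>2 * real x / (d * y)\<^sup>2"
        using pmf_chebyshev[OF square_integrable_offspring[of x], of "d * y" "\<mu> * x"] d y
        by (simp add: variance_offspring)
      finally show ?thesis using False by (simp add: power_mult_distrib)
    qed
  qed (use integrable_X in \<open>auto intro!: integrable_pmf_bounded[where C=1]\<close>)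
  also have "\<dots> = tail pX ((1 - d) / \<mu> * y) + \<sigma>\<^sup>2 * measure_pmf.expectation pX real / (d\<^sup>2 * y\<^sup>2)"
    using integrable_X by (subst Bochner_Integration.integral_add) (auto simp: tail_def)
  finally show ?thesis .
qed

text \<open>Conversely, a parent generation above \<open>(1 + d) / \<mu> * y\<close> has an offspring sum above \<open>y\<close> except with the
  Chebyshev probability.\<close>

lemma tail_offspring_law_ge:
  assumes d: "0 < d" and y: "0 < y"
  shows "(1 - \<sigma>\<^sup>2 * (1 + d) / (\<mu> * d\<^sup>2 * y)) * tail pX ((1 + d) / \<mu> * y) \<le> tail offspring_law y"
proof -
  let ?S = "{k. real k > (1 + d) / \<mu> * y}"
  have "(1 - \<sigma>\<^sup>2 * (1 + d) / (\<mu> * d\<^sup>2 * y)) * tail pX ((1 + d) / \<mu> * y) =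
    measure_pmf.expectation pX (\<lambda>x. (1 - \<sigma>\<^sup>2 * (1 + d) / (\<mu> * d\<^sup>2 * y)) * indicator ?S x)"
    by (simp add: tail_def)
  also have "\<dots> \<le> tail offspring_law y"
    unfolding tail_offspring_law
  proof (intro integral_mono)
    fix x :: nat
    show "(1 - \<sigma>\<^sup>2 * (1 + d) / (\<mu> * d\<^sup>2 * y)) * indicat_real ?S x \<le> tail (offspring_sum pA x) y"
    proof (cases "x \<in> ?S")
      case True
      then have x: "y < \<mu> * x / (1 + d)" "0 < real x"
        using \<mu>(2) d y add_pos_pos[of y "d * y"] by (auto simp: field_simps intro!: Nat.gr0I)
      define e where "e = \<mu> * x * d / (1 + d)"
      have e: "0 < e" using x \<mu> d by (auto simp: e_def)
      have e': "e = \<mu> * x - \<mu> * x / (1 + d)" using d by (simp add: e_def field_simps)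
      have "1 - tail (offspring_sum pA x) y = measure_pmf.prob (offspring_sum pA x) (- {k. real k > y})"
        unfolding tail_def using measure_pmf.prob_compl[of "{k. real k > y}" "offspring_sum pA x"]
        by (simp add: Compl_eq_Diff_UNIV)
      also have "\<dots> \<le> measure_pmf.prob (offspring_sum pA x) {k. e \<le> \<bar>real k - \<mu> * x\<bar>}"
        using x e' by (intro measure_pmf.finite_measure_mono) auto
      also have "\<dots> \<le> \<sigma>\<^sup>2 * real x / e\<^sup>2"
        using pmf_chebyshev[OF square_integrable_offspring[of x], of e "\<mu> * x"] e
        by (simp add: variance_offspring)
      also have "\<dots> = \<sigma>\<^sup>2 * (1 + d) / (\<mu> * d\<^sup>2) * ((1 + d) / (\<mu> * x))"
        using x d \<mu> by (simp add: e_def power2_eq_square field_simps)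
      also have "\<dots> \<le> \<sigma>\<^sup>2 * (1 + d) / (\<mu> * d\<^sup>2) * (1 / y)"
        using x d \<mu> y by (intro mult_left_mono) (auto simp: field_simps)
      finally show ?thesis using True by simp
    qed auto
  qed (auto intro!: integrable_pmf_bounded[where C=1] integrable_indicator_pmf)
  finally show ?thesis .
qed

lemma tail_B_pos: "0 < tail pB x"
  by (rule regularly_varying_tail_pos[OF \<alpha>(3)])

text \<open>For the sum of two independent variables to exceed \<open>x\<close>, one of them exceeds \<open>(1 - d) * x\<close> or both
  exceed \<open>d * x\<close>. The last event and the Chebyshev error are negligible against the tail of \<open>B\<close>, the
  error because \<open>\<alpha> < 2\<close>.\<close>

lemma tail_upper_recursion:
  assumes d: "0 < d" "d < 1" and c: "(1 - d) powr (-\<alpha>) < c"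
  shows "eventually (\<lambda>x. tail pX x \<le> tail pX ((1 - d)\<^sup>2 / \<mu> * x) + c * tail pB x) at_top"
proof -
  define D where "D = \<sigma>\<^sup>2 * measure_pmf.expectation pX real / (d\<^sup>2 * (1 - d)\<^sup>2)"
  \<comment> \<open>\<open>h x\<close> collects everything that will be charged to the tail of \<open>B\<close>.\<close>
  define h where "h x = D / (x\<^sup>2 * tail pB x) + tail pB ((1 - d) * x) / tail pB x
      + tail offspring_law (d * x) * (tail pB (d * x) / tail pB x)" for x
  have dx: "filterlim (\<lambda>x. d * x) at_top at_top"
    using d by (intro filterlim_tendsto_pos_mult_at_top[OF tendsto_const] filterlim_ident)
  have "(h \<longlongrightarrow> 0 + (1 - d) powr (-\<alpha>) + 0 * d powr (-\<alpha>)) at_top"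
    unfolding h_def
    by (intro tendsto_intros regularly_varyingD[OF \<alpha>(3)] tendsto_divide_0[OF tendsto_const]
      filterlim_compose[OF tail_tendsto_0 dx]
      filterlim_at_top_imp_at_infinity square_times_tail_at_top[OF \<alpha>(3,2)]) (use d in auto)
  then have "eventually (\<lambda>x. h x < c) at_top"
    using c by (intro order_tendstoD) auto
  then show ?thesis
    using eventually_gt_at_top[of 0]
  proof eventually_elim
    case (elim x)
    let ?P = "measure_pmf.prob (pair_pmf offspring_law pB)"
    have "tail pX x \<le> ?P ({(s, b). real s > (1 - d) * x} \<union> {(s, b). real b > (1 - d) * x}
        \<union> {(s, b). real s > d * x \<and> real b > d * x})"
      unfolding tail_stationary by (intro measure_pmf.finite_measure_mono) (auto simp: algebra_simps)
    also have "\<dots> \<le> ?P {(s, b). real s > (1 - d) * x} + ?P {(s, b). real b > (1 - d) * x}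
        + ?P {(s, b). real s > d * x \<and> real b > d * x}"
      by (intro order_trans[OF measure_Un_le] add_mono) auto
    also have "\<dots> = tail offspring_law ((1 - d) * x) + tail pB ((1 - d) * x)
        + tail offspring_law (d * x) * tail pB (d * x)"
      by (simp only: prob_pair_tails prob_pair_tail_fst prob_pair_tail_snd)
    also have "tail offspring_law ((1 - d) * x) \<le> tail pX ((1 - d) / \<mu> * ((1 - d) * x)) + D / x\<^sup>2"
      using tail_offspring_law_le[OF d, of "(1 - d) * x"] d elim by (simp add: D_def power_mult_distrib mult_ac)
    also have "(1 - d) / \<mu> * ((1 - d) * x) = (1 - d)\<^sup>2 / \<mu> * x" by (simp add: power2_eq_square)
    finally have "tail pX x \<le> tail pX ((1 - d)\<^sup>2 / \<mu> * x) + h x * tail pB x"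
      using tail_B_pos[of x] elim by (simp add: h_def algebra_simps)
    also have "\<dots> \<le> tail pX ((1 - d)\<^sup>2 / \<mu> * x) + c * tail pB x"
      using elim by (intro add_left_mono mult_right_mono) auto
    finally show ?case .
  qed
qed

lemma tail_lower_recursion:
  assumes d: "0 < d" "d < 1"
  shows "eventually (\<lambda>x. (1 - d) * (tail pX ((1 + d) / \<mu> * x) + tail pB x) \<le> tail pX x) at_top"
proof -
  define D where "D = \<sigma>\<^sup>2 * (1 + d) / (\<mu> * d\<^sup>2)"
  have "((\<lambda>x. (1 - tail pB x) * (1 - D / x)) \<longlongrightarrow> (1 - 0) * (1 - 0)) at_top"
    by (intro tendsto_intros tail_tendsto_0 tendsto_divide_0[OF tendsto_const]
      filterlim_at_top_imp_at_infinity filterlim_ident)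
  then have "eventually (\<lambda>x. 1 - d < (1 - tail pB x) * (1 - D / x)) at_top"
    using d by (intro order_tendstoD) auto
  then show ?thesis
    using eventually_gt_at_top[of 0]
  proof eventually_elim
    case (elim x)
    let ?P = "measure_pmf.prob (pair_pmf offspring_law pB)"
    have "(1 - d) * tail pX ((1 + d) / \<mu> * x) \<le> (1 - tail pB x) * (1 - D / x) * tail pX ((1 + d) / \<mu> * x)"
      using elim by (intro mult_right_mono) auto
    also have "\<dots> \<le> (1 - tail pB x) * tail offspring_law x"
      using tail_offspring_law_ge[OF d(1), of x] elim
      by (simp only: mult.assoc, intro mult_left_mono) (auto simp: D_def)
    finally have 1: "(1 - d) * tail pX ((1 + d) / \<mu> * x) \<le> (1 - tail pB x) * tail offspring_law x" .
    have 2: "(1 - d) * tail pB x \<le> tail pB x" using d by (simp add: mult_left_le_one_le)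
    have "tail offspring_law x + tail pB x - tail offspring_law x * tail pB x =
      ?P {(s, b). real s > x} + ?P {(s, b). real b > x} - ?P ({(s, b). real s > x} \<inter> {(s, b). real b > x})"
      by (simp only: prob_pair_tail_fst prob_pair_tail_snd prob_pair_tails[symmetric])
         (auto intro!: arg_cong[where f="?P"])
    also have "\<dots> = ?P ({(s, b). real s > x} \<union> {(s, b). real b > x})"
      by (subst measure_pmf.finite_measure_Union') (auto simp: measure_pmf.finite_measure_Diff' Int_commute)
    also have "\<dots> \<le> tail pX x"
      unfolding tail_stationary by (intro measure_pmf.finite_measure_mono) auto
    finally show ?case using 1 2 by (simp add: algebra_simps)
  qed
qed

text \<open>Unrolling \<open>tail pX x \<approx> tail pX (x / \<mu>) + tail pB x\<close> gives the sum of the tails of \<open>B\<close> at \<open>x / \<mu> ^ j\<close>,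
  each about \<open>\<mu> powr (\<alpha> * j)\<close> times the tail at \<open>x\<close>: a geometric series with ratio \<open>\<mu> powr \<alpha>\<close>. The
  recursions hold with a small slack \<open>d\<close>, and \<open>U d\<close> is the bound obtained with that slack; it tends to
  the claimed constant for \<open>d \<rightarrow> 0\<close>.\<close>

theorem tail_ratio: "((\<lambda>x. tail pX x / tail pB x) \<longlongrightarrow> 1 / (1 - \<mu> powr \<alpha>)) at_top"
proof (rule order_tendstoI)
  have mua: "\<mu> powr \<alpha> < 1" using \<mu>(2,3) \<alpha>(1) powr_less_mono2[of \<alpha> \<mu> 1] by auto
  have small: "eventually (\<lambda>d::real. 0 < d \<and> d < 1) (at_right 0)"
    by (auto simp: eventually_at_right[of 0 1] intro!: exI[of _ 1])
  {
    fix u :: real assume u: "1 / (1 - \<mu> powr \<alpha>) < u"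
    define U where "U d = ((1 - d) powr (-\<alpha>) + d) / (1 - (((1 - d)\<^sup>2 / \<mu>) powr (-\<alpha>) + d))" for d :: real
    have q: "((\<lambda>d. (1 - d)\<^sup>2 / \<mu>) \<longlongrightarrow> (1 - 0)\<^sup>2 / \<mu>) (at_right 0)"
      using \<mu> by (intro tendsto_intros) auto
    have rho: "((\<lambda>d. ((1 - d)\<^sup>2 / \<mu>) powr (-\<alpha>) + d) \<longlongrightarrow> ((1 - 0)\<^sup>2 / \<mu>) powr (-\<alpha>) + 0) (at_right 0)"
      using \<mu> by (intro tendsto_intros q) auto
    have e: "((1 - 0)\<^sup>2 / \<mu>) powr (-\<alpha>) = \<mu> powr \<alpha>" using \<mu> by (simp add: powr_minus powr_divide)
    have "(U \<longlongrightarrow> ((1 - 0) powr (-\<alpha>) + 0) / (1 - (((1 - 0)\<^sup>2 / \<mu>) powr (-\<alpha>) + 0))) (at_right 0)"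
      unfolding U_def using \<mu> mua by (intro tendsto_intros rho) (auto simp: e[simplified])
    then have "eventually (\<lambda>d. U d < u) (at_right 0)"
      using u e by (intro order_tendstoD) auto
    moreover have "eventually (\<lambda>d. 1 < (1 - d)\<^sup>2 / \<mu>) (at_right 0)"
      using \<mu> by (intro order_tendstoD(1)[OF q]) auto
    moreover have "eventually (\<lambda>d. ((1 - d)\<^sup>2 / \<mu>) powr (-\<alpha>) + d < 1) (at_right 0)"
      using mua e by (intro order_tendstoD(2)[OF rho]) auto
    ultimately have "eventually (\<lambda>d. U d < u \<and> 1 < (1 - d)\<^sup>2 / \<mu> \<and> ((1 - d)\<^sup>2 / \<mu>) powr (-\<alpha>) + d < 1 \<and> 0 < d \<and> d < 1) (at_right 0)"
      using small by eventually_elim auto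
    then obtain d where d: "U d < u" "1 < (1 - d)\<^sup>2 / \<mu>" "((1 - d)\<^sup>2 / \<mu>) powr (-\<alpha>) + d < 1" "0 < d" "d < 1"
      by (metis (mono_tags, lifting) eventually_happens' trivial_limit_at_right_real)
    define q where "q = (1 - d)\<^sup>2 / \<mu>"
    define c where "c = (1 - d) powr (-\<alpha>) + d"
    have q1: "1 < q" using d(2) by (simp add: q_def)
    have "eventually (\<lambda>x. 0 < x \<and> tail pX x \<le> tail pX (q * x) + c * tail pB x \<and>
        tail pB (q * x) \<le> (q powr (-\<alpha>) + d) * tail pB x) at_top"
      using eventually_gt_at_top[of 0] tail_upper_recursion[of d c]
        regularly_varying_eventually_le[OF \<alpha>(3), of q "q powr (-\<alpha>) + d"]
      using d by (auto simp: q_def c_def elim: eventually_elim2 intro: eventually_conj)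
    then obtain x0 where x0: "\<And>x. x0 \<le> x \<Longrightarrow> 0 < x \<and> tail pX x \<le> tail pX (q * x) + c * tail pB x \<and>
        tail pB (q * x) \<le> (q powr (-\<alpha>) + d) * tail pB x"
      by (auto simp: eventually_at_top_linorder)
    show "eventually (\<lambda>x. tail pX x / tail pB x < u) at_top"
      using eventually_ge_at_top[of x0]
    proof eventually_elim
      case (elim x)
      have xpos: "0 < x" using x0[OF elim] by simp
      have lim: "(\<lambda>m. tail pX (q ^ m * x)) \<longlonglongrightarrow> 0"
      proof (intro filterlim_compose[OF tail_tendsto_0] filterlim_at_top_mult_tendsto_pos[OF tendsto_const xpos])
        show "filterlim (\<lambda>m. q ^ m) at_top sequentially"
          using q1 by (intro filterlim_at_infinity_imp_filterlim_at_top filterlim_realpow_sequentially_gt1) auto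
      qed
      have "tail pX x \<le> c * tail pB x / (1 - (q powr (-\<alpha>) + d))"
        by (rule geometric_upper_bound[of q _ c x0]) (use x0 elim d lim in \<open>auto simp: q_def c_def\<close>)
      also have "\<dots> = U d * tail pB x" by (simp add: U_def q_def c_def)
      also have "\<dots> < u * tail pB x" using d tail_B_pos[of x] by simp
      finally show ?case using tail_B_pos[of x] by (simp add: field_simps)
    qed
  }
  {
    fix u :: real assume u: "u < 1 / (1 - \<mu> powr \<alpha>)"
    define U where "U d = (1 - d) / (1 - (1 - d) * (((1 + d) / \<mu>) powr (-\<alpha>) - d))" for d :: real
    have q: "((\<lambda>d. (1 + d) / \<mu>) \<longlongrightarrow> (1 + 0) / \<mu>) (at_right 0)"
      using \<mu> by (intro tendsto_intros) auto
    have rho: "((\<lambda>d. ((1 + d) / \<mu>) powr (-\<alpha>) - d) \<longlongrightarrow> ((1 + 0) / \<mu>) powr (-\<alpha>) - 0) (at_right 0)"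
      using \<mu> by (intro tendsto_intros q) auto
    have e: "((1 + 0) / \<mu>) powr (-\<alpha>) = \<mu> powr \<alpha>" using \<mu> by (simp add: powr_minus powr_divide)
    have "(U \<longlongrightarrow> (1 - 0) / (1 - (1 - 0) * (((1 + 0) / \<mu>) powr (-\<alpha>) - 0))) (at_right 0)"
      unfolding U_def using \<mu> mua by (intro tendsto_intros rho) (auto simp: e[simplified])
    then have "eventually (\<lambda>d. u < U d) (at_right 0)"
      using u e by (intro order_tendstoD) auto
    moreover have "eventually (\<lambda>d. 0 < ((1 + d) / \<mu>) powr (-\<alpha>) - d) (at_right 0)"
      using \<mu> e by (intro order_tendstoD(1)[OF rho]) auto
    ultimately have "eventually (\<lambda>d. u < U d \<and> 0 < ((1 + d) / \<mu>) powr (-\<alpha>) - d \<and> 0 < d \<and> d < 1) (at_right 0)"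
      using small by eventually_elim auto
    then obtain d where d: "u < U d" "0 < ((1 + d) / \<mu>) powr (-\<alpha>) - d" "0 < d" "d < 1"
      by (metis (mono_tags, lifting) eventually_happens' trivial_limit_at_right_real)
    define q where "q = (1 + d) / \<mu>"
    define r where "r = q powr (-\<alpha>) - d"
    have q1: "1 < q" using d \<mu> by (simp add: q_def field_simps)
    have r1: "r < 1" using powr_less_mono2_neg[of "-\<alpha>" 1 q] q1 \<alpha> d by (simp add: r_def)
    have dr: "(1 - d) * r < 1"
      using mult_strict_mono[of "1 - d" 1 r 1] d r1 by (auto simp: r_def q_def)
    have "eventually (\<lambda>x. 0 < x \<and> (1 - d) * (tail pX (q * x) + tail pB x) \<le> tail pX x \<and>
        r * tail pB x \<le> tail pB (q * x)) at_top"
      using eventually_gt_at_top[of 0] tail_lower_recursion[of d]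
        regularly_varying_eventually_ge[OF \<alpha>(3), of q r] d q1
      by (auto simp: q_def r_def intro: eventually_conj)
    then obtain x0 where x0: "\<And>x. x0 \<le> x \<Longrightarrow> 0 < x \<and> (1 - d) * (tail pX (q * x) + tail pB x) \<le> tail pX x \<and>
        r * tail pB x \<le> tail pB (q * x)"
      by (auto simp: eventually_at_top_linorder)
    show "eventually (\<lambda>x. u < tail pX x / tail pB x) at_top"
      using eventually_ge_at_top[of x0]
    proof eventually_elim
      case (elim x)
      have "u * tail pB x < U d * tail pB x" using d tail_B_pos[of x] by simp
      also have "\<dots> = (1 - d) * tail pB x / (1 - (1 - d) * r)" by (simp add: U_def q_def r_def)
      also have "\<dots> \<le> tail pX x"
        by (rule geometric_lower_bound[of q r "1 - d" x0]) (use x0 elim d q1 dr in \<open>auto simp: r_def q_def\<close>)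
      finally show ?case using tail_B_pos[of x] by (simp add: field_simps)
    qed
  }
qed

lemma regularly_varying_X: "regularly_varying \<alpha> pX"
  using \<mu>(2,3) \<alpha>(1) powr_less_mono2[of \<alpha> \<mu> 1] by (intro regularly_varying_transfer[OF \<alpha>(3) _ tail_ratio]) auto

end

section \<open>Convergence to the stable Levy measure\<close>

lemma integral_uniform_measure:
  fixes f :: "'a \<Rightarrow> 'b::{banach, second_countable_topology}"
  assumes A: "emeasure M A \<noteq> 0" "emeasure M A \<noteq> \<infinity>" and f[measurable]: "f \<in> borel_measurable M"
  shows "(LINT x|uniform_measure M A. f x) = (LINT x|M. indicator A x *\<^sub>R f x) /\<^sub>R measure M A"
proof -
  have [measurable]: "A \<in> sets M" by (rule emeasure_neq_0_sets[OF A(1)])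
  have m: "0 < measure M A" "emeasure M A = ennreal (measure M A)"
    using A by (simp_all add: emeasure_eq_ennreal_measure zero_less_measure_iff)
  have "uniform_measure M A = density M (\<lambda>x. ennreal (indicator A x / measure M A))"
    unfolding uniform_measure_def m(2)
    by (intro density_cong) (use m divide_ennreal[of 1 "measure M A"] in \<open>auto simp: indicator_def\<close>)
  then have "(LINT x|uniform_measure M A. f x) = (LINT x|M. (indicator A x / measure M A) *\<^sub>R f x)"
    using m by (simp add: integral_density)
  also have "\<dots> = (LINT x|M. (indicator A x *\<^sub>R f x) /\<^sub>R measure M A)"
    by (intro Bochner_Integration.integral_cong) (auto simp: divide_inverse mult.commute)
  also have "\<dots> = (LINT x|M. indicator A x *\<^sub>R f x) /\<^sub>R measure M A"
    by (rule integral_scaleR_right)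
  finally show ?thesis .
qed

text \<open>The Levy measure of a one-sided stable law, scaled so that \<open>{c<..}\<close> has mass \<open>c powr (- \<alpha>)\<close>.\<close>

definition stable_levy :: "real \<Rightarrow> real measure" where
  "stable_levy \<alpha> = density lborel (\<lambda>y. ennreal (indicator {0<..} y * (\<alpha> * y powr (- \<alpha> - 1))))"

lemma sets_stable_levy [measurable_cong, simp]: "sets (stable_levy \<alpha>) = sets borel"
  and space_stable_levy [simp]: "space (stable_levy \<alpha>) = UNIV"
  by (simp_all add: stable_levy_def)

lemma emeasure_stable_levy_tail:
  assumes a: "0 < \<alpha>" and c: "0 < c"
  shows "emeasure (stable_levy \<alpha>) {c<..} = ennreal (c powr (-\<alpha>))"
proof -
  have "emeasure (stable_levy \<alpha>) {c<..} = (\<integral>\<^sup>+y. ennreal (indicator {0<..} y * (\<alpha> * y powr (- \<alpha> - 1))) * indicator {c<..} y \<partial>lborel)"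
    unfolding stable_levy_def by (subst emeasure_density) auto
  also have "\<dots> = (\<integral>\<^sup>+y. ennreal (\<alpha> * y powr (- \<alpha> - 1)) * indicator {c..} y \<partial>lborel)"
  proof (rule nn_integral_cong_AE)
    show "AE y in lborel. ennreal (indicator {0<..} y * (\<alpha> * y powr (- \<alpha> - 1))) * indicator {c<..} y =
        ennreal (\<alpha> * y powr (- \<alpha> - 1)) * indicator {c..} y"
      using AE_lborel_singleton[of c] by eventually_elim (use c in \<open>auto simp: indicator_def\<close>)
  qed
  also have "\<dots> = ennreal (0 - (- (c powr (-\<alpha>))))"
  proof (rule nn_integral_FTC_atLeast)
    show "((\<lambda>y. - (y powr (-\<alpha>))) has_real_derivative \<alpha> * x powr (- \<alpha> - 1)) (at x)" if "c \<le> x" for x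
      using that c by (auto intro!: derivative_eq_intros simp: powr_diff)
    have "((\<lambda>y::real. y powr (-\<alpha>)) \<longlongrightarrow> 0) at_top"
      using a by (intro tendsto_neg_powr filterlim_ident) auto
    from tendsto_minus[OF this] show "((\<lambda>y. - (y powr (-\<alpha>))) \<longlongrightarrow> 0) at_top" by simp
  qed (use a in auto)
  finally show ?thesis by simp
qed

lemma measure_stable_levy_tail:
  "0 < \<alpha> \<Longrightarrow> 0 < c \<Longrightarrow> measure (stable_levy \<alpha>) {c<..} = c powr (-\<alpha>)"
  by (simp add: measure_def emeasure_stable_levy_tail)

lemma AE_stable_levy_pos: "AE y in stable_levy \<alpha>. 0 < y"
proof -
  have "AE y in lborel. 0 < ennreal (indicator {0<..} y * (\<alpha> * y powr (- \<alpha> - 1))) \<longrightarrow> 0 < y"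
    by (rule AE_I2) (simp add: indicator_def)
  then show ?thesis
    unfolding stable_levy_def by (subst AE_density) measurable
qed

lemma nn_integral_stable_levy_square:
  assumes a: "0 < \<alpha>" "\<alpha> < 2" and c: "0 < c"
  shows "(\<integral>\<^sup>+y. ennreal (y\<^sup>2) * indicator {..c} y \<partial>stable_levy \<alpha>) = ennreal (\<alpha> * c powr (2 - \<alpha>) / (2 - \<alpha>))"
proof -
  have "(\<integral>\<^sup>+y. ennreal (y\<^sup>2) * indicator {..c} y \<partial>stable_levy \<alpha>) =
     (\<integral>\<^sup>+y. ennreal (\<alpha> * y powr (1 - \<alpha>)) * indicator {0..c} y \<partial>lborel)"
    unfolding stable_levy_def
  proof (subst nn_integral_density)
    have "y powr (-\<alpha> - 1) * y\<^sup>2 = y powr (1 - \<alpha>)" if "0 < y" for y :: real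
      using that powr_add[of y "-\<alpha> - 1" 2] by (simp add: powr_numeral)
    then have "ennreal (indicator {0<..} y * (\<alpha> * y powr (- \<alpha> - 1))) * (ennreal (y\<^sup>2) * indicator {..c} y) =
        ennreal (\<alpha> * y powr (1 - \<alpha>)) * indicator {0..c} y" for y
      using a by (auto simp: indicator_def ennreal_mult'[symmetric] mult.assoc)
    then show "(\<integral>\<^sup>+y. ennreal (indicator {0<..} y * (\<alpha> * y powr (- \<alpha> - 1))) * (ennreal (y\<^sup>2) * indicator {..c} y) \<partial>lborel) =
        (\<integral>\<^sup>+y. ennreal (\<alpha> * y powr (1 - \<alpha>)) * indicator {0..c} y \<partial>lborel)"
      by simp
  qed auto
  also have "\<dots> = ennreal (\<alpha> * (c powr (1 - \<alpha> + 1) / (1 - \<alpha> + 1)))"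
  proof (rule nn_integral_has_integral_lebesgue')
    have "((\<lambda>x. \<alpha> * x powr (1 - \<alpha>)) has_integral \<alpha> * (c powr (1 - \<alpha> + 1) / (1 - \<alpha> + 1))) {0..c}"
      by (intro has_integral_mult_right has_integral_powr_from_0) (use a c in auto)
    then show "((\<lambda>x. \<alpha> * x powr (1 - \<alpha>)) has_integral \<alpha> * (c powr (1 - \<alpha> + 1) / (1 - \<alpha> + 1))) {0..c}" .
  qed (use a in auto)
  finally show ?thesis by simp
qed

lemma
  fixes G :: "real \<Rightarrow> complex"
  assumes a: "0 < \<alpha>" "\<alpha> < 2" and [measurable]: "G \<in> borel_measurable borel"
    and G1: "\<And>y. 0 \<le> y \<Longrightarrow> norm (G y) \<le> C" and G2: "\<And>y. 0 \<le> y \<Longrightarrow> norm (G y) \<le> C * y\<^sup>2"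
  shows integrable_stable_levy: "integrable (stable_levy \<alpha>) G"
    and integral_stable_levy_small: "0 < e \<Longrightarrow>
      norm (LINT y|stable_levy \<alpha>. indicator {..e} y *\<^sub>R G y) \<le> C * (\<alpha> * e powr (2 - \<alpha>) / (2 - \<alpha>))"
proof -
  have C0: "0 \<le> C" using order_trans[OF norm_ge_zero G1[of 0]] by simp
  have sm: "(\<integral>\<^sup>+y. ennreal (norm (indicator {..e} y *\<^sub>R G y)) \<partial>stable_levy \<alpha>) \<le> ennreal (C * (\<alpha> * e powr (2 - \<alpha>) / (2 - \<alpha>)))"
    if e: "0 < e" for e
  proof -
    have "(\<integral>\<^sup>+y. ennreal (norm (indicator {..e} y *\<^sub>R G y)) \<partial>stable_levy \<alpha>) \<le>
      (\<integral>\<^sup>+y. ennreal C * (ennreal (y\<^sup>2) * indicator {..e} y) \<partial>stable_levy \<alpha>)"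
    proof (rule nn_integral_mono_AE)
      show "AE y in stable_levy \<alpha>. ennreal (norm (indicator {..e} y *\<^sub>R G y)) \<le> ennreal C * (ennreal (y\<^sup>2) * indicator {..e} y)"
        using AE_stable_levy_pos
      proof eventually_elim
        case (elim y)
        have "ennreal (norm (G y)) \<le> ennreal (C * y\<^sup>2)" using G2[of y] elim by (intro ennreal_leI) auto
        also have "\<dots> = ennreal C * ennreal (y\<^sup>2)" using C0 by (rule ennreal_mult')
        finally show ?case by (simp add: indicator_def)
      qed
    qed
    also have "\<dots> = ennreal C * ennreal (\<alpha> * e powr (2 - \<alpha>) / (2 - \<alpha>))"
      by (subst nn_integral_cmult) (auto simp: nn_integral_stable_levy_square[OF a e])
    also have "\<dots> = ennreal (C * (\<alpha> * e powr (2 - \<alpha>) / (2 - \<alpha>)))" using C0 by (rule ennreal_mult'[symmetric])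
    finally show ?thesis .
  qed
  have i1: "integrable (stable_levy \<alpha>) (\<lambda>y. indicator {..e} y *\<^sub>R G y)" if e: "0 < e" for e
    using sm[OF e] by (intro integrableI_bounded) (auto intro: le_less_trans)
  show "norm (LINT y|stable_levy \<alpha>. indicator {..e} y *\<^sub>R G y) \<le> C * (\<alpha> * e powr (2 - \<alpha>) / (2 - \<alpha>))" if e: "0 < e"
  proof -
    have "ennreal (norm (LINT y|stable_levy \<alpha>. indicator {..e} y *\<^sub>R G y)) \<le> ennreal (C * (\<alpha> * e powr (2 - \<alpha>) / (2 - \<alpha>)))"
      using order_trans[OF integral_norm_bound_ennreal[OF i1[OF e]] sm[OF e]] .
    then show ?thesis by (subst (asm) ennreal_le_iff) (use a C0 in auto)
  qed
  have i2: "integrable (stable_levy \<alpha>) (\<lambda>y. indicator {1<..} y *\<^sub>R G y)"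
  proof (rule Bochner_Integration.integrable_bound)
    have "emeasure (stable_levy \<alpha>) {1<..} < \<infinity>" using a by (simp add: emeasure_stable_levy_tail)
    then show "integrable (stable_levy \<alpha>) (\<lambda>y. C * indicator {1<..} y)" by (simp add: integrable_indicator_iff)
    show "AE y in stable_levy \<alpha>. norm (indicator {1<..} y *\<^sub>R G y) \<le> norm (C * indicator {1<..} y)"
      using C0 G1 by (intro AE_I2) (auto simp: indicator_def)
  qed auto
  have "integrable (stable_levy \<alpha>) (\<lambda>y. indicator {..1} y *\<^sub>R G y + indicator {1<..} y *\<^sub>R G y)"
    using i1[of 1] i2 by simp
  also have "(\<lambda>y. indicator {..1} y *\<^sub>R G y + indicator {1<..} y *\<^sub>R G y) = G"
    by (auto simp: indicator_def)
  finally show "integrable (stable_levy \<alpha>) G" .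
qed

text \<open>Translates between distribution functions, in which weak convergence is defined, and upper tails,
  in which regular variation is.\<close>

lemma cdf_eq_1_minus_tail:
  assumes "real_distribution N"
  shows "cdf N x = 1 - measure N {x<..}"
proof -
  interpret real_distribution N by fact
  have "{x<..} = space N - {..x}" by auto
  then have "measure N {x<..} = 1 - measure N {..x}" by (simp add: prob_compl del: space_eq_univ)
  then show ?thesis by (simp add: cdf_def)
qed

text \<open>Conditioned on exceeding \<open>e * a n\<close>, the rescaled law has tail ratios of \<open>p\<close> as its tail function, so
  regular variation is the asserted convergence, read at every point.\<close>

lemma weak_conv_conditioned_tail:
  assumes rv: "regularly_varying \<alpha> p" and al: "0 < \<alpha>" and a: "filterlim a at_top sequentially" and e: "0 < e"
  defines "N \<equiv> (\<lambda>n. distr (uniform_measure (measure_pmf p) {k. real k > e * a n}) borel (\<lambda>k. real k / a n))"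
  shows "\<And>n. real_distribution (N n)" "real_distribution (uniform_measure (stable_levy \<alpha>) {e<..})"
    "weak_conv_m N (uniform_measure (stable_levy \<alpha>) {e<..})"
proof -
  have pos: "0 < tail p x" for x by (rule regularly_varying_tail_pos[OF rv])
  have ne: "emeasure p {k. real k > x} \<noteq> 0" "emeasure p {k. real k > x} \<noteq> \<infinity>" for x
    using pos[of x] by (simp_all add: measure_pmf.emeasure_eq_measure tail_def)
  interpret U: prob_space "uniform_measure (measure_pmf p) {k. real k > e * a n}" for n
    by (rule prob_space_uniform_measure[OF ne])
  show rN: "real_distribution (N n)" for n
    unfolding N_def by (rule U.real_distribution_distr) simp
  have nn: "emeasure (stable_levy \<alpha>) {e<..} \<noteq> 0" "emeasure (stable_levy \<alpha>) {e<..} \<noteq> \<infinity>"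
    using al e by (simp_all add: emeasure_stable_levy_tail)
  interpret L: prob_space "uniform_measure (stable_levy \<alpha>) {e<..}"
    by (rule prob_space_uniform_measure[OF nn])
  show rL: "real_distribution (uniform_measure (stable_levy \<alpha>) {e<..})"
    by unfold_locales auto
  have L: "measure (uniform_measure (stable_levy \<alpha>) {e<..}) {x<..} = (max x e / e) powr (-\<alpha>)" for x
  proof -
    have "measure (uniform_measure (stable_levy \<alpha>) {e<..}) {x<..} =
        measure (stable_levy \<alpha>) ({e<..} \<inter> {x<..}) / measure (stable_levy \<alpha>) {e<..}"
      using nn by (subst measure_uniform_measure) auto
    also have "{e<..} \<inter> {x<..} = {max x e<..}" by auto
    finally show ?thesis using al e by (simp add: measure_stable_levy_tail powr_divide)
  qed
  have N: "eventually (\<lambda>n. measure (N n) {x<..} = tail p (max x e / e * (e * a n)) / tail p (e * a n)) sequentially" for x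
  proof -
    have "eventually (\<lambda>n. 0 < a n) sequentially"
      using a by (auto simp: filterlim_at_top_dense)
    then show ?thesis
    proof eventually_elim
      case (elim n)
      have "measure (N n) {x<..} = measure p ({k. real k > e * a n} \<inter> {k. real k / a n > x}) / measure p {k. real k > e * a n}"
        unfolding N_def using ne by (subst measure_distr) (auto simp: vimage_def Int_def)
      also have "{k. real k > e * a n} \<inter> {k. real k / a n > x} = {k. real k > max x e * a n}"
        using elim by (auto simp: pos_less_divide_eq max_def)
           (smt (verit) mult_right_mono)+
      finally show ?case using e by (simp add: tail_def)
    qed
  qed
  show "weak_conv_m N (uniform_measure (stable_levy \<alpha>) {e<..})"
    unfolding weak_conv_m_def weak_conv_def
  proof (intro allI impI)
    fix x
    have ea: "filterlim (\<lambda>n. e * a n) at_top sequentially"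
      by (intro filterlim_tendsto_pos_mult_at_top[OF tendsto_const] e a)
    have "(\<lambda>n. tail p (max x e / e * (e * a n)) / tail p (e * a n)) \<longlonglongrightarrow> (max x e / e) powr (-\<alpha>)"
      using e by (intro filterlim_compose[OF regularly_varyingD[OF rv] ea]) auto
    then have "(\<lambda>n. measure (N n) {x<..}) \<longlonglongrightarrow> (max x e / e) powr (-\<alpha>)"
      unfolding tendsto_cong[OF N[of x]] .
    then show "(\<lambda>n. cdf (N n) x) \<longlonglongrightarrow> cdf (uniform_measure (stable_levy \<alpha>) {e<..}) x"
      unfolding cdf_eq_1_minus_tail[OF rL] cdf_eq_1_minus_tail[OF rN] L
      by (intro tendsto_intros)
  qed
qed

text \<open>Values above \<open>e * a n\<close> converge by weak convergence of the conditioned laws. Values below are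
  controlled on both sides by the quadratic bound on \<open>G\<close>: their contribution is of order
  \<open>e powr (2 - \<alpha>)\<close>, by Karamata's theorem for \<open>p\<close> and by direct integration for the Levy measure.
  Finally \<open>e \<rightarrow> 0\<close>.\<close>

theorem scaled_expectation_tendsto_levy_integral:
  fixes G :: "real \<Rightarrow> complex"
  assumes rv: "regularly_varying \<alpha> p" and al: "0 < \<alpha>" "\<alpha> < 2"
    and a: "filterlim a at_top sequentially" and lim: "(\<lambda>n. real n * tail p (a n)) \<longlonglongrightarrow> \<kappa>"
    and G: "\<And>y. isCont G y" and G1: "\<And>y. norm (G y) \<le> C" and G2: "\<And>y. 0 \<le> y \<Longrightarrow> norm (G y) \<le> C * y\<^sup>2"
  shows "(\<lambda>n. of_nat n * measure_pmf.expectation p (\<lambda>k. G (real k / a n))) \<longlonglongrightarrow>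
     of_real \<kappa> * (LINT y|stable_levy \<alpha>. G y)"
proof -
  have pos: "0 < tail p x" for x by (rule regularly_varying_tail_pos[OF rv])
  have [measurable]: "G \<in> borel_measurable borel"
    by (intro borel_measurable_continuous_onI continuous_at_imp_continuous_on ballI G)
  have C0: "0 \<le> C" using order_trans[OF norm_ge_zero G1[of 0]] by simp
  have \<kappa>: "0 \<le> \<kappa>" by (rule LIMSEQ_le_const[OF lim]) auto
  have intG: "integrable (stable_levy \<alpha>) G"
    by (rule integrable_stable_levy[OF al]) (use G1 G2 in auto)
  define big where "big e n = of_nat n * measure_pmf.expectation p (\<lambda>k. indicator {k. real k > e * a n} k *\<^sub>R G (real k / a n))" for e n
  define sml where "sml e n = of_nat n * measure_pmf.expectation p (\<lambda>k. indicator {k. real k \<le> e * a n} k *\<^sub>R G (real k / a n))" for e n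
  have intp: "integrable p (\<lambda>k. indicat_real S k *\<^sub>R G (real k / z))" for S z
    by (rule integrable_pmf_bounded[where C=C]) (use G1 C0 in \<open>auto simp: indicator_def\<close>)
  have split: "of_nat n * measure_pmf.expectation p (\<lambda>k. G (real k / a n)) = big e n + sml e n" for e n
  proof -
    have "measure_pmf.expectation p (\<lambda>k. G (real k / a n)) = measure_pmf.expectation p
       (\<lambda>k. indicat_real {k. real k > e * a n} k *\<^sub>R G (real k / a n) + indicat_real {k. real k \<le> e * a n} k *\<^sub>R G (real k / a n))"
      by (intro Bochner_Integration.integral_cong) (auto simp: indicator_def)
    then show ?thesis using intp by (simp add: big_def sml_def algebra_simps)
  qed
  have splitL: "(LINT y|stable_levy \<alpha>. G y) = (LINT y|stable_levy \<alpha>. indicator {e<..} y *\<^sub>R G y) + (LINT y|stable_levy \<alpha>. indicator {..e} y *\<^sub>R G y)" for e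
  proof -
    have "(LINT y|stable_levy \<alpha>. G y) = (LINT y|stable_levy \<alpha>. indicat_real {e<..} y *\<^sub>R G y + indicat_real {..e} y *\<^sub>R G y)"
      by (intro Bochner_Integration.integral_cong) (auto simp: indicator_def)
    then show ?thesis
      using integrable_mult_indicator[OF _ intG, of "{e<..}"] integrable_mult_indicator[OF _ intG, of "{..e}"] by simp
  qed
  have big: "big e \<longlonglongrightarrow> of_real \<kappa> * (LINT y|stable_levy \<alpha>. indicator {e<..} y *\<^sub>R G y)" if e: "0 < e" for e
  proof -
    let ?N = "\<lambda>n. distr (uniform_measure (measure_pmf p) {k. real k > e * a n}) borel (\<lambda>k. real k / a n)"
    note wc = weak_conv_conditioned_tail[OF rv al(1) a e]
    have "(\<lambda>n. integral\<^sup>L (?N n) G) \<longlonglongrightarrow> integral\<^sup>L (uniform_measure (stable_levy \<alpha>) {e<..}) G"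
      by (rule weak_conv_imp_integral_bdd_continuous_conv[OF wc G G1])
    moreover have "integral\<^sup>L (?N n) G =
      measure_pmf.expectation p (\<lambda>k. indicator {k. real k > e * a n} k *\<^sub>R G (real k / a n)) /\<^sub>R tail p (e * a n)" for n
      using pos[of "e * a n"]
      by (subst integral_distr) (auto simp: integral_uniform_measure measure_pmf.emeasure_eq_measure tail_def)
    moreover have "integral\<^sup>L (uniform_measure (stable_levy \<alpha>) {e<..}) G = (LINT y|stable_levy \<alpha>. indicator {e<..} y *\<^sub>R G y) /\<^sub>R (e powr (-\<alpha>))"
      using e al by (subst integral_uniform_measure) (auto simp: emeasure_stable_levy_tail measure_stable_levy_tail)
    ultimately have 1: "(\<lambda>n. measure_pmf.expectation p (\<lambda>k. indicat_real {k. real k > e * a n} k *\<^sub>R G (real k / a n)) /\<^sub>R tail p (e * a n))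
       \<longlonglongrightarrow> (LINT y|stable_levy \<alpha>. indicator {e<..} y *\<^sub>R G y) /\<^sub>R (e powr (-\<alpha>))"
      by simp
    have "(\<lambda>n. (real n * tail p (e * a n)) *\<^sub>R (measure_pmf.expectation p (\<lambda>k. indicat_real {k. real k > e * a n} k *\<^sub>R G (real k / a n)) /\<^sub>R tail p (e * a n)))
       \<longlonglongrightarrow> (\<kappa> * e powr (-\<alpha>)) *\<^sub>R ((LINT y|stable_levy \<alpha>. indicator {e<..} y *\<^sub>R G y) /\<^sub>R (e powr (-\<alpha>)))"
      by (intro tendsto_scaleR 1 regularly_varying_scaled_tail[OF rv a lim e])
    moreover have "(real n * tail p (e * a n)) *\<^sub>R (measure_pmf.expectation p (\<lambda>k. indicat_real {k. real k > e * a n} k *\<^sub>R G (real k / a n)) /\<^sub>R tail p (e * a n)) = big e n" for n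
      using pos[of "e * a n"] by (simp add: big_def scaleR_conv_of_real)
    moreover have "(\<kappa> * e powr (-\<alpha>)) *\<^sub>R (z /\<^sub>R (e powr (-\<alpha>))) = of_real \<kappa> * z" for z :: complex
      using e by (simp add: scaleR_conv_of_real[symmetric])
    ultimately show ?thesis by simp
  qed
  obtain D where D: "0 < D" "eventually (\<lambda>z. measure_pmf.expectation p (\<lambda>k. (min (real k) z)\<^sup>2) \<le> D * (z\<^sup>2 * tail p z)) at_top"
    by (rule truncated_second_moment_le[OF rv al(2)])
  have sml: "eventually (\<lambda>n. norm (sml e n) \<le> C * D * e\<^sup>2 * (\<kappa> * e powr (-\<alpha>) + e powr (-\<alpha>))) sequentially" if e: "0 < e" for e
  proof -
    have ea: "filterlim (\<lambda>n. e * a n) at_top sequentially"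
      by (intro filterlim_tendsto_pos_mult_at_top[OF tendsto_const] e a)
    have "eventually (\<lambda>n. 0 < a n) sequentially"
      using a by (auto simp: filterlim_at_top_dense)
    moreover have "eventually (\<lambda>n. real n * tail p (e * a n) < \<kappa> * e powr (-\<alpha>) + e powr (-\<alpha>)) sequentially"
      using e by (intro order_tendstoD(2)[OF regularly_varying_scaled_tail[OF rv a lim e]]) auto
    ultimately show ?thesis
      using eventually_compose_filterlim[OF D(2) ea]
    proof eventually_elim
      case (elim n)
      have "norm (measure_pmf.expectation p (\<lambda>k. indicat_real {k. real k \<le> e * a n} k *\<^sub>R G (real k / a n))) \<le>
        measure_pmf.expectation p (\<lambda>k. C / (a n)\<^sup>2 * (min (real k) (e * a n))\<^sup>2)"
      proof (rule order_trans[OF integral_norm_bound], rule integral_mono)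
        show "integrable p (\<lambda>k. C / (a n)\<^sup>2 * (min (real k) (e * a n))\<^sup>2)"
          using elim e by (intro integrable_mult_right integrable_pmf_bounded[where C="(e * a n)\<^sup>2"]) (auto intro!: power_mono)
        fix k show "norm (indicat_real {k. real k \<le> e * a n} k *\<^sub>R G (real k / a n)) \<le> C / (a n)\<^sup>2 * (min (real k) (e * a n))\<^sup>2"
          using G2[of "real k / a n"] elim C0 by (auto simp: indicator_def power_divide)
      qed (intro integrable_norm intp)
      also have "\<dots> \<le> C / (a n)\<^sup>2 * (D * ((e * a n)\<^sup>2 * tail p (e * a n)))"
        using elim C0 by (simp only: integral_mult_right_zero, intro mult_left_mono) auto
      also have "\<dots> = C * D * e\<^sup>2 * tail p (e * a n)"
        using elim by (simp add: power_mult_distrib)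
      finally have "norm (sml e n) \<le> real n * (C * D * e\<^sup>2 * tail p (e * a n))"
        unfolding sml_def norm_mult by (intro mult_mono) auto
      also have "\<dots> = C * D * e\<^sup>2 * (real n * tail p (e * a n))" by simp
      also have "\<dots> \<le> C * D * e\<^sup>2 * (\<kappa> * e powr (-\<alpha>) + e powr (-\<alpha>))"
        using elim C0 D by (intro mult_left_mono) auto
      finally show ?case .
    qed
  qed
  \<comment> \<open>\<open>E e\<close> bounds the contribution of small values to both sides.\<close>
  define E where "E e = C * D * (\<kappa> + 1) * e powr (2 - \<alpha>) + \<kappa> * (C * (\<alpha> * e powr (2 - \<alpha>) / (2 - \<alpha>)))" for e
  have "(E \<longlongrightarrow> C * D * (\<kappa> + 1) * 0 + \<kappa> * (C * (\<alpha> * 0 / (2 - \<alpha>)))) (at_right 0)"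
  proof -
    have "((\<lambda>e. e powr (2 - \<alpha>)) \<longlongrightarrow> 0 powr (2 - \<alpha>)) (at_right 0)"
      using al by (intro tendsto_powr2 tendsto_intros) (auto simp: eventually_at_right_less eventually_at_right[of 0 1] intro!: exI[of _ 1])
    then have *: "((\<lambda>e. e powr (2 - \<alpha>)) \<longlongrightarrow> 0) (at_right 0)" by simp
    show ?thesis unfolding E_def using al by (intro tendsto_intros *) auto
  qed
  then have E: "(E \<longlongrightarrow> 0) (at_right 0)" by simp
  show ?thesis
  proof (rule LIMSEQ_I)
    fix r :: real assume r: "0 < r"
    have "eventually (\<lambda>e. E e < r / 2 \<and> 0 < e) (at_right 0)"
      using r by (intro eventually_conj order_tendstoD(2)[OF E] eventually_at_right_less) auto
    then obtain e where e: "E e < r / 2" "0 < e"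
      by (metis (mono_tags, lifting) eventually_happens' trivial_limit_at_right_real)
    have "eventually (\<lambda>n. norm (big e n - of_real \<kappa> * (LINT y|stable_levy \<alpha>. indicator {e<..} y *\<^sub>R G y)) < r / 2) sequentially"
      using tendstoD[OF big[OF e(2)], of "r / 2"] r by (simp add: dist_norm)
    then have "eventually (\<lambda>n. norm (of_nat n * measure_pmf.expectation p (\<lambda>k. G (real k / a n)) - of_real \<kappa> * (LINT y|stable_levy \<alpha>. G y)) < r) sequentially"
      using sml[OF e(2)]
    proof eventually_elim
      case (elim n)
      let ?s = "of_real \<kappa> * (LINT y|stable_levy \<alpha>. indicator {..e} y *\<^sub>R G y)"
      have s: "norm ?s \<le> \<kappa> * (C * (\<alpha> * e powr (2 - \<alpha>) / (2 - \<alpha>)))"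
        unfolding norm_mult norm_of_real abs_of_nonneg[OF \<kappa>]
        by (rule mult_left_mono[OF integral_stable_levy_small[OF al _ G1 G2 e(2)] \<kappa>]) measurable
      have m: "norm (sml e n) \<le> C * D * (\<kappa> + 1) * e powr (2 - \<alpha>)"
      proof -
        have "e\<^sup>2 * e powr (-\<alpha>) = e powr (2 - \<alpha>)" using e powr_add[of e 2 "-\<alpha>"] by (simp add: powr_numeral)
        then have "C * D * e\<^sup>2 * (\<kappa> * e powr (-\<alpha>) + e powr (-\<alpha>)) = C * D * (\<kappa> + 1) * e powr (2 - \<alpha>)"
          by (simp add: algebra_simps)
        with elim show ?thesis by simp
      qed
      have "of_nat n * measure_pmf.expectation p (\<lambda>k. G (real k / a n)) - of_real \<kappa> * (LINT y|stable_levy \<alpha>. G y)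
        = (big e n - of_real \<kappa> * (LINT y|stable_levy \<alpha>. indicator {e<..} y *\<^sub>R G y)) + sml e n - ?s"
        unfolding split[of n e] splitL[of e] by (simp add: algebra_simps)
      also have "norm \<dots> < r / 2 + E e"
      proof -
        have *: "norm (u + v - w) \<le> norm u + norm v + norm w" for u v w :: complex
          by (rule order_trans[OF norm_triangle_ineq4 add_right_mono[OF norm_triangle_ineq]])
        show ?thesis using elim m s unfolding E_def by (intro le_less_trans[OF *]) linarith
      qed
      finally show ?case using e by simp
    qed
    then show "\<exists>no. \<forall>n\<ge>no. norm (of_nat n * measure_pmf.expectation p (\<lambda>k. G (real k / a n)) - of_real \<kappa> * (LINT y|stable_levy \<alpha>. G y)) < r"
      by (simp add: eventually_sequentially)
  qed
qed

section \<open>The characteristic function of a cluster\<close>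

text \<open>Conditional on its height \<open>y\<close>, a jump contributes a multiple of \<open>y\<^sup>2\<close> to the denominator and a centred
  Gaussian amount with variance proportional to \<open>y\<^sup>3\<close> to the numerator; this is the characteristic
  function of the pair. The absolute value makes it bounded on the whole line, while only \<open>y \<ge> 0\<close> has
  a meaning.\<close>

definition cluster_cf :: "real \<Rightarrow> real \<Rightarrow> real \<Rightarrow> complex" where
  "cluster_cf s v y = exp (\<i> * of_real (s * y\<^sup>2) - of_real (v * \<bar>y\<bar> ^ 3))"

lemma norm_cluster_cf: "0 \<le> v \<Longrightarrow> norm (cluster_cf s v y) \<le> 1"
  by (simp add: cluster_cf_def)

lemma cluster_cf_0 [simp]: "cluster_cf s v 0 = 1"
  by (simp add: cluster_cf_def)

lemma isCont_cluster_cf: "isCont (cluster_cf s v) y"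
  unfolding cluster_cf_def by (intro continuous_intros)

lemma cluster_cf_mult:
  "cluster_cf s v y = iexp (s * y\<^sup>2) * of_real (exp (- (v * \<bar>y\<bar> ^ 3)))"
  by (simp add: cluster_cf_def exp_diff exp_of_real[symmetric] exp_minus divide_inverse del: exp_of_real)

lemma norm_iexp_diff_le: "norm (iexp x - iexp y) \<le> \<bar>x - y\<bar>"
proof -
  have "iexp x - iexp y = iexp y * (iexp (x - y) - 1)"
    by (simp add: algebra_simps exp_add[symmetric])
  then have "norm (iexp x - iexp y) = norm (iexp (x - y) - 1)"
    by (simp add: norm_mult)
  also have "\<dots> \<le> \<bar>x - y\<bar>"
    using iexp_approx1[of "x - y" 0] by simp
  finally show ?thesis .
qed

text \<open>Lipschitz continuity in \<open>y\<^sup>2\<close> rather than in \<open>y\<close> matches the second moments that truncation at the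
  scale \<open>a n\<close> makes available. For the Gaussian factor it amounts to \<open>exp (- v * y ^ 3) + D * y\<^sup>2\<close> being
  nondecreasing, which holds as \<open>v * x * exp (- v * x ^ 3) \<le> v + 1\<close>.\<close>

lemma cluster_cf_lipschitz_square:
  assumes v: "0 \<le> v" and y: "0 \<le> y" and z: "0 \<le> z"
  shows "norm (cluster_cf s v y - cluster_cf s v z) \<le> (\<bar>s\<bar> + 3 / 2 * (v + 1)) * \<bar>y\<^sup>2 - z\<^sup>2\<bar>"
proof -
  define D where "D = 3 / 2 * (v + 1)"
  have *: "norm (cluster_cf s v y - cluster_cf s v z) \<le> (\<bar>s\<bar> + D) * (z\<^sup>2 - y\<^sup>2)" if "0 \<le> y" "y \<le> z" for y z
  proof -
    define f where "f y = exp (- (v * y ^ 3)) + D * y\<^sup>2" for y :: real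
    have "f y \<le> f z"
    proof (rule DERIV_nonneg_imp_nondecreasing[OF \<open>y \<le> z\<close>])
      fix x assume x: "y \<le> x" "x \<le> z"
      then have x0: "0 \<le> x" using that by simp
      have "(f has_real_derivative (- (v * (3 * x\<^sup>2)) * exp (- (v * x ^ 3)) + D * (2 * x))) (at x)"
        unfolding f_def by (auto intro!: derivative_eq_intros simp: power2_eq_square)
      moreover have "v * x * exp (- (v * x ^ 3)) \<le> v + 1"
      proof (cases "x \<le> 1")
        case True
        have "v * x * exp (- (v * x ^ 3)) \<le> v * 1 * 1"
          using True x0 v by (intro mult_mono) auto
        then show ?thesis by simp
      next
        case False
        have "v * x * exp (- (v * x ^ 3)) \<le> v * x ^ 3 * exp (- (v * x ^ 3))"
          using False v by (intro mult_right_mono mult_left_mono) (auto simp: power3_eq_cube intro!: mult_ge1_I)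
        also have "\<dots> \<le> exp (v * x ^ 3) * exp (- (v * x ^ 3))"
          by (rule mult_right_mono) (use exp_ge_add_one_self[of "v * x ^ 3"] in linarith, simp)
        also have "\<dots> = 1" by (simp add: exp_add[symmetric])
        finally show ?thesis using v by simp
      qed
      then have "3 * x * (v * x * exp (- (v * x ^ 3))) \<le> 3 * x * (v + 1)"
        using x0 by (intro mult_left_mono) auto
      then have "0 \<le> - (v * (3 * x\<^sup>2)) * exp (- (v * x ^ 3)) + D * (2 * x)"
        by (simp add: D_def power2_eq_square algebra_simps)
      ultimately show "\<exists>d. (f has_real_derivative d) (at x) \<and> 0 \<le> d" by blast
    qed
    then have 1: "exp (- (v * y ^ 3)) - exp (- (v * z ^ 3)) \<le> D * (z\<^sup>2 - y\<^sup>2)"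
      by (simp add: f_def algebra_simps)
    have 2: "exp (- (v * z ^ 3)) \<le> exp (- (v * y ^ 3))"
      using that v by (auto intro!: mult_left_mono power_mono)
    have 3: "y\<^sup>2 \<le> z\<^sup>2" using that by (intro power_mono) auto
    have "cluster_cf s v y - cluster_cf s v z = (iexp (s * y\<^sup>2) - iexp (s * z\<^sup>2)) * of_real (exp (- (v * y ^ 3)))
        + iexp (s * z\<^sup>2) * of_real (exp (- (v * y ^ 3)) - exp (- (v * z ^ 3)))"
      using that by (simp add: cluster_cf_mult algebra_simps)
    also have "norm \<dots> \<le> norm (iexp (s * y\<^sup>2) - iexp (s * z\<^sup>2)) * exp (- (v * y ^ 3))
        + \<bar>exp (- (v * y ^ 3)) - exp (- (v * z ^ 3))\<bar>"
      by (intro order_trans[OF norm_triangle_ineq] add_mono) (simp_all add: norm_mult del: of_real_diff)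
    also have "\<dots> \<le> \<bar>s * y\<^sup>2 - s * z\<^sup>2\<bar> * 1 + D * (z\<^sup>2 - y\<^sup>2)"
      using 1 2 that v by (intro add_mono mult_mono norm_iexp_diff_le) auto
    also have "\<bar>s * y\<^sup>2 - s * z\<^sup>2\<bar> = \<bar>s\<bar> * (z\<^sup>2 - y\<^sup>2)"
      using 3 by (simp add: right_diff_distrib[symmetric] abs_mult)
    finally show ?thesis by (simp add: algebra_simps)
  qed
  show ?thesis
  proof (cases "y \<le> z")
    case True
    then have "y\<^sup>2 \<le> z\<^sup>2" using y by (intro power_mono) auto
    then show ?thesis using *[OF y True] by (simp add: D_def)
  next
    case False
    then have "z\<^sup>2 \<le> y\<^sup>2" using z by (intro power_mono) auto
    then show ?thesis using *[OF z, of y] False by (simp add: D_def norm_minus_commute)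
  qed
qed

text \<open>The principle of a single big jump: the error is bounded by the product of the two heights, which
  is small unless both are large. For \<open>h \<le> b\<close> both \<open>\<bar>(h + b)\<^sup>2 - b\<^sup>2\<bar>\<close> and \<open>h\<^sup>2\<close> are at most a multiple of
  \<open>h * b\<close>.\<close>

lemma cluster_cf_add:
  assumes v: "0 \<le> v" and h: "0 \<le> h" and b: "0 \<le> b"
  shows "norm (cluster_cf s v (h + b) - cluster_cf s v h * cluster_cf s v b) \<le> 4 * (\<bar>s\<bar> + 3 / 2 * (v + 1)) * (h * b)"
proof -
  define L where "L = \<bar>s\<bar> + 3 / 2 * (v + 1)"
  have L: "0 \<le> L" using v by (simp add: L_def)
  let ?g = "cluster_cf s v"
  have *: "norm (?g (h + b) - ?g h * ?g b) \<le> 4 * L * (h * b)" if "0 \<le> h" "h \<le> b" for h b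
  proof -
    have "?g (h + b) - ?g h * ?g b = (?g (h + b) - ?g b) + (?g 0 - ?g h) * ?g b"
      by (simp add: algebra_simps)
    also have "norm \<dots> \<le> norm (?g (h + b) - ?g b) + norm (?g 0 - ?g h) * norm (?g b)"
      by (rule order_trans[OF norm_triangle_ineq]) (simp add: norm_mult)
    also have "\<dots> \<le> L * \<bar>(h + b)\<^sup>2 - b\<^sup>2\<bar> + L * \<bar>0\<^sup>2 - h\<^sup>2\<bar> * 1"
      unfolding L_def using that v norm_cluster_cf[OF v]
      by (intro add_mono mult_mono cluster_cf_lipschitz_square) auto
    also have "\<dots> = 2 * L * (h * h) + 2 * L * (h * b)"
      using that by (simp add: power2_eq_square algebra_simps)
    also have "\<dots> \<le> 2 * L * (h * b) + 2 * L * (h * b)"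
      using that L by (intro add_right_mono mult_left_mono) auto
    finally show ?thesis by (simp only: mult_2[symmetric] mult.assoc[symmetric])
  qed
  show ?thesis
  proof (cases "h \<le> b")
    case True
    then show ?thesis using *[OF h True] by (simp only: L_def)
  next
    case False
    then have "b \<le> h" by simp
    from *[OF b this] show ?thesis
      by (simp only: L_def add.commute[of b h] mult.commute[of b h] mult.commute[of "?g b" "?g h"])
  qed
qed

text \<open>The error, divided by \<open>l\<^sup>2\<close>, in replacing a centred characteristic function at \<open>l\<close> by the Gaussian
  one: the first summand comes from the second-order Taylor expansion, the second from replacing
  \<open>1 - v * l\<^sup>2 / 2\<close> by \<open>exp (- v * l\<^sup>2 / 2)\<close>.\<close>

definition clt_remainder :: "nat pmf \<Rightarrow> real \<Rightarrow> real \<Rightarrow> real \<Rightarrow> real" where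
  "clt_remainder p m v l = measure_pmf.expectation p (\<lambda>k. min (6 * (real k - m)\<^sup>2) (l * \<bar>real k - m\<bar> ^ 3)) / 6 + v\<^sup>2 * l\<^sup>2 / 8"

lemma
  assumes i2: "integrable (measure_pmf p) (\<lambda>k. (real k)\<^sup>2)"
    and m: "m = measure_pmf.expectation p real"
    and v: "v = measure_pmf.variance p real"
  shows cf_gaussian_approx: "\<bar>l\<bar> \<le> l0 \<Longrightarrow>
      norm (measure_pmf.expectation p (\<lambda>k. iexp (l * (real k - m))) - of_real (exp (- (v * l\<^sup>2 / 2)))) \<le> l\<^sup>2 * clt_remainder p m v l0"
    and clt_remainder_tendsto_0: "(\<And>n. 0 \<le> L n) \<Longrightarrow> L \<longlonglongrightarrow> 0 \<Longrightarrow> (\<lambda>n. clt_remainder p m v (L n)) \<longlonglongrightarrow> 0"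
proof -
  have i1: "integrable p real"
    by (rule measure_pmf.square_integrable_imp_integrable[OF _ i2]) simp
  have ic: "integrable p (\<lambda>k. (real k - m)\<^sup>2)" using i1 i2 by (simp add: power2_diff)
  have v0: "0 \<le> v" by (simp add: v)
  have im: "integrable p (\<lambda>k. min (6 * (real k - m)\<^sup>2) (l * \<bar>real k - m\<bar> ^ 3))" if "0 \<le> l" for l
    by (rule Bochner_Integration.integrable_bound[of _ "\<lambda>k. 6 * (real k - m)\<^sup>2"]) (use ic that in auto)
  show "norm (measure_pmf.expectation p (\<lambda>k. iexp (l * (real k - m))) - of_real (exp (- (v * l\<^sup>2 / 2)))) \<le> l\<^sup>2 * clt_remainder p m v l0"
    if l: "\<bar>l\<bar> \<le> l0"
  proof -
    let ?X = "\<lambda>k. real k - m"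
    have EX: "measure_pmf.expectation p ?X = 0" using i1 by (simp add: m)
    have "norm (char (distr p borel ?X) l - (1 - l\<^sup>2 * v / 2)) \<le>
       l\<^sup>2 / 6 * measure_pmf.expectation p (\<lambda>k. min (6 * (?X k)\<^sup>2) (\<bar>l\<bar> * \<bar>?X k\<bar> ^ 3))"
      by (rule prob_space.char_approx3'[OF prob_space_measure_pmf]) (use i1 ic EX v m in auto)
    also have "\<dots> \<le> l\<^sup>2 / 6 * measure_pmf.expectation p (\<lambda>k. min (6 * (?X k)\<^sup>2) (l0 * \<bar>?X k\<bar> ^ 3))"
      using l by (intro mult_left_mono integral_mono im min.mono mult_right_mono) auto
    finally have 1: "norm (measure_pmf.expectation p (\<lambda>k. iexp (l * ?X k)) - (1 - l\<^sup>2 * v / 2)) \<le>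
      l\<^sup>2 / 6 * measure_pmf.expectation p (\<lambda>k. min (6 * (?X k)\<^sup>2) (l0 * \<bar>?X k\<bar> ^ 3))"
      unfolding char_def by (subst (asm) integral_distr) auto
    define u where "u = v * l\<^sup>2 / 2"
    have u: "0 \<le> u" using v0 by (simp add: u_def)
    have 2: "\<bar>exp (- u) - (1 - u)\<bar> \<le> u\<^sup>2 / 2"
    proof -
      have "1 - u \<le> exp (- u)" using exp_ge_add_one_self[of "-u"] by simp
      moreover have "exp (- u) \<le> 1 - u + u\<^sup>2 / 2"
      proof -
        have "1 + u + u\<^sup>2 / 2 \<le> exp u" by (rule exp_lower_Taylor_quadratic[OF u])
        then have "exp (- u) \<le> inverse (1 + u + u\<^sup>2 / 2)"
          unfolding exp_minus using u by (intro le_imp_inverse_le) (auto intro: add_pos_nonneg)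
        also have "\<dots> \<le> 1 - u + u\<^sup>2 / 2"
        proof -
          \<comment> \<open>The upper bound for \<open>exp (- u)\<close> follows from the lower Taylor bound for \<open>exp u\<close>, since the two
              quadratic polynomials multiply to at least 1.\<close>
          have "(1 - u + u\<^sup>2 / 2) * (1 + u + u\<^sup>2 / 2) = 1 + (u\<^sup>2)\<^sup>2 / 4"
            by (simp add: power2_eq_square algebra_simps)
          then have "1 \<le> (1 - u + u\<^sup>2 / 2) * (1 + u + u\<^sup>2 / 2)" by simp
          moreover have "0 < 1 + u + u\<^sup>2 / 2" using u by (auto intro: add_pos_nonneg)
          ultimately show ?thesis by (simp add: inverse_eq_divide pos_divide_le_eq)
        qed
        finally show ?thesis .
      qed
      ultimately show ?thesis by simp
    qed
    have "u\<^sup>2 / 2 = l\<^sup>2 * (v\<^sup>2 * l\<^sup>2 / 8)" by (simp add: u_def power2_eq_square)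
    also have "\<dots> \<le> l\<^sup>2 * (v\<^sup>2 * l0\<^sup>2 / 8)"
      using power_mono[OF l, of 2] by (intro mult_left_mono divide_right_mono) auto
    finally have 3: "\<bar>exp (- u) - (1 - u)\<bar> \<le> l\<^sup>2 * (v\<^sup>2 * l0\<^sup>2 / 8)" using 2 by linarith
    have "norm (measure_pmf.expectation p (\<lambda>k. iexp (l * ?X k)) - of_real (exp (- u))) \<le>
      norm (measure_pmf.expectation p (\<lambda>k. iexp (l * ?X k)) - (1 - l\<^sup>2 * v / 2)) + norm (of_real (exp (- u) - (1 - u)) :: complex)"
    proof -
      have e: "measure_pmf.expectation p (\<lambda>k. iexp (l * ?X k)) - of_real (exp (- u)) =
        (measure_pmf.expectation p (\<lambda>k. iexp (l * ?X k)) - (1 - l\<^sup>2 * v / 2)) - of_real (exp (- u) - (1 - u))"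
        by (simp add: u_def mult.commute)
      show ?thesis unfolding e by (rule norm_triangle_ineq4)
    qed
    also have "\<dots> \<le> l\<^sup>2 / 6 * measure_pmf.expectation p (\<lambda>k. min (6 * (?X k)\<^sup>2) (l0 * \<bar>?X k\<bar> ^ 3)) + l\<^sup>2 * (v\<^sup>2 * l0\<^sup>2 / 8)"
      unfolding norm_of_real by (rule add_mono[OF 1 3])
    also have "\<dots> = l\<^sup>2 * clt_remainder p m v l0"
      by (simp add: clt_remainder_def algebra_simps)
    finally show ?thesis unfolding u_def .
  qed
  show "(\<lambda>n. clt_remainder p m v (L n)) \<longlonglongrightarrow> 0" if L: "\<And>n. 0 \<le> L n" "L \<longlonglongrightarrow> 0" for L :: "nat \<Rightarrow> real"
  proof -
    have "(\<lambda>n. measure_pmf.expectation p (\<lambda>k. min (6 * (real k - m)\<^sup>2) (L n * \<bar>real k - m\<bar> ^ 3))) \<longlonglongrightarrow> measure_pmf.expectation p (\<lambda>k. 0)"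
    proof (rule integral_dominated_convergence[where w = "\<lambda>k. 6 * (real k - m)\<^sup>2"])
      show "AE k in p. (\<lambda>n. min (6 * (real k - m)\<^sup>2) (L n * \<bar>real k - m\<bar> ^ 3)) \<longlonglongrightarrow> 0"
      proof (rule AE_I2)
        fix k
        have "(\<lambda>n. min (6 * (real k - m)\<^sup>2) (L n * \<bar>real k - m\<bar> ^ 3)) \<longlonglongrightarrow> min (6 * (real k - m)\<^sup>2) (0 * \<bar>real k - m\<bar> ^ 3)"
          by (intro tendsto_intros L)
        then show "(\<lambda>n. min (6 * (real k - m)\<^sup>2) (L n * \<bar>real k - m\<bar> ^ 3)) \<longlonglongrightarrow> 0" by simp
      qed
      show "AE k in p. norm (min (6 * (real k - m)\<^sup>2) (L n * \<bar>real k - m\<bar> ^ 3)) \<le> 6 * (real k - m)\<^sup>2" for n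
        using L(1)[of n] by (intro AE_I2) auto
    qed (use ic in auto)
    then have *: "(\<lambda>n. measure_pmf.expectation p (\<lambda>k. min (6 * (real k - m)\<^sup>2) (L n * \<bar>real k - m\<bar> ^ 3))) \<longlonglongrightarrow> 0"
      by simp
    have "(\<lambda>n. clt_remainder p m v (L n)) \<longlonglongrightarrow> 0 / 6 + v\<^sup>2 * 0\<^sup>2 / 8"
      unfolding clt_remainder_def by (intro tendsto_intros * L) auto
    then show ?thesis by simp
  qed
qed

section \<open>Immigration and offspring fluctuations\<close>

lemma expectation_nonneg_mono:
  assumes "integrable (measure_pmf p) g" "\<And>x. 0 \<le> f x" "\<And>x. f x \<le> (g x :: real)"
  shows "measure_pmf.expectation p f \<le> measure_pmf.expectation p g"
proof (rule integral_mono)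
  have "norm (f x) \<le> norm (g x)" for x using assms(2,3)[of x] by simp
  then show "integrable (measure_pmf p) f"
    by (intro Bochner_Integration.integrable_bound[OF assms(1)]) auto
qed (use assms in auto)

lemma norm_expectation_le_integral:
  fixes f :: "'a \<Rightarrow> complex"
  assumes "integrable (measure_pmf p) g" "\<And>x. norm (f x) \<le> g x"
  shows "norm (measure_pmf.expectation p f) \<le> measure_pmf.expectation p g"
  by (rule order_trans[OF integral_norm_bound]) (intro expectation_nonneg_mono assms, simp)

context gwi_law
begin

text \<open>Immigration has infinite variance, so its second moment enters truncated at \<open>z\<close>, and its first
  moment beyond \<open>z\<close> separately.\<close>

definition truncated_square :: "real \<Rightarrow> real" where
  "truncated_square z = measure_pmf.expectation pB (\<lambda>b. (min (real b) z)\<^sup>2)"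

definition tail_mean :: "real \<Rightarrow> real" where
  "tail_mean z = measure_pmf.expectation pB (\<lambda>b. real b * indicator {b. real b > z} b)"

lemma integrable_truncated_square: "0 \<le> z \<Longrightarrow> integrable pB (\<lambda>b. (min (real b) z)\<^sup>2)"
  by (intro integrable_pmf_bounded[where C="z\<^sup>2"]) (auto simp: power_mono)

lemma integrable_tail_mean: "integrable pB (\<lambda>b. real b * indicat_real {b. real b > z} b)"
  by (rule Bochner_Integration.integrable_bound[OF integrable_B]) (auto simp: indicator_def)

lemma truncated_square_nonneg: "0 \<le> truncated_square z" and tail_mean_nonneg: "0 \<le> tail_mean z"
  unfolding truncated_square_def tail_mean_def by (auto intro!: Bochner_Integration.integral_nonneg)

text \<open>Centring removes the first-order term. The remaining second-order error is used up to the level \<open>a\<close>,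
  and a linear bound beyond it.\<close>

lemma immigration_cf_bound:
  assumes a: "1 \<le> a"
  shows "norm (measure_pmf.expectation pB (\<lambda>b. iexp (l * (real b - \<mu>\<^sub>B)) - 1)) \<le>
    l\<^sup>2 / 2 * (truncated_square a + \<mu>\<^sub>B\<^sup>2) + 2 * \<bar>l\<bar> * (1 + \<mu>\<^sub>B) * tail_mean a"
proof -
  let ?u = "\<lambda>b. l * (real b - \<mu>\<^sub>B)"
  have iu: "integrable pB ?u" using integrable_B by simp
  have iuc: "integrable pB (\<lambda>b. \<i> * complex_of_real (?u b))"
    by (intro integrable_mult_right integrable_of_real iu)
  have ie: "integrable pB (\<lambda>b. iexp (?u b) - 1)"
    by (rule integrable_pmf_bounded[where C=2]) (auto intro!: order_trans[OF norm_triangle_ineq4])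
  have Eu: "measure_pmf.expectation pB ?u = 0" using integrable_B by (simp add: \<mu>\<^sub>B)
  have "measure_pmf.expectation pB (\<lambda>b. \<i> * complex_of_real (?u b)) = \<i> * of_real (measure_pmf.expectation pB ?u)"
    by (simp only: integral_mult_right_zero integral_complex_of_real)
  then have E: "measure_pmf.expectation pB (\<lambda>b. iexp (?u b) - 1) = measure_pmf.expectation pB (\<lambda>b. iexp (?u b) - 1 - \<i> * complex_of_real (?u b))"
    using Bochner_Integration.integral_diff[OF ie iuc] by (simp only: Eu of_real_0 mult_zero_right diff_zero)
  have "norm (measure_pmf.expectation pB (\<lambda>b. iexp (?u b) - 1)) \<le> measure_pmf.expectation pB (\<lambda>b. l\<^sup>2 / 2 * ((min (real b) a)\<^sup>2 + \<mu>\<^sub>B\<^sup>2) + 2 * \<bar>l\<bar> * (1 + \<mu>\<^sub>B) * (real b * indicator {b. real b > a} b))"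
    unfolding E
  proof (rule norm_expectation_le_integral)
    show "integrable pB (\<lambda>b. l\<^sup>2 / 2 * ((min (real b) a)\<^sup>2 + \<mu>\<^sub>B\<^sup>2) + 2 * \<bar>l\<bar> * (1 + \<mu>\<^sub>B) * (real b * indicat_real {b. real b > a} b))"
      using a by (intro Bochner_Integration.integrable_add integrable_mult_right integrable_truncated_square integrable_tail_mean) auto
    fix b :: nat
    show "norm (iexp (?u b) - 1 - \<i> * complex_of_real (?u b)) \<le> l\<^sup>2 / 2 * ((min (real b) a)\<^sup>2 + \<mu>\<^sub>B\<^sup>2) + 2 * \<bar>l\<bar> * (1 + \<mu>\<^sub>B) * (real b * indicat_real {b. real b > a} b)"
    proof (cases "real b > a")
      case False
      have "norm (iexp (?u b) - 1 - \<i> * complex_of_real (?u b)) \<le> (?u b)\<^sup>2 / 2"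
        using iexp_approx1[of "?u b" 1] by (simp add: algebra_simps power2_eq_square abs_mult fact_numeral)
      also have "\<dots> = l\<^sup>2 / 2 * (real b - \<mu>\<^sub>B)\<^sup>2" by (simp add: power_mult_distrib)
      also have "(real b - \<mu>\<^sub>B)\<^sup>2 \<le> (real b)\<^sup>2 + \<mu>\<^sub>B\<^sup>2" using \<mu>\<^sub>B_nonneg by (simp add: power2_diff)
      finally show ?thesis using False by (simp add: mult_left_mono)
    next
      case True
      have b1: "1 \<le> real b" using True a by simp
      have "norm (iexp (?u b) - 1 - \<i> * complex_of_real (?u b)) \<le> 2 * \<bar>?u b\<bar>"
        using iexp_approx2[of "?u b" 1] by (simp add: algebra_simps)
      also have "\<dots> = 2 * \<bar>l\<bar> * \<bar>real b - \<mu>\<^sub>B\<bar>" by (simp add: abs_mult)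
      also have "\<bar>real b - \<mu>\<^sub>B\<bar> \<le> real b + \<mu>\<^sub>B" using \<mu>\<^sub>B_nonneg by simp
      also have "\<dots> \<le> (1 + \<mu>\<^sub>B) * real b" using b1 mult_left_mono[OF b1 \<mu>\<^sub>B_nonneg] by (simp add: algebra_simps)
      finally have "norm (iexp (?u b) - 1 - \<i> * complex_of_real (?u b)) \<le> 2 * \<bar>l\<bar> * ((1 + \<mu>\<^sub>B) * real b)"
        by (simp add: mult_left_mono)
      also have "\<dots> \<le> l\<^sup>2 / 2 * ((min (real b) a)\<^sup>2 + \<mu>\<^sub>B\<^sup>2) + 2 * \<bar>l\<bar> * ((1 + \<mu>\<^sub>B) * real b)"
        by simp
      finally show ?thesis using True by (simp add: mult.assoc)
    qed
  qed
  also have "\<dots> = l\<^sup>2 / 2 * (truncated_square a + \<mu>\<^sub>B\<^sup>2) + 2 * \<bar>l\<bar> * (1 + \<mu>\<^sub>B) * tail_mean a"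
  proof -
    have i: "integrable pB (\<lambda>b. (min (real b) a)\<^sup>2)" using a by (intro integrable_truncated_square) simp
    have "measure_pmf.expectation pB (\<lambda>b. (min (real b) a)\<^sup>2 + \<mu>\<^sub>B\<^sup>2) = truncated_square a + \<mu>\<^sub>B\<^sup>2"
      using i by (simp add: truncated_square_def)
    then show ?thesis
      using i integrable_tail_mean[of a]
      by (subst Bochner_Integration.integral_add) (auto simp only: integral_mult_right_zero tail_mean_def
        intro!: integrable_mult_right Bochner_Integration.integrable_add measure_pmf.integrable_const)
  qed
  finally show ?thesis .
qed

text \<open>Both factors are small for small immigration: below \<open>a\<close> the product is of third order, one order of
  which is spent on \<open>real b \<le> a\<close>.\<close>

lemma immigration_cf_product_bound:
  assumes a: "1 \<le> a" and L: "0 \<le> L" and g1: "\<And>y. norm (g y :: complex) \<le> 1" and g2: "\<And>y. 0 \<le> y \<Longrightarrow> norm (g y - 1) \<le> L * y\<^sup>2"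
  shows "measure_pmf.expectation pB (\<lambda>b. norm (iexp (l * (real b - \<mu>\<^sub>B)) - 1) * norm (g (real b / a) - 1)) \<le>
    \<bar>l\<bar> * (1 + \<mu>\<^sub>B) * (L + 2) * (truncated_square a / a + tail_mean a)"
proof -
  let ?r = "\<lambda>b. \<bar>l\<bar> * (1 + \<mu>\<^sub>B) * (L + 2) * ((min (real b) a)\<^sup>2 / a + real b * indicat_real {b. real b > a} b)"
  have "measure_pmf.expectation pB (\<lambda>b. norm (iexp (l * (real b - \<mu>\<^sub>B)) - 1) * norm (g (real b / a) - 1)) \<le>
    measure_pmf.expectation pB ?r"
  proof (rule expectation_nonneg_mono)
    show "integrable pB ?r"
      using a integrable_truncated_square[of a] integrable_tail_mean[of a] by simp
    fix b :: nat
    have "norm (iexp (l * (real b - \<mu>\<^sub>B)) - 1) \<le> \<bar>l * (real b - \<mu>\<^sub>B)\<bar>"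
      using iexp_approx1[of "l * (real b - \<mu>\<^sub>B)" 0] by simp
    also have "\<dots> = \<bar>l\<bar> * \<bar>real b - \<mu>\<^sub>B\<bar>" by (simp add: abs_mult)
    also have "\<dots> \<le> \<bar>l\<bar> * (real b + \<mu>\<^sub>B)" using \<mu>\<^sub>B_nonneg by (intro mult_left_mono) auto
    finally have 1: "norm (iexp (l * (real b - \<mu>\<^sub>B)) - 1) \<le> \<bar>l\<bar> * (real b + \<mu>\<^sub>B)" .
    have 2: "(real b + \<mu>\<^sub>B) * norm (g (real b / a) - 1) \<le> (1 + \<mu>\<^sub>B) * (L + 2) * ((min (real b) a)\<^sup>2 / a + real b * indicat_real {b. real b > a} b)"
    proof (cases "real b > a")
      case False
      have "real b + \<mu>\<^sub>B \<le> (1 + \<mu>\<^sub>B) * a" using False mult_left_mono[OF a \<mu>\<^sub>B_nonneg] by (simp add: algebra_simps)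
      moreover have "norm (g (real b / a) - 1) \<le> L * (real b / a)\<^sup>2" using a by (intro g2) auto
      ultimately have "(real b + \<mu>\<^sub>B) * norm (g (real b / a) - 1) \<le> ((1 + \<mu>\<^sub>B) * a) * (L * (real b / a)\<^sup>2)"
        using a \<mu>\<^sub>B_nonneg by (intro mult_mono) auto
      also have "\<dots> = (1 + \<mu>\<^sub>B) * L * ((real b)\<^sup>2 / a)" using a by (simp add: power2_eq_square)
      also have "\<dots> \<le> (1 + \<mu>\<^sub>B) * (L + 2) * ((real b)\<^sup>2 / a)"
        using a \<mu>\<^sub>B_nonneg by (intro mult_right_mono mult_left_mono) auto
      finally show ?thesis using False by simp
    next
      case True
      have b1: "1 \<le> real b" using True a by simp
      have "real b + \<mu>\<^sub>B \<le> (1 + \<mu>\<^sub>B) * real b" using mult_left_mono[OF b1 \<mu>\<^sub>B_nonneg] by (simp add: algebra_simps)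
      moreover have "norm (g (real b / a) - 1) \<le> 2"
        using norm_triangle_ineq4[of "g (real b / a)" 1] g1[of "real b / a"] by simp
      ultimately have "(real b + \<mu>\<^sub>B) * norm (g (real b / a) - 1) \<le> ((1 + \<mu>\<^sub>B) * real b) * 2"
        using \<mu>\<^sub>B_nonneg by (intro mult_mono) auto
      also have "\<dots> \<le> ((1 + \<mu>\<^sub>B) * real b) * (L + 2)"
        using \<mu>\<^sub>B_nonneg L by (intro mult_left_mono) auto
      also have "\<dots> = (1 + \<mu>\<^sub>B) * (L + 2) * (0 + real b)" by simp
      also have "\<dots> \<le> (1 + \<mu>\<^sub>B) * (L + 2) * ((min (real b) a)\<^sup>2 / a + real b)"
        using \<mu>\<^sub>B_nonneg L a by (intro mult_left_mono add_right_mono) auto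
      finally show ?thesis using True by simp
    qed
    have "norm (iexp (l * (real b - \<mu>\<^sub>B)) - 1) * norm (g (real b / a) - 1) \<le> \<bar>l\<bar> * ((real b + \<mu>\<^sub>B) * norm (g (real b / a) - 1))"
      using mult_right_mono[OF 1, of "norm (g (real b / a) - 1)"] by (simp add: mult.assoc)
    also have "\<dots> \<le> \<bar>l\<bar> * ((1 + \<mu>\<^sub>B) * (L + 2) * ((min (real b) a)\<^sup>2 / a + real b * indicat_real {b. real b > a} b))"
      by (intro mult_left_mono 2) auto
    finally show "norm (iexp (l * (real b - \<mu>\<^sub>B)) - 1) * norm (g (real b / a) - 1) \<le> ?r b" by (simp add: mult.assoc)
  qed simp
  also have "\<dots> = \<bar>l\<bar> * (1 + \<mu>\<^sub>B) * (L + 2) * (truncated_square a / a + tail_mean a)"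
    using a integrable_truncated_square[of a] integrable_tail_mean[of a] by (simp add: truncated_square_def tail_mean_def)
  finally show ?thesis .
qed

text \<open>Replaces the offspring sum by its mean \<open>\<mu> * x\<close> inside \<open>g\<close>. The factor \<open>W\<close> stands for the oscillating
  exponential of the increment, of which only boundedness is used. The parameter \<open>\<theta>\<close> avoids square
  roots of moments: with \<open>Z\<close> the deviation, \<open>2 * \<bar>Z\<bar> \<le> \<theta> + Z\<^sup>2 / \<theta>\<close>.\<close>

lemma offspring_fluctuation_bound:
  fixes W :: "nat \<times> nat \<Rightarrow> complex"
  assumes a: "0 < a" and th: "0 < \<theta>" and L: "0 \<le> L"
    and g: "\<And>y z. 0 \<le> y \<Longrightarrow> 0 \<le> z \<Longrightarrow> norm (g y - g z) \<le> L * \<bar>y\<^sup>2 - z\<^sup>2\<bar>"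
    and W: "\<And>z. norm (W z) \<le> 1"
  shows "norm (measure_pmf.expectation (pair_pmf (offspring_sum pA x) pB)
       (\<lambda>z. W z * (g ((real (fst z) + real (snd z)) / a) - g ((\<mu> * x + real (snd z)) / a)))) \<le>
     L / a\<^sup>2 * (\<sigma>\<^sup>2 * x + (\<theta> + \<sigma>\<^sup>2 * x / \<theta>) * (\<mu> * x + \<mu>\<^sub>B))"
proof -
  let ?q = "offspring_sum pA x"
  let ?Z = "\<lambda>s::nat. (real s - \<mu> * x)\<^sup>2"
  have iZ: "integrable ?q ?Z"
    using square_integrable_offspring[of x] integrable_offspring[of x] by (simp add: power2_diff)
  have iZ': "integrable ?q (\<lambda>s. \<theta> + ?Z s / \<theta>)" using iZ by simp
  have iB: "integrable pB (\<lambda>b. \<mu> * x + real b)" using integrable_B by simp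
  note i1 = integrable_pair_pmf_fst[OF iZ, of pB]
  note i2 = integrable_pair_pmf_mult[OF iZ' iB]
  let ?r = "\<lambda>z. L / a\<^sup>2 * (?Z (fst z) + (case z of (s, b) \<Rightarrow> (\<theta> + ?Z s / \<theta>) * (\<mu> * x + real b)))"
  have "norm (measure_pmf.expectation (pair_pmf ?q pB)
       (\<lambda>z. W z * (g ((real (fst z) + real (snd z)) / a) - g ((\<mu> * x + real (snd z)) / a)))) \<le>
     measure_pmf.expectation (pair_pmf ?q pB) ?r"
  proof (rule norm_expectation_le_integral)
    show "integrable (pair_pmf ?q pB) ?r" by (intro integrable_mult_right Bochner_Integration.integrable_add i1 i2)
    fix z :: "nat \<times> nat"
    obtain s b where z: "z = (s, b)" by (cases z)
    define Z where "Z = real s - \<mu> * x"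
    have mx: "0 \<le> \<mu> * x + real b" using \<mu>(2) by simp
    have "norm (W z * (g ((real s + real b) / a) - g ((\<mu> * x + real b) / a))) \<le> norm (g ((real s + real b) / a) - g ((\<mu> * x + real b) / a))"
      using W[of z] by (simp add: norm_mult mult_left_le_one_le)
    also have "\<dots> \<le> L * \<bar>((real s + real b) / a)\<^sup>2 - ((\<mu> * x + real b) / a)\<^sup>2\<bar>"
      using a mx by (intro g) auto
    also have "\<dots> = L / a\<^sup>2 * \<bar>(real s + real b)\<^sup>2 - (\<mu> * x + real b)\<^sup>2\<bar>"
      using a by (simp add: power_divide diff_divide_distrib[symmetric] abs_divide)
    also have "(real s + real b)\<^sup>2 - (\<mu> * x + real b)\<^sup>2 = Z\<^sup>2 + 2 * Z * (\<mu> * x + real b)"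
      by (simp add: Z_def power2_eq_square algebra_simps)
    finally have 1: "norm (W z * (g ((real s + real b) / a) - g ((\<mu> * x + real b) / a))) \<le> L / a\<^sup>2 * \<bar>Z\<^sup>2 + 2 * Z * (\<mu> * x + real b)\<bar>" .
    have 2: "\<bar>Z\<^sup>2 + 2 * Z * (\<mu> * x + real b)\<bar> \<le> Z\<^sup>2 + (\<theta> + Z\<^sup>2 / \<theta>) * (\<mu> * x + real b)"
    proof -
      have "2 * \<bar>Z\<bar> * \<theta> \<le> \<theta> * \<theta> + Z\<^sup>2"
        using zero_le_power2[of "\<theta> - \<bar>Z\<bar>"] by (simp add: power2_eq_square algebra_simps)
      then have "2 * \<bar>Z\<bar> \<le> \<theta> + Z\<^sup>2 / \<theta>" using th by (simp add: field_simps)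
      then have "2 * \<bar>Z\<bar> * (\<mu> * x + real b) \<le> (\<theta> + Z\<^sup>2 / \<theta>) * (\<mu> * x + real b)"
        using mx by (rule mult_right_mono)
      moreover have "\<bar>2 * Z * (\<mu> * x + real b)\<bar> = 2 * \<bar>Z\<bar> * (\<mu> * x + real b)"
        by (simp only: abs_mult abs_of_nonneg[OF mx] abs_numeral)
      ultimately show ?thesis using abs_triangle_ineq[of "Z\<^sup>2" "2 * Z * (\<mu> * x + real b)"] by simp
    qed
    have "norm (W z * (g ((real s + real b) / a) - g ((\<mu> * x + real b) / a))) \<le> L / a\<^sup>2 * (Z\<^sup>2 + (\<theta> + Z\<^sup>2 / \<theta>) * (\<mu> * x + real b))"
      using L a by (intro order_trans[OF 1 mult_left_mono[OF 2]]) simp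
    then show "norm (W z * (g ((real (fst z) + real (snd z)) / a) - g ((\<mu> * x + real (snd z)) / a))) \<le> ?r z"
      by (simp only: z fst_conv snd_conv prod.case Z_def)
  qed
  moreover have "measure_pmf.expectation (pair_pmf ?q pB) ?r = L / a\<^sup>2 * (\<sigma>\<^sup>2 * x + (\<theta> + \<sigma>\<^sup>2 * x / \<theta>) * (\<mu> * x + \<mu>\<^sub>B))"
  proof -
    have "measure_pmf.expectation (pair_pmf ?q pB) (\<lambda>z. ?Z (fst z)) = \<sigma>\<^sup>2 * x"
      by (simp only: expectation_pair_pmf_fst[of ?q pB ?Z] variance_offspring)
    moreover have "measure_pmf.expectation ?q (\<lambda>s. \<theta> + ?Z s / \<theta>) = \<theta> + \<sigma>\<^sup>2 * x / \<theta>"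
      using iZ by (simp add: variance_offspring)
    moreover have "measure_pmf.expectation pB (\<lambda>b. \<mu> * x + real b) = \<mu> * x + \<mu>\<^sub>B"
      using integrable_B by (simp add: \<mu>\<^sub>B)
    ultimately show ?thesis
      using i1 i2 expectation_pair_pmf_mult[OF iZ' iB]
      by (simp only: integral_mult_right_zero Bochner_Integration.integral_add)
  qed
  ultimately show ?thesis by (simp only:)
qed

end

section \<open>The one-step remainder\<close>

context gwi_law
begin

text \<open>The factors \<open>1 / (1 - \<mu>\<^sup>2)\<close> and \<open>1 / (1 - \<mu> ^ 3)\<close> sum the geometric series of the contributions
  \<open>(\<mu> ^ k * y)\<^sup>2\<close> and \<open>(\<mu> ^ k * y) ^ 3\<close> of successive generations.\<close>

definition limit_cf :: "real \<Rightarrow> real \<Rightarrow> real \<Rightarrow> complex" where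
  "limit_cf s t = cluster_cf (s / (1 - \<mu>\<^sup>2)) (\<sigma>\<^sup>2 * t\<^sup>2 / (2 * (1 - \<mu> ^ 3)))"

definition lipschitz_const :: "real \<Rightarrow> real \<Rightarrow> real" where
  "lipschitz_const s t = \<bar>s / (1 - \<mu>\<^sup>2)\<bar> + 3 / 2 * (\<sigma>\<^sup>2 * t\<^sup>2 / (2 * (1 - \<mu> ^ 3)) + 1)"

text \<open>The step from \<open>x\<close> to \<open>y\<close> of \<open>s * D + t * R\<close>, where \<open>D\<close> is the denominator of the estimator divided by \<open>a\<^sup>2\<close>
  and \<open>R\<close> is its centred numerator divided by \<open>a * sqrt a\<close>.\<close>

definition increment :: "real \<Rightarrow> real \<Rightarrow> real \<Rightarrow> nat \<Rightarrow> nat \<Rightarrow> real" where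
  "increment a s t x y = s * ((real x)\<^sup>2 / a\<^sup>2) + t * (real x * (real y - \<mu> * real x - \<mu>\<^sub>B) / (a * sqrt a))"

definition immigration_cf :: "real \<Rightarrow> real \<Rightarrow> real \<Rightarrow> complex" where
  "immigration_cf a s t = measure_pmf.expectation pB (\<lambda>b. limit_cf s t (real b / a))"

text \<open>The failure of \<open>limit_cf\<close> to be an exact eigenfunction, with eigenvalue \<open>immigration_cf\<close>, of the
  transition operator twisted by the increment.\<close>

definition remainder :: "real \<Rightarrow> real \<Rightarrow> real \<Rightarrow> nat \<Rightarrow> complex" where
  "remainder a s t x =
     measure_pmf.expectation (gwi_step pA pB x) (\<lambda>y. iexp (increment a s t x y) * limit_cf s t (real y / a))
       - immigration_cf a s t * limit_cf s t (real x / a)"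

lemma one_minus_\<mu>_pos: "0 < 1 - \<mu>\<^sup>2" "0 < 1 - \<mu> ^ 3"
  using power_strict_decreasing[of 0 2 \<mu>] power_strict_decreasing[of 0 3 \<mu>] \<mu>(2,3) by auto

lemma variance_coeff_nonneg: "0 \<le> \<sigma>\<^sup>2 * t\<^sup>2 / (2 * (1 - \<mu> ^ 3))"
  using one_minus_\<mu>_pos by simp

lemma norm_limit_cf: "norm (limit_cf s t y) \<le> 1"
  unfolding limit_cf_def by (rule norm_cluster_cf[OF variance_coeff_nonneg])

lemma limit_cf_0 [simp]: "limit_cf s t 0 = 1"
  by (simp add: limit_cf_def)

lemma isCont_limit_cf: "isCont (limit_cf s t) y"
  unfolding limit_cf_def by (rule isCont_cluster_cf)

lemma lipschitz_const_pos: "0 < lipschitz_const s t"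
proof -
  have "0 < 3 / 2 * (\<sigma>\<^sup>2 * t\<^sup>2 / (2 * (1 - \<mu> ^ 3)) + 1)" using variance_coeff_nonneg[of t] by simp
  then show ?thesis unfolding lipschitz_const_def by linarith
qed

lemma limit_cf_lipschitz:
  "0 \<le> y \<Longrightarrow> 0 \<le> z \<Longrightarrow> norm (limit_cf s t y - limit_cf s t z) \<le> lipschitz_const s t * \<bar>y\<^sup>2 - z\<^sup>2\<bar>"
  unfolding limit_cf_def lipschitz_const_def by (rule cluster_cf_lipschitz_square[OF variance_coeff_nonneg])

lemma limit_cf_minus_1: "0 \<le> y \<Longrightarrow> norm (limit_cf s t y - 1) \<le> lipschitz_const s t * y\<^sup>2"
  using limit_cf_lipschitz[of y 0 s t] by simp

lemma limit_cf_add: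
  "0 \<le> h \<Longrightarrow> 0 \<le> b \<Longrightarrow> norm (limit_cf s t (h + b) - limit_cf s t h * limit_cf s t b) \<le> 4 * lipschitz_const s t * (h * b)"
  unfolding limit_cf_def lipschitz_const_def by (rule cluster_cf_add[OF variance_coeff_nonneg])

lemma norm_immigration_cf: "norm (immigration_cf a s t) \<le> 1"
  unfolding immigration_cf_def by (rule norm_expectation_le) (rule norm_limit_cf)

lemma norm_remainder: "norm (remainder a s t x) \<le> 2"
proof -
  have "norm (measure_pmf.expectation (gwi_step pA pB x) (\<lambda>y. iexp (increment a s t x y) * limit_cf s t (real y / a))) \<le> 1"
    by (rule norm_expectation_le) (simp add: norm_mult norm_limit_cf)
  moreover have "norm (immigration_cf a s t * limit_cf s t (real x / a)) \<le> 1 * 1"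
    unfolding norm_mult by (intro mult_mono norm_immigration_cf norm_limit_cf) auto
  ultimately show ?thesis
    unfolding remainder_def using norm_triangle_ineq4 by (smt (verit))
qed

text \<open>The self-similarity of clusters. In the parameter \<open>l = t * x / (a * sqrt a)\<close> of the numerator, the
  Gaussian factor of the first generation is the product of \<open>x\<close> single-parent factors
  \<open>exp (- \<sigma>\<^sup>2 * l\<^sup>2 / 2)\<close>, which is what the central limit theorem for the offspring sum produces.\<close>

lemma limit_cf_factor:
  assumes a: "0 < a"
  shows "limit_cf s t (real x / a) = iexp (s * ((real x)\<^sup>2 / a\<^sup>2)) *
    (of_real (exp (- (\<sigma>\<^sup>2 * (t * x / (a * sqrt a))\<^sup>2 / 2))) ^ x * limit_cf s t (\<mu> * x / a))"
proof -
  define c v where "c = s / (1 - \<mu>\<^sup>2)" and "v = \<sigma>\<^sup>2 * t\<^sup>2 / (2 * (1 - \<mu> ^ 3))"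
  let ?y = "real x / a"
  have y0: "0 \<le> ?y" "0 \<le> \<mu> * x / a" using a \<mu>(2) by auto
  have c: "c * ?y\<^sup>2 = s * ((real x)\<^sup>2 / a\<^sup>2) + c * (\<mu> * x / a)\<^sup>2"
  proof -
    have "c * (1 - \<mu>\<^sup>2) = s" using one_minus_\<mu>_pos by (simp add: c_def)
    then have "s * ((real x)\<^sup>2 / a\<^sup>2) = c * (1 - \<mu>\<^sup>2) * ((real x)\<^sup>2 / a\<^sup>2)" by simp
    then show ?thesis by (simp add: power_divide power_mult_distrib algebra_simps diff_divide_distrib)
  qed
  have v: "v * ?y ^ 3 = \<sigma>\<^sup>2 * (t * x / (a * sqrt a))\<^sup>2 / 2 * x + v * (\<mu> * x / a) ^ 3"
  proof -
    have "2 * (v * (1 - \<mu> ^ 3)) = \<sigma>\<^sup>2 * t\<^sup>2"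
    proof -
      have "2 * (A / (2 * D) * D) = A" if "D \<noteq> 0" for A D :: real using that by simp
      from this[of "1 - \<mu> ^ 3" "\<sigma>\<^sup>2 * t\<^sup>2"] show ?thesis using one_minus_\<mu>_pos unfolding v_def by linarith
    qed
    moreover have "(t * x / (a * sqrt a))\<^sup>2 = t\<^sup>2 * (real x)\<^sup>2 / a ^ 3"
      by (simp only: power_divide power_mult_distrib real_sqrt_pow2[OF less_imp_le[OF a]])
         (simp add: power2_eq_square power3_eq_cube)
    then have "\<sigma>\<^sup>2 * (t * x / (a * sqrt a))\<^sup>2 / 2 * x = (\<sigma>\<^sup>2 * t\<^sup>2) / 2 * ((real x) ^ 3 / a ^ 3)"
      by (simp add: power2_eq_square power3_eq_cube)
    ultimately have "\<sigma>\<^sup>2 * (t * x / (a * sqrt a))\<^sup>2 / 2 * x = 2 * (v * (1 - \<mu> ^ 3)) / 2 * ((real x) ^ 3 / a ^ 3)"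
      by (simp only:)
    then show ?thesis by (simp add: power_divide power_mult_distrib algebra_simps diff_divide_distrib)
  qed
  have "limit_cf s t ?y = iexp (c * ?y\<^sup>2) * of_real (exp (- (v * ?y ^ 3)))"
    unfolding limit_cf_def c_def[symmetric] v_def[symmetric] cluster_cf_mult using y0 a \<mu>(2) by (simp add: abs_mult)
  also have "iexp (c * ?y\<^sup>2) = iexp (s * ((real x)\<^sup>2 / a\<^sup>2)) * iexp (c * (\<mu> * x / a)\<^sup>2)"
    unfolding c by (simp only: of_real_add distrib_left exp_add)
  also have "exp (- (v * ?y ^ 3)) = exp (- (\<sigma>\<^sup>2 * (t * x / (a * sqrt a))\<^sup>2 / 2)) ^ x * exp (- (v * (\<mu> * x / a) ^ 3))"
    unfolding v by (simp only: minus_add_distrib exp_add exp_of_nat_mult[symmetric] mult_minus_right mult.commute)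
  also have "iexp (s * ((real x)\<^sup>2 / a\<^sup>2)) * iexp (c * (\<mu> * x / a)\<^sup>2) *
      of_real (exp (- (\<sigma>\<^sup>2 * (t * x / (a * sqrt a))\<^sup>2 / 2)) ^ x * exp (- (v * (\<mu> * x / a) ^ 3))) =
    iexp (s * ((real x)\<^sup>2 / a\<^sup>2)) * (of_real (exp (- (\<sigma>\<^sup>2 * (t * x / (a * sqrt a))\<^sup>2 / 2))) ^ x *
      (iexp (c * (\<mu> * x / a)\<^sup>2) * of_real (exp (- (v * (\<mu> * x / a) ^ 3)))))"
    by (simp only: of_real_mult of_real_power ac_simps)
  also have "iexp (c * (\<mu> * x / a)\<^sup>2) * of_real (exp (- (v * (\<mu> * x / a) ^ 3))) = limit_cf s t (\<mu> * x / a)"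
    unfolding limit_cf_def c_def[symmetric] v_def[symmetric] cluster_cf_mult using y0 a \<mu>(2) by (simp add: abs_mult)
  finally show ?thesis .
qed

text \<open>The transition and the eigenfunction are compared factor by factor. The five summands account for
  the fluctuation of the offspring sum inside \<open>limit_cf\<close>, the central limit theorem for the offspring
  sum, the centred characteristic function of immigration (two summands), and the interaction of
  immigration with the present population. The restriction to \<open>real x \<le> K * a\<close> keeps the argument of
  the offspring characteristic function small.\<close>

lemma remainder_bound:
  assumes a: "1 \<le> a" and th: "0 < \<theta>" and K: "0 \<le> K" and x: "real x \<le> K * a"
  shows "norm (remainder a s t x) \<le>
    lipschitz_const s t / a\<^sup>2 * (\<sigma>\<^sup>2 * x + (\<theta> + \<sigma>\<^sup>2 * x / \<theta>) * (\<mu> * x + \<mu>\<^sub>B))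
    + t\<^sup>2 * K * (real x)\<^sup>2 / a\<^sup>2 * clt_remainder pA \<mu> (\<sigma>\<^sup>2) (\<bar>t\<bar> * K / sqrt a)
    + t\<^sup>2 * (real x)\<^sup>2 / a ^ 3 / 2 * (truncated_square a + \<mu>\<^sub>B\<^sup>2)
    + \<bar>t\<bar> * x / (a * sqrt a) * ((1 + \<mu>\<^sub>B) * (lipschitz_const s t + 4) * (truncated_square a / a + tail_mean a))
    + 12 * lipschitz_const s t * \<mu> * x * \<mu>\<^sub>B / a\<^sup>2"
proof -
  define g where "g = limit_cf s t"
  define L where "L = lipschitz_const s t"
  define l where "l = t * x / (a * sqrt a)"
  define P where "P = pair_pmf (offspring_sum pA x) pB"
  define T1 where "T1 k = iexp (l * (real k - \<mu> * x))" for k :: nat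
  define T2 where "T2 b = iexp (l * (real b - \<mu>\<^sub>B))" for b :: nat
  define G2 where "G2 b = g ((\<mu> * x + real b) / a)" for b :: nat
  define gB where "gB b = g (real b / a)" for b :: nat
  define h where "h = g (\<mu> * x / a)"
  define e0 where "e0 = iexp (s * ((real x)\<^sup>2 / a\<^sup>2))"
  define r where "r = complex_of_real (exp (- (\<sigma>\<^sup>2 * l\<^sup>2 / 2)))"
  define \<phi> where "\<phi> = measure_pmf.expectation pA (\<lambda>k. iexp (l * (real k - \<mu>)))"
  define Q where "Q = measure_pmf.expectation pB (\<lambda>b. T2 b * G2 b)"
  define w where "w = immigration_cf a s t"
  have a0: "0 < a" using a by simp
  have L0: "0 \<le> L" using lipschitz_const_pos[of s t] by (simp add: L_def)
  have nT1 [simp]: "norm (T1 k) = 1" and nT2 [simp]: "norm (T2 k) = 1" for k by (simp_all add: T1_def T2_def)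
  have ng: "norm (g y) \<le> 1" for y unfolding g_def by (rule norm_limit_cf)
  then have nG2: "norm (G2 k) \<le> 1" and ngB: "norm (gB k) \<le> 1" and nh: "norm h \<le> 1" for k
    by (simp_all add: G2_def gB_def h_def)
  have bnd: "integrable p f" if "\<And>z. norm (f z) \<le> 1" for p :: "'c pmf" and f :: "'c \<Rightarrow> complex"
    by (rule integrable_pmf_bounded[OF that])
  have iT2: "integrable pB T2" by (rule bnd) simp
  have iG2: "integrable pB G2" by (rule bnd) (rule nG2)
  have igB: "integrable pB gB" by (rule bnd) (rule ngB)
  have iTG: "integrable pB (\<lambda>b. T2 b * G2 b)" by (rule bnd) (simp add: norm_mult nG2)
  have iTgB: "integrable pB (\<lambda>b. T2 b * gB b)" by (rule bnd) (simp add: norm_mult ngB)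
  have iT1: "integrable (offspring_sum pA x) T1" by (rule bnd) simp
  \<comment> \<open>The exponential of the increment factors into \<open>e0\<close>, an offspring part \<open>T1\<close> and an immigration
      part \<open>T2\<close>. \<open>U1\<close> is the error of inserting the mean offspring number into \<open>g\<close>; what is left has
      independent factors, \<open>\<phi> ^ x\<close> and \<open>Q\<close>.\<close>
  define U1 where "U1 = measure_pmf.expectation P (\<lambda>z. (T1 (fst z) * T2 (snd z)) * (g ((real (fst z) + real (snd z)) / a) - g ((\<mu> * x + real (snd z)) / a)))"
  have step: "measure_pmf.expectation (gwi_step pA pB x) (\<lambda>y. iexp (increment a s t x y) * limit_cf s t (real y / a)) = e0 * (U1 + \<phi> ^ x * Q)"
  proof -
    have inc: "iexp (increment a s t x (k + b)) = e0 * (T1 k * T2 b)" for k b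
    proof -
      have "increment a s t x (k + b) = s * ((real x)\<^sup>2 / a\<^sup>2) + (l * (real k - \<mu> * x) + l * (real b - \<mu>\<^sub>B))"
        by (simp add: increment_def l_def algebra_simps add_divide_distrib diff_divide_distrib)
      then show ?thesis unfolding e0_def T1_def T2_def by (simp only: of_real_add distrib_left exp_add)
    qed
    have "measure_pmf.expectation (gwi_step pA pB x) (\<lambda>y. iexp (increment a s t x y) * limit_cf s t (real y / a)) =
      measure_pmf.expectation P (\<lambda>z. e0 * ((T1 (fst z) * T2 (snd z)) * (g ((real (fst z) + real (snd z)) / a) - g ((\<mu> * x + real (snd z)) / a))
        + (case z of (k, b) \<Rightarrow> T1 k * (T2 b * G2 b))))"
      unfolding gwi_step_def integral_map_pmf P_def[symmetric]
      by (intro Bochner_Integration.integral_cong refl) (simp add: case_prod_unfold inc g_def[symmetric] G2_def algebra_simps del: of_nat_add, simp add: algebra_simps)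
    also have "\<dots> = e0 * (U1 + measure_pmf.expectation P (\<lambda>z. case z of (k, b) \<Rightarrow> T1 k * (T2 b * G2 b)))"
    proof -
      have "norm (g u - g v) \<le> 2" for u v
        using norm_triangle_ineq4[of "g u" "g v"] ng[of u] ng[of v] by linarith
      then have "integrable P (\<lambda>z. (T1 (fst z) * T2 (snd z)) * (g ((real (fst z) + real (snd z)) / a) - g ((\<mu> * x + real (snd z)) / a)))"
        by (intro integrable_pmf_bounded[where C=2]) (simp add: norm_mult)
      moreover have "integrable P (\<lambda>z. case z of (k, b) \<Rightarrow> T1 k * (T2 b * G2 b))"
        unfolding P_def by (rule integrable_pair_pmf_mult[OF iT1 iTG])
      ultimately show ?thesis unfolding U1_def by (simp only: integral_mult_right_zero Bochner_Integration.integral_add)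
    qed
    also have "measure_pmf.expectation P (\<lambda>z. case z of (k, b) \<Rightarrow> T1 k * (T2 b * G2 b)) = \<phi> ^ x * Q"
    proof -
      have "measure_pmf.expectation (offspring_sum pA x) T1 = \<phi> ^ x"
        unfolding T1_def[abs_def] \<phi>_def by (rule offspring_sum_char)
      then show ?thesis
        unfolding P_def Q_def by (subst expectation_pair_pmf_mult[OF iT1 iTG]) (simp only:)
    qed
    finally show ?thesis .
  qed
  have gx: "limit_cf s t (real x / a) = e0 * (r ^ x * h)"
    unfolding e0_def r_def h_def g_def l_def by (rule limit_cf_factor[OF a0])
  have nr: "norm r \<le> 1" by (simp add: r_def)
  have n\<phi>: "norm \<phi> \<le> 1" unfolding \<phi>_def by (rule norm_expectation_le) simp
  have nQ: "norm Q \<le> 1" unfolding Q_def by (rule norm_expectation_le) (simp add: norm_mult nG2)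
  have R: "remainder a s t x = e0 * (U1 + (\<phi> ^ x - r ^ x) * Q + r ^ x * (Q - w * h))"
    unfolding remainder_def step gx w_def[symmetric] by (simp add: algebra_simps)
  have nR: "norm (remainder a s t x) \<le> norm U1 + norm (\<phi> ^ x - r ^ x) + norm (Q - w * h)"
  proof -
    have "norm (remainder a s t x) = norm (U1 + (\<phi> ^ x - r ^ x) * Q + r ^ x * (Q - w * h))"
      unfolding R by (simp add: norm_mult e0_def)
    also have "\<dots> \<le> norm U1 + norm ((\<phi> ^ x - r ^ x) * Q) + norm (r ^ x * (Q - w * h))"
      by (rule order_trans[OF norm_triangle_ineq add_right_mono[OF norm_triangle_ineq]])
    also have "norm ((\<phi> ^ x - r ^ x) * Q) \<le> norm (\<phi> ^ x - r ^ x)"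
      using nQ by (simp add: norm_mult mult_left_le)
    also have "norm (r ^ x * (Q - w * h)) \<le> norm (Q - w * h)"
      using nr by (simp add: norm_mult norm_power mult_left_le_one_le power_le_one)
    finally show ?thesis by simp
  qed
  have b1: "norm U1 \<le> L / a\<^sup>2 * (\<sigma>\<^sup>2 * x + (\<theta> + \<sigma>\<^sup>2 * x / \<theta>) * (\<mu> * x + \<mu>\<^sub>B))"
    unfolding U1_def P_def g_def L_def
    by (rule offspring_fluctuation_bound[OF a0 th less_imp_le[OF lipschitz_const_pos] limit_cf_lipschitz]) (simp_all add: norm_mult)
  have lx: "\<bar>l\<bar> = \<bar>t\<bar> * x / (a * sqrt a)" using a0 by (simp add: l_def abs_mult)
  have l2: "l\<^sup>2 = t\<^sup>2 * (real x)\<^sup>2 / a ^ 3"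
    unfolding l_def
    by (simp only: power_divide power_mult_distrib real_sqrt_pow2[OF less_imp_le[OF a0]])
       (simp add: power2_eq_square power3_eq_cube)
  have lK: "\<bar>l\<bar> \<le> \<bar>t\<bar> * K / sqrt a"
  proof -
    have "\<bar>t\<bar> * x / (a * sqrt a) \<le> \<bar>t\<bar> * (K * a) / (a * sqrt a)"
      using x a0 by (intro divide_right_mono mult_left_mono) auto
    then show ?thesis using a0 by (simp add: lx)
  qed
  define \<Theta> where "\<Theta> = clt_remainder pA \<mu> (\<sigma>\<^sup>2) (\<bar>t\<bar> * K / sqrt a)"
  have \<Theta>0: "0 \<le> \<Theta>"
    unfolding \<Theta>_def clt_remainder_def using K a0
    by (intro add_nonneg_nonneg divide_nonneg_nonneg Bochner_Integration.integral_nonneg) auto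
  have b2: "norm (\<phi> ^ x - r ^ x) \<le> t\<^sup>2 * K * (real x)\<^sup>2 / a\<^sup>2 * \<Theta>"
  proof -
    have "norm (\<phi> ^ x - r ^ x) \<le> real x * norm (\<phi> - r)" by (rule norm_power_diff[OF n\<phi> nr])
    also have "norm (\<phi> - r) \<le> l\<^sup>2 * \<Theta>"
      unfolding \<phi>_def r_def \<Theta>_def by (rule cf_gaussian_approx[OF \<sigma>(1) \<mu>(1) \<sigma>(2) lK])
    also have "real x * (l\<^sup>2 * \<Theta>) = t\<^sup>2 * (real x)\<^sup>2 / a ^ 3 * real x * \<Theta>" by (simp add: l2)
    also have "\<dots> \<le> t\<^sup>2 * (real x)\<^sup>2 / a ^ 3 * (K * a) * \<Theta>"
      using x \<Theta>0 a0 by (intro mult_right_mono mult_left_mono) auto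
    also have "\<dots> = t\<^sup>2 * K * (real x)\<^sup>2 / a\<^sup>2 * \<Theta>"
      using a0 by (simp add: power2_eq_square power3_eq_cube)
    finally show ?thesis by (simp add: mult_left_mono)
  qed
  have hb: "0 \<le> \<mu> * x / a" "0 \<le> real b / a" for b using \<mu>(2) a0 by auto
  have dG: "norm (G2 b - h * gB b) \<le> 4 * L * (\<mu> * x / a) * (real b / a)" for b
    using limit_cf_add[OF hb(1) hb(2), of s t b] by (simp add: G2_def h_def gB_def g_def L_def add_divide_distrib mult.assoc)
  have iD: "integrable pB (\<lambda>b. 4 * L * (\<mu> * x / a) * (real b / a))" using integrable_B by simp
  have ED: "measure_pmf.expectation pB (\<lambda>b. 4 * L * (\<mu> * x / a) * (real b / a)) = 4 * L * \<mu> * x * \<mu>\<^sub>B / a\<^sup>2"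
    using integrable_B by (simp add: \<mu>\<^sub>B power2_eq_square)
  \<comment> \<open>Both \<open>T2 b\<close> and \<open>G2 b\<close> are expanded, around 1 and around \<open>h * gB b\<close>; the cross terms are kept
      separate because \<open>T2 b - 1\<close> alone is only of first order in \<open>b\<close> before taking expectations.\<close>
  have Qeq: "Q - w * h = h * measure_pmf.expectation pB (\<lambda>b. T2 b - 1)
      + measure_pmf.expectation pB (\<lambda>b. (T2 b - 1) * (G2 b - h * gB b))
      + h * measure_pmf.expectation pB (\<lambda>b. (T2 b - 1) * (gB b - 1))
      + measure_pmf.expectation pB (\<lambda>b. G2 b - h * gB b)"
  proof -
    have w: "w = measure_pmf.expectation pB gB" by (simp add: w_def immigration_cf_def gB_def[abs_def] g_def)
    have "(T2 b - 1) * (G2 b - h * gB b) = T2 b * G2 b - h * (T2 b * gB b) - G2 b + h * gB b" for b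
      by (simp add: algebra_simps)
    then have 1: "measure_pmf.expectation pB (\<lambda>b. (T2 b - 1) * (G2 b - h * gB b)) =
      Q - h * measure_pmf.expectation pB (\<lambda>b. T2 b * gB b) - measure_pmf.expectation pB G2 + h * w"
      unfolding Q_def w using iTG iTgB iG2 igB by simp
    have "(T2 b - 1) * (gB b - 1) = T2 b * gB b - T2 b - gB b + 1" for b
      by (simp add: algebra_simps)
    then have 2: "measure_pmf.expectation pB (\<lambda>b. (T2 b - 1) * (gB b - 1)) =
      measure_pmf.expectation pB (\<lambda>b. T2 b * gB b) - measure_pmf.expectation pB T2 - w + 1"
      unfolding w using iTgB iT2 igB by simp
    have 3: "measure_pmf.expectation pB (\<lambda>b. T2 b - 1) = measure_pmf.expectation pB T2 - 1"
      using iT2 by simp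
    have 4: "measure_pmf.expectation pB (\<lambda>b. G2 b - h * gB b) = measure_pmf.expectation pB G2 - h * w"
      unfolding w using iG2 igB by simp
    show ?thesis unfolding 1 2 3 4 by (simp add: algebra_simps)
  qed
  have q1: "norm (measure_pmf.expectation pB (\<lambda>b. T2 b - 1)) \<le> l\<^sup>2 / 2 * (truncated_square a + \<mu>\<^sub>B\<^sup>2) + 2 * \<bar>l\<bar> * (1 + \<mu>\<^sub>B) * tail_mean a"
    unfolding T2_def by (rule immigration_cf_bound[OF a])
  have nT: "norm (T2 b - 1) \<le> 2" for b using norm_triangle_ineq4[of "T2 b" 1] by simp
  have q2: "norm (measure_pmf.expectation pB (\<lambda>b. (T2 b - 1) * (G2 b - h * gB b))) \<le> 2 * (4 * L * \<mu> * x * \<mu>\<^sub>B / a\<^sup>2)"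
    unfolding ED[symmetric] integral_mult_right_zero[symmetric]
  proof (rule norm_expectation_le_integral)
    show "integrable pB (\<lambda>b. 2 * (4 * L * (\<mu> * x / a) * (real b / a)))" by (rule integrable_mult_right[OF iD])
    show "norm ((T2 b - 1) * (G2 b - h * gB b)) \<le> 2 * (4 * L * (\<mu> * x / a) * (real b / a))" for b
      unfolding norm_mult by (intro mult_mono nT dG) auto
  qed
  have q3: "norm (measure_pmf.expectation pB (\<lambda>b. (T2 b - 1) * (gB b - 1))) \<le> \<bar>l\<bar> * (1 + \<mu>\<^sub>B) * (L + 2) * (truncated_square a / a + tail_mean a)"
  proof -
    have "norm (measure_pmf.expectation pB (\<lambda>b. (T2 b - 1) * (gB b - 1))) \<le> measure_pmf.expectation pB (\<lambda>b. norm (T2 b - 1) * norm (gB b - 1))"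
      using integral_norm_bound[of pB "\<lambda>b. (T2 b - 1) * (gB b - 1)"] by (simp only: norm_mult)
    also have "\<dots> \<le> \<bar>l\<bar> * (1 + \<mu>\<^sub>B) * (L + 2) * (truncated_square a / a + tail_mean a)"
      unfolding T2_def gB_def g_def L_def
      by (rule immigration_cf_product_bound[OF a less_imp_le[OF lipschitz_const_pos] norm_limit_cf limit_cf_minus_1])
    finally show ?thesis .
  qed
  have q4: "norm (measure_pmf.expectation pB (\<lambda>b. G2 b - h * gB b)) \<le> 4 * L * \<mu> * x * \<mu>\<^sub>B / a\<^sup>2"
    unfolding ED[symmetric] by (rule norm_expectation_le_integral[OF iD dG])
  have hz: "norm (h * z) \<le> norm z" for z using nh by (simp add: norm_mult mult_left_le_one_le)
  have "norm (Q - w * h) \<le> norm (h * measure_pmf.expectation pB (\<lambda>b. T2 b - 1))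
      + norm (measure_pmf.expectation pB (\<lambda>b. (T2 b - 1) * (G2 b - h * gB b)))
      + norm (h * measure_pmf.expectation pB (\<lambda>b. (T2 b - 1) * (gB b - 1)))
      + norm (measure_pmf.expectation pB (\<lambda>b. G2 b - h * gB b))"
    unfolding Qeq
    by (rule order_trans[OF norm_triangle_ineq add_right_mono[OF order_trans[OF norm_triangle_ineq add_right_mono[OF norm_triangle_ineq]]]])
  also have "\<dots> \<le> (l\<^sup>2 / 2 * (truncated_square a + \<mu>\<^sub>B\<^sup>2) + 2 * \<bar>l\<bar> * (1 + \<mu>\<^sub>B) * tail_mean a) + 2 * (4 * L * \<mu> * x * \<mu>\<^sub>B / a\<^sup>2)
      + \<bar>l\<bar> * (1 + \<mu>\<^sub>B) * (L + 2) * (truncated_square a / a + tail_mean a) + 4 * L * \<mu> * x * \<mu>\<^sub>B / a\<^sup>2"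
    by (intro add_mono q2 q4 order_trans[OF hz q1] order_trans[OF hz q3])
  also have "\<dots> \<le> l\<^sup>2 / 2 * (truncated_square a + \<mu>\<^sub>B\<^sup>2) + \<bar>l\<bar> * ((1 + \<mu>\<^sub>B) * (L + 4) * (truncated_square a / a + tail_mean a)) + 12 * L * \<mu> * x * \<mu>\<^sub>B / a\<^sup>2"
  proof -
    define z A E where "z = truncated_square a / a" and "A = l\<^sup>2 / 2 * (truncated_square a + \<mu>\<^sub>B\<^sup>2)" and "E = L * \<mu> * x * \<mu>\<^sub>B / a\<^sup>2"
    have "0 \<le> \<bar>l\<bar> * (1 + \<mu>\<^sub>B) * z" using a0 \<mu>\<^sub>B_nonneg truncated_square_nonneg[of a] by (simp add: z_def)
    moreover have e: "4 * L * \<mu> * x * \<mu>\<^sub>B / a\<^sup>2 = 4 * E" "12 * L * \<mu> * x * \<mu>\<^sub>B / a\<^sup>2 = 12 * E"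
      by (simp_all add: E_def)
    ultimately show ?thesis unfolding z_def[symmetric] A_def[symmetric] e by (simp add: algebra_simps)
  qed
  finally have b3: "norm (Q - w * h) \<le> l\<^sup>2 / 2 * (truncated_square a + \<mu>\<^sub>B\<^sup>2) + \<bar>l\<bar> * ((1 + \<mu>\<^sub>B) * (L + 4) * (truncated_square a / a + tail_mean a)) + 12 * L * \<mu> * x * \<mu>\<^sub>B / a\<^sup>2" .
  have "norm (remainder a s t x) \<le> L / a\<^sup>2 * (\<sigma>\<^sup>2 * x + (\<theta> + \<sigma>\<^sup>2 * x / \<theta>) * (\<mu> * x + \<mu>\<^sub>B)) + t\<^sup>2 * K * (real x)\<^sup>2 / a\<^sup>2 * \<Theta>
     + (l\<^sup>2 / 2 * (truncated_square a + \<mu>\<^sub>B\<^sup>2) + \<bar>l\<bar> * ((1 + \<mu>\<^sub>B) * (L + 4) * (truncated_square a / a + tail_mean a)) + 12 * L * \<mu> * x * \<mu>\<^sub>B / a\<^sup>2)"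
    by (rule order_trans[OF nR add_mono[OF add_mono[OF b1 b2] b3]])
  then show ?thesis unfolding l2 lx \<Theta>_def L_def by (simp only: add.assoc)
qed

end

section \<open>The total remainder vanishes\<close>

text \<open>Markov's inequality applied to the part of the mean beyond \<open>a n\<close>, which vanishes. With \<open>n * tail \<rightarrow> 1\<close>
  it implies that \<open>a n\<close> is of smaller order than \<open>n\<close>.\<close>

lemma times_tail_tendsto_0:
  assumes i: "integrable (measure_pmf p) real" and a: "filterlim a at_top sequentially"
  shows "(\<lambda>n. a n * tail p (a n)) \<longlonglongrightarrow> 0"
proof -
  have "(\<lambda>n. measure_pmf.expectation p (\<lambda>k. real k * indicator {k. real k > a n} k)) \<longlonglongrightarrow> measure_pmf.expectation p (\<lambda>k. 0)"
  proof (rule integral_dominated_convergence[where w=real])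
    show "AE k in p. (\<lambda>n. real k * indicator {k. real k > a n} k) \<longlonglongrightarrow> 0"
    proof (intro AE_I2 tendsto_eventually)
      fix k
      have "eventually (\<lambda>n. real k \<le> a n) sequentially" using a by (simp add: filterlim_at_top)
      then show "eventually (\<lambda>n. real k * indicator {k. real k > a n} k = 0) sequentially"
        by eventually_elim (auto simp: indicator_def)
    qed
  qed (use i in \<open>auto simp: indicator_def intro!: AE_I2\<close>)
  then have lim: "(\<lambda>n. measure_pmf.expectation p (\<lambda>k. real k * indicator {k. real k > a n} k)) \<longlonglongrightarrow> 0" by simp
  have "eventually (\<lambda>n. norm (a n * tail p (a n)) \<le> measure_pmf.expectation p (\<lambda>k. real k * indicator {k. real k > a n} k)) sequentially"
  proof -
    have "eventually (\<lambda>n. 0 \<le> a n) sequentially" using a by (simp add: filterlim_at_top)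
    then show ?thesis
    proof eventually_elim
      case (elim n)
      have "a n * tail p (a n) = measure_pmf.expectation p (\<lambda>k. a n * indicator {k. real k > a n} k)"
        by (simp add: tail_def)
      also have "\<dots> \<le> measure_pmf.expectation p (\<lambda>k. real k * indicator {k. real k > a n} k)"
      proof (rule integral_mono)
        show "integrable p (\<lambda>k. real k * indicat_real {k. real k > a n} k)"
          by (rule Bochner_Integration.integrable_bound[OF i]) (auto simp: indicator_def)
        show "integrable p (\<lambda>k. a n * indicat_real {k. real k > a n} k)"
          by (rule integrable_indicator_pmf)
      qed (auto simp: indicator_def)
      finally show ?case using elim by simp
    qed
  qed
  then show ?thesis by (rule Lim_null_comparison[OF _ lim])
qed

context gwi_law
begin

lemma tail_X_pos: "0 < tail pX x"
  by (rule regularly_varying_tail_pos[OF regularly_varying_X])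

lemma \<mu>_powr_less_1: "\<mu> powr \<alpha> < 1"
  using \<mu>(2,3) \<alpha>(1) powr_less_mono2[of \<alpha> \<mu> 1] by auto

context
  fixes a :: "nat \<Rightarrow> real"
  assumes a: "filterlim a at_top sequentially"
    and tail_a: "(\<lambda>n. real n * tail pX (a n)) \<longlonglongrightarrow> 1"
begin

lemma tail_B_a: "(\<lambda>n. real n * tail pB (a n)) \<longlonglongrightarrow> 1 - \<mu> powr \<alpha>"
proof -
  have "(\<lambda>n. (real n * tail pX (a n)) / (tail pX (a n) / tail pB (a n))) \<longlonglongrightarrow> 1 / (1 / (1 - \<mu> powr \<alpha>))"
    using \<mu>_powr_less_1 by (intro tendsto_divide tail_a filterlim_compose[OF tail_ratio a]) auto
  moreover have "(real n * tail pX (a n)) / (tail pX (a n) / tail pB (a n)) = real n * tail pB (a n)" for n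
    using tail_X_pos[of "a n"] by simp
  ultimately show ?thesis by simp
qed

text \<open>Because \<open>\<alpha> < 2\<close>, fluctuations of the order of the square root of \<open>n\<close> are invisible at scale \<open>a n\<close>.\<close>

lemma n_over_a_square: "(\<lambda>n. real n / (a n)\<^sup>2) \<longlonglongrightarrow> 0"
proof -
  have "(\<lambda>n. (real n * tail pX (a n)) / ((a n)\<^sup>2 * tail pX (a n))) \<longlonglongrightarrow> 0"
    by (rule tendsto_divide_0[OF tail_a filterlim_at_top_imp_at_infinity])
       (rule filterlim_compose[OF square_times_tail_at_top[OF regularly_varying_X \<alpha>(2)] a])
  moreover have "(real n * tail pX (a n)) / ((a n)\<^sup>2 * tail pX (a n)) = real n / (a n)\<^sup>2" for n
    using tail_X_pos[of "a n"] by simp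
  ultimately show ?thesis by simp
qed

lemma a_over_n: "(\<lambda>n. a n / real n) \<longlonglongrightarrow> 0"
proof -
  have "(\<lambda>n. (a n * tail pX (a n)) / (real n * tail pX (a n))) \<longlonglongrightarrow> 0 / 1"
    by (intro tendsto_divide tail_a times_tail_tendsto_0[OF integrable_X a]) auto
  moreover have "(a n * tail pX (a n)) / (real n * tail pX (a n)) = a n / real n" for n
    using tail_X_pos[of "a n"] by simp
  ultimately show ?thesis by simp
qed

lemma immigration_moments_bounded:
  obtains D where "0 \<le> D" "eventually (\<lambda>n. real n * truncated_square (a n) / (a n)\<^sup>2 \<le> D \<and> real n * tail_mean (a n) / a n \<le> D) sequentially"
proof -
  obtain C where C: "0 < C" "eventually (\<lambda>z. measure_pmf.expectation pB (\<lambda>k. (min (real k) z)\<^sup>2) \<le> C * (z\<^sup>2 * tail pB z)) at_top"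
    by (rule truncated_second_moment_le[OF \<alpha>(3,2)])
  obtain C' where C': "0 < C'" "eventually (\<lambda>z. measure_pmf.expectation pB (\<lambda>k. real k * indicator {k. real k > z} k) \<le> C' * (z * tail pB z)) at_top"
    by (rule tail_first_moment_le[OF \<alpha>(3,1)])
  have "eventually (\<lambda>n. real n * tail pB (a n) < 2) sequentially"
    using \<mu>(2) by (intro order_tendstoD(2)[OF tail_B_a]) (smt (verit) powr_non_neg)
  moreover have "eventually (\<lambda>n. 0 < a n) sequentially" using a by (simp add: filterlim_at_top_dense)
  ultimately have "eventually (\<lambda>n. real n * truncated_square (a n) / (a n)\<^sup>2 \<le> 2 * (C + C') \<and> real n * tail_mean (a n) / a n \<le> 2 * (C + C')) sequentially"
    using eventually_compose_filterlim[OF C(2) a] eventually_compose_filterlim[OF C'(2) a]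
  proof eventually_elim
    case (elim n)
    have le: "D * (real n * tail pB (a n)) \<le> 2 * (C + C')" if "0 < D" "D \<le> C + C'" for D
      using mult_mono[of D "C + C'" "real n * tail pB (a n)" 2] that elim(1) C C' by simp
    have "real n * truncated_square (a n) / (a n)\<^sup>2 \<le> real n * (C * ((a n)\<^sup>2 * tail pB (a n))) / (a n)\<^sup>2"
      unfolding truncated_square_def using elim by (intro divide_right_mono mult_left_mono) auto
    also have "\<dots> = C * (real n * tail pB (a n))" using elim by simp
    finally have 1: "real n * truncated_square (a n) / (a n)\<^sup>2 \<le> 2 * (C + C')" using le[of C] C C' by linarith
    have "real n * tail_mean (a n) / a n \<le> real n * (C' * (a n * tail pB (a n))) / a n"
      unfolding tail_mean_def using elim by (intro divide_right_mono mult_left_mono) auto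
    also have "\<dots> = C' * (real n * tail pB (a n))" using elim by simp
    finally have 2: "real n * tail_mean (a n) / a n \<le> 2 * (C + C')" using le[of C'] C C' by linarith
    show ?case using 1 2 by simp
  qed
  then show ?thesis using C C' by (intro that[of "2 * (C + C')"]) auto
qed

lemma stationary_second_moment_bounded:
  assumes K: "0 < K"
  obtains D where "0 \<le> D" "eventually (\<lambda>n. real n * measure_pmf.expectation pX (\<lambda>k. (min (real k) (K * a n))\<^sup>2) / (a n)\<^sup>2 \<le> D) sequentially"
proof -
  obtain C where C: "0 < C" "eventually (\<lambda>z. measure_pmf.expectation pX (\<lambda>k. (min (real k) z)\<^sup>2) \<le> C * (z\<^sup>2 * tail pX z)) at_top"
    by (rule truncated_second_moment_le[OF regularly_varying_X \<alpha>(2)])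
  have Ka: "filterlim (\<lambda>n. K * a n) at_top sequentially"
    by (intro filterlim_tendsto_pos_mult_at_top[OF tendsto_const] K a)
  have "eventually (\<lambda>n. real n * tail pX (K * a n) < 1 * K powr (-\<alpha>) + 1) sequentially"
    by (intro order_tendstoD(2)[OF regularly_varying_scaled_tail[OF regularly_varying_X a tail_a K]]) auto
  moreover have "eventually (\<lambda>n. 0 < a n) sequentially" using a by (simp add: filterlim_at_top_dense)
  ultimately have "eventually (\<lambda>n. real n * measure_pmf.expectation pX (\<lambda>k. (min (real k) (K * a n))\<^sup>2) / (a n)\<^sup>2 \<le> C * K\<^sup>2 * (1 * K powr (-\<alpha>) + 1)) sequentially"
    using eventually_compose_filterlim[OF C(2) Ka]
  proof eventually_elim
    case (elim n)
    have "real n * measure_pmf.expectation pX (\<lambda>k. (min (real k) (K * a n))\<^sup>2) / (a n)\<^sup>2 \<le> real n * (C * ((K * a n)\<^sup>2 * tail pX (K * a n))) / (a n)\<^sup>2"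
      using elim by (intro divide_right_mono mult_left_mono) auto
    also have "\<dots> = C * K\<^sup>2 * (real n * tail pX (K * a n))" using elim by (simp add: power_mult_distrib)
    also have "\<dots> \<le> C * K\<^sup>2 * (1 * K powr (-\<alpha>) + 1)" using elim C by (intro mult_left_mono) auto
    finally show ?case .
  qed
  then show ?thesis using C by (intro that[of "C * K\<^sup>2 * (1 * K powr (-\<alpha>) + 1)"]) auto
qed

text \<open>Below \<open>K * a n\<close> the one-step bound is a quadratic polynomial in \<open>x\<close>, whose expectation is controlled
  by the mean and the truncated second moment of \<open>pX\<close>; above, the remainder is at most 2. The choice
  \<open>\<theta> = 1 / r\<close>, that is \<open>\<theta> = a n / sqrt n\<close>, balances the two terms in which \<open>\<theta>\<close> occurs: both become of
  order \<open>r\<close>, which tends to 0.\<close>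

lemma expected_remainder_bound:
  assumes an: "1 \<le> a n" and n: "1 \<le> n" and K: "1 \<le> K"
    and D: "real n * truncated_square (a n) / (a n)\<^sup>2 \<le> D" "real n * tail_mean (a n) / a n \<le> D"
    and D': "real n * measure_pmf.expectation pX (\<lambda>k. (min (real k) (K * a n))\<^sup>2) / (a n)\<^sup>2 \<le> D'"
  defines "r \<equiv> sqrt (real n / (a n)\<^sup>2)"
  defines "m \<equiv> measure_pmf.expectation pX real"
  shows "real n * measure_pmf.expectation pX (\<lambda>x. norm (remainder (a n) s t x)) \<le>
     m * (lipschitz_const s t * (\<sigma>\<^sup>2 * r\<^sup>2 + \<mu> * r + \<sigma>\<^sup>2 * \<mu>\<^sub>B * (r * r\<^sup>2)) + \<bar>t\<bar> * ((1 + \<mu>\<^sub>B) * (lipschitz_const s t + 4) * (D + D)) / sqrt (a n) + 12 * lipschitz_const s t * \<mu> * \<mu>\<^sub>B * r\<^sup>2)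
     + D' * (lipschitz_const s t * \<sigma>\<^sup>2 * \<mu> * r + t\<^sup>2 * K * clt_remainder pA \<mu> (\<sigma>\<^sup>2) (\<bar>t\<bar> * K / sqrt (a n)) + t\<^sup>2 / 2 * (D * (a n / real n) + \<mu>\<^sub>B\<^sup>2 / a n))
     + lipschitz_const s t * \<mu>\<^sub>B * r + 2 * (real n * tail pX (K * a n))"
proof -
  let ?a = "a n" and ?n = "real n"
  define L where "L = lipschitz_const s t"
  define \<Theta> where "\<Theta> = clt_remainder pA \<mu> (\<sigma>\<^sup>2) (\<bar>t\<bar> * K / sqrt ?a)"
  have a0: "0 < ?a" and n0: "0 < ?n" and K0: "0 \<le> K" using an n K by auto
  have r0: "0 < r" and r2: "r\<^sup>2 = ?n / ?a\<^sup>2" using a0 n0 by (auto simp: r_def)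
  have m0: "0 \<le> m" by (simp add: m_def)
  have L0: "0 \<le> L" using lipschitz_const_pos[of s t] by (simp add: L_def)
  have \<Theta>0: "0 \<le> \<Theta>"
    unfolding \<Theta>_def clt_remainder_def using K a0
    by (intro add_nonneg_nonneg divide_nonneg_nonneg Bochner_Integration.integral_nonneg) auto
  define e1 where "e1 = L / ?a\<^sup>2 * (\<sigma>\<^sup>2 + \<mu> / r + \<sigma>\<^sup>2 * \<mu>\<^sub>B * r) + \<bar>t\<bar> / (?a * sqrt ?a) * ((1 + \<mu>\<^sub>B) * (L + 4) * (truncated_square ?a / ?a + tail_mean ?a)) + 12 * L * \<mu> * \<mu>\<^sub>B / ?a\<^sup>2"
  define e2 where "e2 = L / ?a\<^sup>2 * (\<sigma>\<^sup>2 * \<mu> * r) + t\<^sup>2 * K / ?a\<^sup>2 * \<Theta> + t\<^sup>2 / ?a ^ 3 / 2 * (truncated_square ?a + \<mu>\<^sub>B\<^sup>2)"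
  define e3 where "e3 = L / ?a\<^sup>2 * (\<mu>\<^sub>B / r)"
  have e0: "0 \<le> e1" "0 \<le> e2" "0 \<le> e3"
    using L0 a0 r0 K0 \<Theta>0 \<mu>(2) \<mu>\<^sub>B_nonneg truncated_square_nonneg[of ?a] tail_mean_nonneg[of ?a]
    by (auto simp: e1_def e2_def e3_def intro!: add_nonneg_nonneg mult_nonneg_nonneg divide_nonneg_nonneg)
  have small: "norm (remainder ?a s t x) \<le> e1 * x + e2 * (real x)\<^sup>2 + e3" if x: "real x \<le> K * ?a" for x
  proof -
    have "norm (remainder ?a s t x) \<le> L / ?a\<^sup>2 * (\<sigma>\<^sup>2 * x + (1 / r + \<sigma>\<^sup>2 * x / (1 / r)) * (\<mu> * x + \<mu>\<^sub>B))
      + t\<^sup>2 * K * (real x)\<^sup>2 / ?a\<^sup>2 * \<Theta> + t\<^sup>2 * (real x)\<^sup>2 / ?a ^ 3 / 2 * (truncated_square ?a + \<mu>\<^sub>B\<^sup>2)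
      + \<bar>t\<bar> * x / (?a * sqrt ?a) * ((1 + \<mu>\<^sub>B) * (L + 4) * (truncated_square ?a / ?a + tail_mean ?a)) + 12 * L * \<mu> * x * \<mu>\<^sub>B / ?a\<^sup>2"
      unfolding L_def \<Theta>_def using remainder_bound[OF an _ K0 x, of "1 / r" s t] r0 by simp
    also have "\<dots> = e1 * x + e2 * (real x)\<^sup>2 + e3"
    proof -
      define w where "w = (1 + \<mu>\<^sub>B) * (L + 4) * (truncated_square ?a / ?a + tail_mean ?a)"
      define v where "v = truncated_square ?a + \<mu>\<^sub>B\<^sup>2"
      have "L / ?a\<^sup>2 * (\<sigma>\<^sup>2 * x + (1 / r + \<sigma>\<^sup>2 * x / (1 / r)) * (\<mu> * x + \<mu>\<^sub>B)) =
        L / ?a\<^sup>2 * (\<sigma>\<^sup>2 + \<mu> / r + \<sigma>\<^sup>2 * \<mu>\<^sub>B * r) * x + L / ?a\<^sup>2 * (\<sigma>\<^sup>2 * \<mu> * r) * (real x)\<^sup>2 + L / ?a\<^sup>2 * (\<mu>\<^sub>B / r)"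
        by (simp add: power2_eq_square algebra_simps add_divide_distrib)
      then show ?thesis
        unfolding e1_def e2_def e3_def w_def[symmetric] v_def[symmetric] by (simp add: algebra_simps)
    qed
    finally show ?thesis .
  qed
  have pw: "norm (remainder ?a s t x) \<le> e1 * x + e2 * (min (real x) (K * ?a))\<^sup>2 + e3 + 2 * indicator {k. real k > K * ?a} x" for x
  proof (cases "real x \<le> K * ?a")
    case True
    then show ?thesis using small[OF True] by simp
  next
    case False
    then have "norm (remainder ?a s t x) \<le> 2 * indicator {k. real k > K * ?a} x"
      using norm_remainder[of ?a s t x] by simp
    then show ?thesis using e0 by (smt (verit) mult_nonneg_nonneg of_nat_0_le_iff zero_le_power2)
  qed
  have iX2: "integrable pX (\<lambda>x. (min (real x) (K * ?a))\<^sup>2)"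
    using K0 a0 by (intro integrable_pmf_bounded[where C="(K * ?a)\<^sup>2"]) (auto intro!: power_mono)
  define X2 where "X2 = measure_pmf.expectation pX (\<lambda>x. (min (real x) (K * ?a))\<^sup>2)"
  have "measure_pmf.expectation pX (\<lambda>x. norm (remainder ?a s t x)) \<le>
    measure_pmf.expectation pX (\<lambda>x. e1 * real x + e2 * (min (real x) (K * ?a))\<^sup>2 + e3 + 2 * indicat_real {k. real k > K * ?a} x)"
    by (rule expectation_nonneg_mono[OF _ _ pw]) (use integrable_X iX2 in \<open>auto intro!: integrable_indicator_pmf\<close>)
  also have "\<dots> = e1 * m + e2 * X2 + e3 + 2 * tail pX (K * ?a)"
    using integrable_X iX2 by (simp add: m_def X2_def tail_def)
  finally have "?n * measure_pmf.expectation pX (\<lambda>x. norm (remainder ?a s t x)) \<le> ?n * (e1 * m + e2 * X2 + e3 + 2 * tail pX (K * ?a))"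
    using n0 by (intro mult_left_mono) auto
  also have "\<dots> = m * (?n * e1) + (?n * X2 / ?a\<^sup>2) * (?a\<^sup>2 * e2) + ?n * e3 + 2 * (?n * tail pX (K * ?a))"
    using a0 by (simp add: algebra_simps)
  also have "\<dots> \<le> m * (L * (\<sigma>\<^sup>2 * r\<^sup>2 + \<mu> * r + \<sigma>\<^sup>2 * \<mu>\<^sub>B * (r * r\<^sup>2)) + \<bar>t\<bar> * ((1 + \<mu>\<^sub>B) * (L + 4) * (D + D)) / sqrt ?a + 12 * L * \<mu> * \<mu>\<^sub>B * r\<^sup>2)
     + D' * (L * \<sigma>\<^sup>2 * \<mu> * r + t\<^sup>2 * K * \<Theta> + t\<^sup>2 / 2 * (D * (?a / ?n) + \<mu>\<^sub>B\<^sup>2 / ?a)) + L * \<mu>\<^sub>B * r + 2 * (?n * tail pX (K * ?a))"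
  proof -
    have p: "?n * (L / ?a\<^sup>2 * z) = L * (r\<^sup>2 * z)" for z unfolding r2 by simp
    have rr: "r\<^sup>2 * (z / r) = r * z" for z using r0 by (simp add: power2_eq_square)
    have "?n * e1 = L * (r\<^sup>2 * (\<sigma>\<^sup>2 + \<mu> / r + \<sigma>\<^sup>2 * \<mu>\<^sub>B * r))
       + \<bar>t\<bar> * ((1 + \<mu>\<^sub>B) * (L + 4) * (?n * truncated_square ?a / ?a\<^sup>2 + ?n * tail_mean ?a / ?a)) / sqrt ?a + 12 * L * \<mu> * \<mu>\<^sub>B * r\<^sup>2"
    proof -
      have "?n * (\<bar>t\<bar> / (?a * sqrt ?a) * (w * (truncated_square ?a / ?a + tail_mean ?a))) = \<bar>t\<bar> * (w * (?n * truncated_square ?a / ?a\<^sup>2 + ?n * tail_mean ?a / ?a)) / sqrt ?a" for w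
        using a0 by (simp add: power2_eq_square field_simps)
      then show ?thesis unfolding e1_def distrib_left p r2 by simp
    qed
    also have "r\<^sup>2 * (\<sigma>\<^sup>2 + \<mu> / r + \<sigma>\<^sup>2 * \<mu>\<^sub>B * r) = \<sigma>\<^sup>2 * r\<^sup>2 + \<mu> * r + \<sigma>\<^sup>2 * \<mu>\<^sub>B * (r * r\<^sup>2)"
      unfolding distrib_left rr by simp
    also have "\<bar>t\<bar> * ((1 + \<mu>\<^sub>B) * (L + 4) * (?n * truncated_square ?a / ?a\<^sup>2 + ?n * tail_mean ?a / ?a)) / sqrt ?a \<le> \<bar>t\<bar> * ((1 + \<mu>\<^sub>B) * (L + 4) * (D + D)) / sqrt ?a"
      using D L0 \<mu>\<^sub>B_nonneg a0 by (intro divide_right_mono mult_left_mono add_mono) auto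
    finally have A1: "?n * e1 \<le> L * (\<sigma>\<^sup>2 * r\<^sup>2 + \<mu> * r + \<sigma>\<^sup>2 * \<mu>\<^sub>B * (r * r\<^sup>2)) + \<bar>t\<bar> * ((1 + \<mu>\<^sub>B) * (L + 4) * (D + D)) / sqrt ?a + 12 * L * \<mu> * \<mu>\<^sub>B * r\<^sup>2"
      by simp
    have A2: "?n * X2 / ?a\<^sup>2 \<le> D'" using D' by (simp add: X2_def)
    have "?n * e3 = L * \<mu>\<^sub>B * r" unfolding e3_def p rr by simp
    then have A3: "?n * e3 \<le> L * \<mu>\<^sub>B * r" by simp
    have X20: "0 \<le> X2" by (simp add: X2_def)
    then have "0 \<le> ?n * X2 / ?a\<^sup>2" by simp
    with A2 have A4: "0 \<le> D'" by linarith
    have A5: "0 \<le> ?a\<^sup>2 * e2" using e0 by simp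
    have "?a\<^sup>2 * e2 = L * \<sigma>\<^sup>2 * \<mu> * r + t\<^sup>2 * K * \<Theta> + t\<^sup>2 / 2 * (truncated_square ?a / ?a + \<mu>\<^sub>B\<^sup>2 / ?a)"
    proof -
      have 1: "?a\<^sup>2 * (L / ?a\<^sup>2 * z) = L * z" "?a\<^sup>2 * (t\<^sup>2 * K / ?a\<^sup>2 * z) = t\<^sup>2 * K * z" for z using a0 by auto
      have 2: "?a\<^sup>2 * (t\<^sup>2 / ?a ^ 3 / 2 * (u + v)) = t\<^sup>2 / 2 * (u / ?a + v / ?a)" for u v
        using a0 by (simp add: power2_eq_square power3_eq_cube field_simps)
      show ?thesis unfolding e2_def distrib_left[of "?a\<^sup>2"] 1 2 by simp
    qed
    also have "truncated_square ?a / ?a = (?n * truncated_square ?a / ?a\<^sup>2) * (?a / ?n)"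
      using a0 n0 by (simp add: power2_eq_square)
    also have "L * \<sigma>\<^sup>2 * \<mu> * r + t\<^sup>2 * K * \<Theta> + t\<^sup>2 / 2 * ((?n * truncated_square ?a / ?a\<^sup>2) * (?a / ?n) + \<mu>\<^sub>B\<^sup>2 / ?a) \<le>
       L * \<sigma>\<^sup>2 * \<mu> * r + t\<^sup>2 * K * \<Theta> + t\<^sup>2 / 2 * (D * (?a / ?n) + \<mu>\<^sub>B\<^sup>2 / ?a)"
      using D a0 n0 by (intro add_left_mono mult_left_mono add_right_mono mult_right_mono) auto
    finally have A6: "?a\<^sup>2 * e2 \<le> L * \<sigma>\<^sup>2 * \<mu> * r + t\<^sup>2 * K * \<Theta> + t\<^sup>2 / 2 * (D * (?a / ?n) + \<mu>\<^sub>B\<^sup>2 / ?a)" .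
    show ?thesis
      by (rule add_mono[OF add_mono[OF add_mono[OF mult_left_mono[OF A1 m0] mult_mono[OF A2 A6 A4 A5]] A3] order_refl])
  qed
  finally show ?thesis unfolding L_def \<Theta>_def .
qed

text \<open>For fixed \<open>K\<close> all terms of the bound vanish except \<open>2 * (n * tail pX (K * a n))\<close>, whose limit
  \<open>2 * K powr (- \<alpha>)\<close> is made small by the choice of \<open>K\<close>.\<close>

theorem expected_remainder_tendsto_0:
  "(\<lambda>n. real n * measure_pmf.expectation pX (\<lambda>x. norm (remainder (a n) s t x))) \<longlonglongrightarrow> 0"
proof (rule order_tendstoI)
  let ?F = "\<lambda>n. real n * measure_pmf.expectation pX (\<lambda>x. norm (remainder (a n) s t x))"
  fix e :: real
  show "eventually (\<lambda>n. e < ?F n) sequentially" if "e < 0"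
    using that by (intro always_eventually allI less_le_trans[OF that] mult_nonneg_nonneg) auto
  assume e: "0 < e"
  have "((\<lambda>K. 2 * (1 * K powr (-\<alpha>))) \<longlongrightarrow> 2 * (1 * 0)) at_top"
    using \<alpha>(1) by (intro tendsto_intros tendsto_neg_powr filterlim_ident) auto
  then have "eventually (\<lambda>K. 2 * (1 * K powr (-\<alpha>)) < e \<and> 1 \<le> K) at_top"
    using e by (intro eventually_conj order_tendstoD(2) eventually_ge_at_top) auto
  then obtain K where K: "2 * (1 * K powr (-\<alpha>)) < e" "1 \<le> K"
    by (auto simp: eventually_at_top_linorder)
  have K0: "0 < K" using K by simp
  obtain D where D: "0 \<le> D" "eventually (\<lambda>n. real n * truncated_square (a n) / (a n)\<^sup>2 \<le> D \<and> real n * tail_mean (a n) / a n \<le> D) sequentially"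
    by (rule immigration_moments_bounded)
  obtain D' where D': "0 \<le> D'" "eventually (\<lambda>n. real n * measure_pmf.expectation pX (\<lambda>k. (min (real k) (K * a n))\<^sup>2) / (a n)\<^sup>2 \<le> D') sequentially"
    by (rule stationary_second_moment_bounded[OF K0])
  define r where "r n = sqrt (real n / (a n)\<^sup>2)" for n
  define m where "m = measure_pmf.expectation pX real"
  define H where "H n = m * (lipschitz_const s t * (\<sigma>\<^sup>2 * (r n)\<^sup>2 + \<mu> * r n + \<sigma>\<^sup>2 * \<mu>\<^sub>B * (r n * (r n)\<^sup>2)) + \<bar>t\<bar> * ((1 + \<mu>\<^sub>B) * (lipschitz_const s t + 4) * (D + D)) / sqrt (a n) + 12 * lipschitz_const s t * \<mu> * \<mu>\<^sub>B * (r n)\<^sup>2)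
     + D' * (lipschitz_const s t * \<sigma>\<^sup>2 * \<mu> * r n + t\<^sup>2 * K * clt_remainder pA \<mu> (\<sigma>\<^sup>2) (\<bar>t\<bar> * K / sqrt (a n)) + t\<^sup>2 / 2 * (D * (a n / real n) + \<mu>\<^sub>B\<^sup>2 / a n))
     + lipschitz_const s t * \<mu>\<^sub>B * r n + 2 * (real n * tail pX (K * a n))" for n
  have r: "r \<longlonglongrightarrow> 0"
    using tendsto_real_sqrt[OF n_over_a_square] by (simp add: r_def[abs_def])
  have ai: "filterlim a at_infinity sequentially" by (rule filterlim_at_top_imp_at_infinity[OF a])
  have sa: "filterlim (\<lambda>n. sqrt (a n)) at_infinity sequentially"
    by (intro filterlim_at_top_imp_at_infinity filterlim_compose[OF sqrt_at_top a])
  have d: "(\<lambda>n. c / sqrt (a n)) \<longlonglongrightarrow> 0" "(\<lambda>n. c / a n) \<longlonglongrightarrow> 0" for c :: real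
    by (rule tendsto_divide_0[OF tendsto_const] sa ai)+
  have apos: "eventually (\<lambda>n. 1 \<le> a n) sequentially" using a by (simp add: filterlim_at_top)
  have \<Theta>: "(\<lambda>n. clt_remainder pA \<mu> (\<sigma>\<^sup>2) (\<bar>t\<bar> * K / sqrt (a n))) \<longlonglongrightarrow> 0"
  proof -
    have "(\<lambda>n. clt_remainder pA \<mu> (\<sigma>\<^sup>2) \<bar>\<bar>t\<bar> * K / sqrt (a n)\<bar>) \<longlonglongrightarrow> 0"
      by (rule clt_remainder_tendsto_0[OF \<sigma>(1) \<mu>(1) \<sigma>(2) abs_ge_zero tendsto_rabs_zero[OF d(1)]])
    moreover have "eventually (\<lambda>n. clt_remainder pA \<mu> (\<sigma>\<^sup>2) \<bar>\<bar>t\<bar> * K / sqrt (a n)\<bar> = clt_remainder pA \<mu> (\<sigma>\<^sup>2) (\<bar>t\<bar> * K / sqrt (a n))) sequentially"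
      using apos by eventually_elim (use K0 in auto)
    ultimately show ?thesis by (rule Lim_transform_eventually)
  qed
  have "H \<longlonglongrightarrow> m * (lipschitz_const s t * (\<sigma>\<^sup>2 * 0\<^sup>2 + \<mu> * 0 + \<sigma>\<^sup>2 * \<mu>\<^sub>B * (0 * 0\<^sup>2)) + 0 + 12 * lipschitz_const s t * \<mu> * \<mu>\<^sub>B * 0\<^sup>2)
     + D' * (lipschitz_const s t * \<sigma>\<^sup>2 * \<mu> * 0 + t\<^sup>2 * K * 0 + t\<^sup>2 / 2 * (D * 0 + 0)) + lipschitz_const s t * \<mu>\<^sub>B * 0 + 2 * (1 * K powr (-\<alpha>))"
    unfolding H_def
    by (intro tendsto_add tendsto_mult tendsto_const tendsto_power r d \<Theta> a_over_n
      regularly_varying_scaled_tail[OF regularly_varying_X a tail_a K0])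
  then have "eventually (\<lambda>n. H n < e) sequentially"
    using K by (intro order_tendstoD(2)) auto
  then show "eventually (\<lambda>n. ?F n < e) sequentially"
    using apos D(2) D'(2) eventually_ge_at_top[of 1]
  proof eventually_elim
    case (elim n)
    have "?F n \<le> H n"
      unfolding H_def r_def m_def using elim K(2) by (intro expected_remainder_bound) auto
    then show ?case using elim by simp
  qed
qed

end

end

section \<open>The characteristic function along the path\<close>

text \<open>Paths are lists with the newest state at the head, so that a transition prepends an element.\<close>

primrec path_sum :: "(nat \<Rightarrow> nat \<Rightarrow> real) \<Rightarrow> nat list \<Rightarrow> real" where
  "path_sum f [] = 0"
| "path_sum f (y # xs) = (if xs = [] then 0 else f (hd xs) y + path_sum f xs)"

primrec markov_path :: "nat pmf \<Rightarrow> (nat \<Rightarrow> nat pmf) \<Rightarrow> nat \<Rightarrow> nat list pmf" where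
  "markov_path p K 0 = map_pmf (\<lambda>x. [x]) p"
| "markov_path p K (Suc k) = bind_pmf (markov_path p K k) (\<lambda>xs. map_pmf (\<lambda>y. y # xs) (K (hd xs)))"

lemma markov_path_nonempty: "xs \<in> set_pmf (markov_path p K k) \<Longrightarrow> xs \<noteq> []"
  by (induction k) auto

lemma markov_path_hd:
  assumes "bind_pmf p K = p"
  shows "map_pmf hd (markov_path p K k) = p"
proof (induction k)
  case 0
  show ?case by (simp add: map_pmf_comp)
next
  case (Suc k)
  have "map_pmf hd (markov_path p K (Suc k)) = bind_pmf (map_pmf hd (markov_path p K k)) K"
    by (simp add: map_bind_pmf map_pmf_comp bind_map_pmf)
  then show ?case by (simp add: Suc assms)
qed

lemma exp_scaled_difference_tendsto:
  fixes z :: complex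
  shows "(\<lambda>n. of_nat n * (exp (z / of_nat n) - 1)) \<longlonglongrightarrow> z"
proof (cases "z = 0")
  case False
  have "((\<lambda>h::complex. (exp (0 + h) - exp 0) / h) \<longlongrightarrow> exp 0) (at 0)"
    using DERIV_exp[of "0::complex"] unfolding DERIV_def .
  then have d: "((\<lambda>h::complex. (exp h - 1) / h) \<longlongrightarrow> 1) (at 0)" by simp
  have "filterlim (\<lambda>n. z / of_nat n) (at 0) sequentially"
    unfolding filterlim_at
  proof
    show "eventually (\<lambda>n. z / of_nat n \<in> UNIV \<and> z / of_nat n \<noteq> 0) sequentially"
      using eventually_gt_at_top[of 0] by eventually_elim (use False in auto)
    show "(\<lambda>n. z / of_nat n) \<longlonglongrightarrow> 0" by (rule lim_const_over_n)
  qed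
  from filterlim_compose[OF d this]
  have "(\<lambda>n. z * ((exp (z / of_nat n) - 1) / (z / of_nat n))) \<longlonglongrightarrow> z * 1"
    by (intro tendsto_mult tendsto_const)
  moreover have "z * ((exp (z / of_nat n) - 1) / (z / of_nat n)) = of_nat n * (exp (z / of_nat n) - 1)" for n
    using False by simp
  ultimately show ?thesis by simp
qed simp

text \<open>On the closed unit disc \<open>norm (x ^ n - y ^ n) \<le> n * norm (x - y)\<close>; with \<open>y = exp (z / n)\<close> no logarithm
  of \<open>w n\<close> is needed. The limit \<open>z\<close> has nonpositive real part because every \<open>w n\<close> lies in the disc.\<close>

lemma power_tendsto_exp:
  fixes w :: "nat \<Rightarrow> complex"
  assumes w: "\<And>n. norm (w n) \<le> 1" and lim: "(\<lambda>n. of_nat n * (w n - 1)) \<longlonglongrightarrow> z"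
  shows "(\<lambda>n. w n ^ n) \<longlonglongrightarrow> exp z"
proof -
  have "(\<lambda>n. Re (of_nat n * (w n - 1))) \<longlonglongrightarrow> Re z" by (intro tendsto_intros lim)
  moreover have "Re (of_nat n * (w n - 1)) \<le> 0" for n
    using w[of n] complex_Re_le_cmod[of "w n"] by (simp add: mult_nonneg_nonpos)
  ultimately have z: "Re z \<le> 0" by (intro LIMSEQ_le_const2[where a=0]) auto
  have "(\<lambda>n. w n ^ n - exp z) \<longlonglongrightarrow> 0"
  proof (rule Lim_null_comparison)
    have "(\<lambda>n. of_nat n * (w n - 1) - of_nat n * (exp (z / of_nat n) - 1)) \<longlonglongrightarrow> z - z"
      by (intro tendsto_diff lim exp_scaled_difference_tendsto)
    then show "(\<lambda>n. norm (of_nat n * (w n - 1) - of_nat n * (exp (z / of_nat n) - 1))) \<longlonglongrightarrow> 0"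
      by (simp add: tendsto_norm_zero)
    show "eventually (\<lambda>n. norm (w n ^ n - exp z) \<le> norm (of_nat n * (w n - 1) - of_nat n * (exp (z / of_nat n) - 1))) sequentially"
      using eventually_gt_at_top[of 0]
    proof eventually_elim
      case (elim n)
      have "exp (z / of_nat n) ^ n = exp z"
        using elim by (simp add: exp_of_nat_mult[symmetric])
      moreover have "norm (exp (z / of_nat n)) \<le> 1"
        using z elim by (simp add: Re_divide_of_nat divide_nonpos_nonneg)
      ultimately have "norm (w n ^ n - exp z) \<le> real n * norm (w n - exp (z / of_nat n))"
        using norm_power_diff[OF w[of n], of "exp (z / of_nat n)" n] by simp
      also have "\<dots> = norm (of_nat n * (w n - exp (z / of_nat n)))" by (simp add: norm_mult)
      also have "of_nat n * (w n - exp (z / of_nat n)) = of_nat n * (w n - 1) - of_nat n * (exp (z / of_nat n) - 1)"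
        by (simp add: algebra_simps)
      finally show ?case .
    qed
  qed
  then show ?thesis by (rule LIM_zero_cancel)
qed

context gwi_law
begin

abbreviation path :: "nat \<Rightarrow> nat list pmf" where
  "path \<equiv> markov_path pX (gwi_step pA pB)"

text \<open>The characteristic function of the sum up to time \<open>k\<close>, corrected by the expected effect that the
  current population has on later increments.\<close>

definition corrected_cf :: "real \<Rightarrow> real \<Rightarrow> real \<Rightarrow> nat \<Rightarrow> complex" where
  "corrected_cf a s t k = measure_pmf.expectation (path k)
     (\<lambda>xs. iexp (path_sum (increment a s t) xs) * limit_cf s t (real (hd xs) / a))"

lemma expectation_path_hd:
  fixes f :: "nat \<Rightarrow> 'b::{banach, second_countable_topology}"
  shows "measure_pmf.expectation (path k) (\<lambda>xs. f (hd xs)) = measure_pmf.expectation pX f"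
  using integral_map_pmf[of hd "path k" f] by (simp add: markov_path_hd[OF stationary])

text \<open>Conditioning on the path up to time \<open>k\<close> leaves an error \<open>remainder\<close> of the current state, multiplied
  by a number of modulus one. The absolute value therefore depends on the current state alone, whose
  law is \<open>pX\<close> by invariance; no dependence along the path has to be controlled.\<close>

lemma corrected_cf_step:
  "norm (corrected_cf a s t (Suc k) - immigration_cf a s t * corrected_cf a s t k) \<le>
     measure_pmf.expectation pX (\<lambda>x. norm (remainder a s t x))"
proof -
  let ?Z = "path_sum (increment a s t)" and ?g = "\<lambda>y. limit_cf s t (real y / a)"
  let ?E = "\<lambda>x. measure_pmf.expectation (gwi_step pA pB x) (\<lambda>y. iexp (increment a s t x y) * ?g y)"
  have "corrected_cf a s t (Suc k) = measure_pmf.expectation (path k)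
      (\<lambda>xs. measure_pmf.expectation (map_pmf (\<lambda>y. y # xs) (gwi_step pA pB (hd xs))) (\<lambda>ys. iexp (?Z ys) * ?g (hd ys)))"
    unfolding corrected_cf_def markov_path.simps
    by (rule expectation_bind_pmf[where C=1]) (simp add: norm_mult norm_limit_cf)
  also have "\<dots> = measure_pmf.expectation (path k) (\<lambda>xs. iexp (?Z xs) * ?E (hd xs))"
  proof (rule integral_cong_AE)
    show "AE xs in path k. measure_pmf.expectation (map_pmf (\<lambda>y. y # xs) (gwi_step pA pB (hd xs))) (\<lambda>ys. iexp (?Z ys) * ?g (hd ys))
       = iexp (?Z xs) * ?E (hd xs)"
    proof (rule AE_pmfI)
      fix xs assume "xs \<in> set_pmf (path k)"
      then have ne: "xs \<noteq> []" by (rule markov_path_nonempty)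
      have "iexp (?Z (y # xs)) * ?g (hd (y # xs)) = iexp (?Z xs) * (iexp (increment a s t (hd xs) y) * ?g y)" for y
        using ne by (simp add: distrib_left exp_add)
      then show "measure_pmf.expectation (map_pmf (\<lambda>y. y # xs) (gwi_step pA pB (hd xs))) (\<lambda>ys. iexp (?Z ys) * ?g (hd ys))
       = iexp (?Z xs) * ?E (hd xs)"
        by (simp only: integral_map_pmf integral_mult_right_zero)
    qed
  qed auto
  finally have 1: "corrected_cf a s t (Suc k) = measure_pmf.expectation (path k) (\<lambda>xs. iexp (?Z xs) * ?E (hd xs))" .
  have nE: "norm (?E x) \<le> 1" for x
    by (rule norm_expectation_le) (simp add: norm_mult norm_limit_cf)
  have i1: "integrable (path k) (\<lambda>xs. iexp (?Z xs) * ?E (hd xs))"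
    by (rule integrable_pmf_bounded[where C=1]) (use nE in \<open>simp add: norm_mult\<close>)
  have i2: "integrable (path k) (\<lambda>xs. iexp (?Z xs) * ?g (hd xs))"
    by (rule integrable_pmf_bounded[where C=1]) (simp add: norm_mult norm_limit_cf)
  have "corrected_cf a s t (Suc k) - immigration_cf a s t * corrected_cf a s t k =
    measure_pmf.expectation (path k) (\<lambda>xs. iexp (?Z xs) * ?E (hd xs) - immigration_cf a s t * (iexp (?Z xs) * ?g (hd xs)))"
    unfolding 1 unfolding corrected_cf_def using i1 i2 by simp
  moreover have "iexp (?Z xs) * ?E (hd xs) - immigration_cf a s t * (iexp (?Z xs) * ?g (hd xs)) = iexp (?Z xs) * remainder a s t (hd xs)" for xs
    by (simp add: remainder_def algebra_simps)
  ultimately have 2: "corrected_cf a s t (Suc k) - immigration_cf a s t * corrected_cf a s t k =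
    measure_pmf.expectation (path k) (\<lambda>xs. iexp (?Z xs) * remainder a s t (hd xs))" by simp
  have "norm (measure_pmf.expectation (path k) (\<lambda>xs. iexp (?Z xs) * remainder a s t (hd xs))) \<le>
    measure_pmf.expectation (path k) (\<lambda>xs. norm (remainder a s t (hd xs)))"
    by (rule norm_expectation_le_integral)
       (auto simp: norm_mult intro!: integrable_pmf_bounded[where C=2] norm_remainder)
  then show ?thesis unfolding 2 expectation_path_hd[of k "\<lambda>x. norm (remainder a s t x)"] .
qed

lemma corrected_cf_telescope:
  "norm (corrected_cf a s t k - immigration_cf a s t ^ k * corrected_cf a s t 0) \<le>
     real k * measure_pmf.expectation pX (\<lambda>x. norm (remainder a s t x))"
proof (induction k)
  case (Suc k)
  let ?w = "immigration_cf a s t" and ?u = "corrected_cf a s t"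
  have "?u (Suc k) - ?w ^ Suc k * ?u 0 = (?u (Suc k) - ?w * ?u k) + ?w * (?u k - ?w ^ k * ?u 0)"
    by (simp add: algebra_simps)
  also have "norm \<dots> \<le> norm (?u (Suc k) - ?w * ?u k) + norm ?w * norm (?u k - ?w ^ k * ?u 0)"
    by (rule order_trans[OF norm_triangle_ineq]) (simp add: norm_mult)
  also have "\<dots> \<le> measure_pmf.expectation pX (\<lambda>x. norm (remainder a s t x)) + 1 * (real k * measure_pmf.expectation pX (\<lambda>x. norm (remainder a s t x)))"
    by (intro add_mono corrected_cf_step mult_mono norm_immigration_cf Suc) auto
  finally show ?case by (simp add: algebra_simps)
qed simp

text \<open>The correction is negligible at both ends of the path because \<open>X / a n \<rightarrow> 0\<close> in probability, so only
  the power of \<open>immigration_cf\<close> survives.\<close>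

theorem path_cf_tendsto:
  fixes a :: "nat \<Rightarrow> real"
  assumes a: "filterlim a at_top sequentially" and tail_a: "(\<lambda>n. real n * tail pX (a n)) \<longlonglongrightarrow> 1"
  shows "(\<lambda>n. measure_pmf.expectation (path n) (\<lambda>xs. iexp (path_sum (increment (a n) s t) xs))) \<longlonglongrightarrow>
    exp (of_real (1 - \<mu> powr \<alpha>) * (LINT y|stable_levy \<alpha>. limit_cf s t y - 1))"
proof -
  define z where "z = of_real (1 - \<mu> powr \<alpha>) * (LINT y|stable_levy \<alpha>. limit_cf s t y - 1)"
  let ?u = "\<lambda>n. corrected_cf (a n) s t n" and ?v = "\<lambda>n. corrected_cf (a n) s t 0"
    and ?w = "\<lambda>n. immigration_cf (a n) s t"
    and ?E = "\<lambda>n. measure_pmf.expectation (path n) (\<lambda>xs. iexp (path_sum (increment (a n) s t) xs))"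
  have w: "(\<lambda>n. of_nat n * (?w n - 1)) \<longlonglongrightarrow> z"
  proof -
    define C where "C = max 2 (lipschitz_const s t)"
    have "(\<lambda>n. of_nat n * measure_pmf.expectation pB (\<lambda>k. limit_cf s t (real k / a n) - 1)) \<longlonglongrightarrow> z"
      unfolding z_def
    proof (rule scaled_expectation_tendsto_levy_integral[OF \<alpha>(3) _ \<alpha>(2) a tail_B_a[OF a tail_a]])
      show "isCont (\<lambda>y. limit_cf s t y - 1) y" for y by (intro continuous_intros isCont_limit_cf)
      show "norm (limit_cf s t y - 1) \<le> C" for y
        using norm_triangle_ineq4[of "limit_cf s t y" 1] norm_limit_cf[of s t y] by (simp add: C_def)
      show "norm (limit_cf s t y - 1) \<le> C * y\<^sup>2" if "0 \<le> y" for y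
        by (rule order_trans[OF limit_cf_minus_1[OF that] mult_right_mono]) (auto simp: C_def)
    qed (use \<alpha>(1) in simp)
    moreover have "measure_pmf.expectation pB (\<lambda>k. limit_cf s t (real k / a n) - 1) = ?w n - 1" for n
      unfolding immigration_cf_def
      by (subst Bochner_Integration.integral_diff) (auto intro!: integrable_pmf_bounded[where C=1] norm_limit_cf)
    ultimately show ?thesis by simp
  qed
  have wn: "(\<lambda>n. ?w n ^ n) \<longlonglongrightarrow> exp z" by (rule power_tendsto_exp[OF norm_immigration_cf w])
  have ig: "integrable p (\<lambda>k. limit_cf s t (real k / b))" for p :: "nat pmf" and b
    by (rule integrable_pmf_bounded[where C=1]) (rule norm_limit_cf)
  have g1: "(\<lambda>n. measure_pmf.expectation pX (\<lambda>x. norm (limit_cf s t (real x / a n) - 1))) \<longlonglongrightarrow> 0"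
  proof -
    have "(\<lambda>n. measure_pmf.expectation pX (\<lambda>x. norm (limit_cf s t (real x / a n) - 1))) \<longlonglongrightarrow> measure_pmf.expectation pX (\<lambda>x. 0)"
    proof (rule integral_dominated_convergence[where w="\<lambda>_. 2"])
      show "AE x in pX. (\<lambda>n. norm (limit_cf s t (real x / a n) - 1)) \<longlonglongrightarrow> 0"
      proof (rule AE_I2)
        fix x
        have "(\<lambda>n. real x / a n) \<longlonglongrightarrow> 0"
          by (rule tendsto_divide_0[OF tendsto_const filterlim_at_top_imp_at_infinity[OF a]])
        then have "(\<lambda>n. limit_cf s t (real x / a n)) \<longlonglongrightarrow> limit_cf s t 0"
          by (rule isCont_tendsto_compose[OF isCont_limit_cf])
        then show "(\<lambda>n. norm (limit_cf s t (real x / a n) - 1)) \<longlonglongrightarrow> 0"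
          by (intro tendsto_norm_zero) (simp add: LIM_zero)
      qed
      show "AE x in pX. norm (norm (limit_cf s t (real x / a n) - 1)) \<le> 2" for n
      proof (rule AE_I2)
        show "norm (norm (limit_cf s t (real x / a n) - 1)) \<le> 2" for x
          using norm_triangle_ineq4[of "limit_cf s t (real x / a n)" 1] norm_limit_cf[of s t "real x / a n"] by simp
      qed
    qed auto
    then show ?thesis by simp
  qed
  have ng: "integrable p (\<lambda>xs. norm (limit_cf s t (real (f xs) / b) - 1))" for p :: "'z pmf" and f b
  proof (rule integrable_pmf_bounded[where C=2])
    show "norm (norm (limit_cf s t (real (f xs) / b) - 1)) \<le> 2" for xs
      using norm_triangle_ineq4[of "limit_cf s t (real (f xs) / b)" 1] norm_limit_cf[of s t "real (f xs) / b"] by simp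
  qed
  have u0: "?v \<longlonglongrightarrow> 1"
  proof -
    have "?v n - 1 = measure_pmf.expectation pX (\<lambda>x. limit_cf s t (real x / a n) - 1)" for n
      using ig by (simp add: corrected_cf_def)
    then have "norm (?v n - 1) \<le> measure_pmf.expectation pX (\<lambda>x. norm (limit_cf s t (real x / a n) - 1))" for n
      by (simp add: integral_norm_bound)
    then have "(\<lambda>n. ?v n - 1) \<longlonglongrightarrow> 0"
      by (intro Lim_null_comparison[OF _ g1]) auto
    then show ?thesis by (rule LIM_zero_cancel)
  qed
  have d1: "(\<lambda>n. ?u n - ?w n ^ n * ?v n) \<longlonglongrightarrow> 0"
  proof (rule Lim_null_comparison[OF _ expected_remainder_tendsto_0[OF a tail_a, of s t]])
    show "eventually (\<lambda>n. norm (?u n - ?w n ^ n * ?v n) \<le>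
        real n * measure_pmf.expectation pX (\<lambda>x. norm (remainder (a n) s t x))) sequentially"
      using corrected_cf_telescope by (intro always_eventually) blast
  qed
  have d2: "(\<lambda>n. ?E n - ?u n) \<longlonglongrightarrow> 0"
  proof (rule Lim_null_comparison[OF always_eventually g1], rule allI)
    fix n
    let ?Z = "path_sum (increment (a n) s t)"
    have i1: "integrable (path n) (\<lambda>xs. iexp (?Z xs))" by (rule integrable_pmf_bounded[where C=1]) simp
    have i2: "integrable (path n) (\<lambda>xs. iexp (?Z xs) * limit_cf s t (real (hd xs) / a n))"
      by (rule integrable_pmf_bounded[where C=1]) (simp add: norm_mult norm_limit_cf)
    have "?E n - ?u n = measure_pmf.expectation (path n) (\<lambda>xs. iexp (?Z xs) - iexp (?Z xs) * limit_cf s t (real (hd xs) / a n))"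
      unfolding corrected_cf_def using i1 i2 by simp
    moreover have "norm (measure_pmf.expectation (path n) (\<lambda>xs. iexp (?Z xs) - iexp (?Z xs) * limit_cf s t (real (hd xs) / a n))) \<le>
       measure_pmf.expectation (path n) (\<lambda>xs. norm (limit_cf s t (real (hd xs) / a n) - 1))"
    proof (rule norm_expectation_le_integral[OF ng])
      fix xs
      have "iexp (?Z xs) - iexp (?Z xs) * limit_cf s t (real (hd xs) / a n) = - (iexp (?Z xs) * (limit_cf s t (real (hd xs) / a n) - 1))"
        by (simp add: algebra_simps)
      then show "norm (iexp (?Z xs) - iexp (?Z xs) * limit_cf s t (real (hd xs) / a n)) \<le> norm (limit_cf s t (real (hd xs) / a n) - 1)"
        by (simp add: norm_mult)
    qed
    ultimately show "norm (?E n - ?u n) \<le> measure_pmf.expectation pX (\<lambda>x. norm (limit_cf s t (real x / a n) - 1))"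
      using expectation_path_hd[of n "\<lambda>x. norm (limit_cf s t (real x / a n) - 1)"] by simp
  qed
  have "(\<lambda>n. (?E n - ?u n) + (?u n - ?w n ^ n * ?v n) + ?w n ^ n * ?v n) \<longlonglongrightarrow> 0 + 0 + exp z * 1"
    by (intro tendsto_add tendsto_mult d1 d2 wn u0)
  then show ?thesis by (simp add: z_def)
qed

end

section \<open>The observed path is a Markov chain\<close>

lemma pmf_of_countable_law:
  fixes Y :: "'a \<Rightarrow> 'b::countable"
  assumes "prob_space M" and Y: "Y \<in> measurable M (count_space UNIV)"
  obtains p where "distr M (count_space UNIV) Y = measure_pmf p"
proof -
  interpret prob_space M by fact
  let ?D = "distr M (count_space UNIV) Y"
  interpret D: prob_space ?D by (rule prob_space_distr[OF Y])
  have "AE x in ?D. \<forall>y. measure ?D {y} = 0 \<longrightarrow> x \<noteq> y"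
    unfolding AE_all_countable
  proof
    fix y
    show "AE x in ?D. measure ?D {y} = 0 \<longrightarrow> x \<noteq> y"
    proof (cases "measure ?D {y} = 0")
      case True
      then have "{y} \<in> null_sets ?D"
        by (auto simp: null_sets_def D.emeasure_eq_measure)
      from AE_not_in[OF this] show ?thesis by eventually_elim auto
    qed auto
  qed
  then have "AE x in ?D. measure ?D {x} \<noteq> 0" by eventually_elim auto
  then have "measure_pmf (Abs_pmf ?D) = ?D"
    by (intro Abs_pmf_inverse) (auto intro: D.prob_space_axioms)
  then show ?thesis by (intro that[of "Abs_pmf ?D"]) simp
qed

lemma law_eq_pmfI:
  fixes Y :: "'a \<Rightarrow> 'b::countable"
  assumes "prob_space M" and Y: "Y \<in> measurable M (count_space UNIV)"
    and eq: "\<And>y. measure M {\<omega> \<in> space M. Y \<omega> = y} = pmf p y"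
  shows "distr M (count_space UNIV) Y = measure_pmf p"
proof (rule measure_eqI_countable)
  interpret prob_space M by fact
  fix y :: 'b
  have "emeasure (distr M (count_space UNIV) Y) {y} = emeasure M {\<omega> \<in> space M. Y \<omega> = y}"
    using Y by (subst emeasure_distr) (auto intro!: arg_cong[where f="emeasure M"])
  then show "emeasure (distr M (count_space UNIV) Y) {y} = emeasure (measure_pmf p) {y}"
    by (simp add: emeasure_eq_measure eq emeasure_pmf_single)
qed auto

lemma prob_sum_independent:
  fixes U V :: "'a \<Rightarrow> nat"
  assumes M: "prob_space M" and U[measurable]: "U \<in> measurable M (count_space UNIV)" and V[measurable]: "V \<in> measurable M (count_space UNIV)"
    and eq: "\<And>u v. measure M ({\<omega> \<in> space M. U \<omega> = u} \<inter> {\<omega> \<in> space M. V \<omega> = v}) = pmf p u * pmf q v"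
  shows "measure M {\<omega> \<in> space M. U \<omega> + V \<omega> = m} = pmf (map_pmf (\<lambda>(u, v). u + v) (pair_pmf p q)) m"
proof -
  have meas: "(\<lambda>\<omega>. (U \<omega>, V \<omega>)) \<in> measurable M (count_space UNIV)"
  proof -
    have "(\<lambda>\<omega>. (U \<omega>, V \<omega>)) \<in> measurable M (count_space UNIV \<Otimes>\<^sub>M count_space UNIV)" by measurable
    then show ?thesis by (subst (asm) pair_measure_countable) auto
  qed
  have d: "distr M (count_space UNIV) (\<lambda>\<omega>. (U \<omega>, V \<omega>)) = measure_pmf (pair_pmf p q)"
  proof (rule law_eq_pmfI[OF M meas])
    fix y :: "nat \<times> nat"
    have "{\<omega> \<in> space M. (U \<omega>, V \<omega>) = y} = {\<omega> \<in> space M. U \<omega> = fst y} \<inter> {\<omega> \<in> space M. V \<omega> = snd y}" by auto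
    then show "measure M {\<omega> \<in> space M. (U \<omega>, V \<omega>) = y} = pmf (pair_pmf p q) y"
      by (cases y) (simp add: eq pmf_pair)
  qed
  have "measure M {\<omega> \<in> space M. U \<omega> + V \<omega> = m} = measure (distr M (count_space UNIV) (\<lambda>\<omega>. (U \<omega>, V \<omega>))) {z. fst z + snd z = m}"
    using meas by (subst measure_distr) (auto intro!: arg_cong[where f="measure M"])
  also have "\<dots> = measure (measure_pmf (pair_pmf p q)) ((\<lambda>(u, v). u + v) -` {m})"
    unfolding d by (auto intro!: arg_cong[where f="measure _"])
  finally show ?thesis by (simp add: pmf_map)
qed

lemma pmf_markov_path_Suc:
  "pmf (markov_path p K (Suc k)) (y # ys) = pmf (markov_path p K k) ys * pmf (K (hd ys)) y"
proof -
  have "pmf (map_pmf (\<lambda>y. y # xs) (K (hd xs))) (y # ys) = indicator {ys} xs * pmf (K (hd ys)) y" for xs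
  proof (cases "xs = ys")
    case True
    have "inj (\<lambda>y. y # ys)" by (auto simp: inj_def)
    from pmf_map_inj'[OF this, of "K (hd ys)" y] show ?thesis using True by simp
  next
    case False
    then show ?thesis by (subst pmf_map_outside) auto
  qed
  then have "pmf (markov_path p K (Suc k)) (y # ys) = (\<integral>xs. indicator {ys} xs * pmf (K (hd ys)) y \<partial>markov_path p K k)"
    by (simp add: pmf_bind)
  also have "\<dots> = pmf (markov_path p K k) ys * pmf (K (hd ys)) y"
    by (simp add: measure_pmf_single)
  finally show ?thesis .
qed

primrec observed_path :: "(int \<Rightarrow> 'a \<Rightarrow> nat) \<Rightarrow> nat \<Rightarrow> 'a \<Rightarrow> nat list" where
  "observed_path X 0 \<omega> = [X 0 \<omega>]"
| "observed_path X (Suc k) \<omega> = X (int (Suc k)) \<omega> # observed_path X k \<omega>"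

lemma observed_path_nonempty [simp]: "observed_path X k \<omega> \<noteq> []"
  by (cases k) auto

lemma hd_observed_path [simp]: "hd (observed_path X k \<omega>) = X (int k) \<omega>"
  by (cases k) auto

locale stationary_GWI_process =
  fixes M :: "'a measure" and pA pB :: "nat pmf"
    and A :: "nat \<Rightarrow> int \<Rightarrow> 'a \<Rightarrow> nat" and B X :: "int \<Rightarrow> 'a \<Rightarrow> nat"
  assumes GWI: "stationary_GWI M pA pB A B X"

sublocale stationary_GWI_process \<subseteq> prob_space M
  using GWI by (simp add: stationary_GWI_def)

context stationary_GWI_process
begin

text \<open>The events determined by the innovations with index in \<open>J\<close>; disjoint blocks are independent.\<close>

definition block_sigma :: "((nat \<times> int) + int) set \<Rightarrow> 'a set set" where
  "block_sigma J = sigma_sets (space M) {innovation A B k -` S \<inter> space M | k S. k \<in> J}"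

lemma innovation_sigma_eq: "innovation_sigma M A B i = block_sigma (({1..} \<times> {i..}) <+> {i..})"
  by (simp add: innovation_sigma_def block_sigma_def)

lemma sets_block: "sets (sigma (space M) {innovation A B k -` S \<inter> space M | k S. k \<in> J}) = block_sigma J"
  unfolding block_sigma_def by (rule sets_measure_of) auto

lemma block_sigma_mono: "J \<subseteq> J' \<Longrightarrow> block_sigma J \<subseteq> block_sigma J'"
  unfolding block_sigma_def by (rule sigma_sets_subseteq) auto

lemma block_sigma_Int: "E \<in> block_sigma J \<Longrightarrow> F \<in> block_sigma J \<Longrightarrow> E \<inter> F \<in> block_sigma J"
  unfolding sets_block[symmetric] by (rule sets.Int)

lemma block_sigma_space: "space M \<in> block_sigma J"
  unfolding block_sigma_def by (rule sigma_sets_top)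

lemma block_measurable_event:
  assumes "\<And>k. k \<in> K \<Longrightarrow> k \<in> J" and "finite K"
  shows "{\<omega> \<in> space M. (\<Sum>k\<in>K. innovation A B k \<omega>) = y} \<in> block_sigma J"
proof -
  let ?N = "sigma (space M) {innovation A B k -` S \<inter> space M | k S. k \<in> J}"
  have sp: "space ?N = space M" by (rule space_measure_of) auto
  have "innovation A B k \<in> measurable ?N borel" if "k \<in> K" for k
  proof (rule measurableI)
    fix S
    have "innovation A B k -` S \<inter> space M \<in> block_sigma J"
      unfolding block_sigma_def using assms(1)[OF that] by (intro sigma_sets.Basic) auto
    then show "innovation A B k -` S \<inter> space ?N \<in> sets ?N" unfolding sets_block sp .
  qed simp
  then have "(\<lambda>\<omega>. \<Sum>k\<in>K. innovation A B k \<omega>) \<in> borel_measurable ?N"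
    by (rule borel_measurable_sum)
  from measurable_sets[OF this, of "{y}"]
  have "(\<lambda>\<omega>. \<Sum>k\<in>K. innovation A B k \<omega>) -` {y} \<inter> space M \<in> block_sigma J"
    unfolding sets_block sp by auto
  also have "(\<lambda>\<omega>. \<Sum>k\<in>K. innovation A B k \<omega>) -` {y} \<inter> space M = {\<omega> \<in> space M. (\<Sum>k\<in>K. innovation A B k \<omega>) = y}"
    by auto
  finally show ?thesis .
qed

lemma indep_innovation: "indep_vars (\<lambda>_. count_space UNIV) (innovation A B) (({1..} \<times> UNIV) <+> UNIV)"
  using GWI by (simp add: stationary_GWI_def)

lemma block_independent:
  assumes J: "J1 \<subseteq> ({1..} \<times> UNIV) <+> UNIV" "J2 \<subseteq> ({1..} \<times> UNIV) <+> UNIV" "J1 \<inter> J2 = {}"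
    and E: "E1 \<in> block_sigma J1" "E2 \<in> block_sigma J2"
  shows "prob (E1 \<inter> E2) = prob E1 * prob E2"
proof -
  define F where "F k = sigma_sets (space M) {innovation A B k -` S \<inter> space M | S. S \<in> sets (count_space UNIV)}" for k
  define J where "J = case_bool J1 J2"
  have ind: "indep_sets F (({1..} \<times> UNIV) <+> UNIV)"
    using indep_innovation unfolding indep_vars_def F_def by simp
  have "indep_sets F (\<Union>j\<in>UNIV. J j)"
    by (rule indep_sets_mono_index[OF _ ind]) (use J in \<open>auto simp: J_def split: bool.splits\<close>)
  then have "indep_sets (\<lambda>j. sigma_sets (space M) (\<Union>i\<in>J j. F i)) UNIV"
  proof (rule indep_sets_collect_sigma)
    show "Int_stable (F k)" for k
      unfolding F_def by (rule algebra.Int_stable[OF sigma_algebra.axioms(1)[OF sigma_algebra_sigma_sets]]) auto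
    show "disjoint_family_on J UNIV"
      using J(3) by (auto simp: disjoint_family_on_def J_def split: bool.splits)
  qed
  from indep_setsD[OF this, of "UNIV" "case_bool E1 E2"]
  have "prob (\<Inter>j\<in>UNIV. case_bool E1 E2 j) = (\<Prod>j\<in>UNIV. prob (case_bool E1 E2 j))"
  proof
    have sub: "block_sigma K \<subseteq> sigma_sets (space M) (\<Union>i\<in>K. F i)" for K
      unfolding block_sigma_def F_def by (rule sigma_sets_subseteq) (auto intro!: sigma_sets.Basic)
    show "\<forall>j\<in>UNIV. case_bool E1 E2 j \<in> sigma_sets (space M) (\<Union>i\<in>J j. F i)"
      using subsetD[OF sub E(1)] subsetD[OF sub E(2)] by (auto simp: J_def split: bool.split)
  qed auto
  then show ?thesis by (simp add: UNIV_bool Int_commute mult.commute)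
qed

lemma measurable_X [measurable]: "X i \<in> measurable M (count_space UNIV)"
  using GWI by (simp add: stationary_GWI_def strongly_stationary_def)

lemma measurable_innovation: "k \<in> ({1..} \<times> UNIV) <+> UNIV \<Longrightarrow> innovation A B k \<in> measurable M (count_space UNIV)"
  using indep_innovation by (simp add: indep_vars_def2)

lemma measurable_offspring_sum: "(\<lambda>\<omega>. \<Sum>j=1..x. A j i \<omega>) \<in> measurable M (count_space UNIV)"
proof -
  have "A j i \<in> measurable M (count_space UNIV)" if "j \<in> {1..x}" for j
    using measurable_innovation[of "Inl (j, i)"] that by (auto simp: innovation_def)
  then have "A j i \<in> borel_measurable M" if "j \<in> {1..x}" for j
    using that by (simp add: measurable_cong_sets[OF refl sets_borel_eq_count_space])
  then have "(\<lambda>\<omega>. \<Sum>j=1..x. A j i \<omega>) \<in> borel_measurable M"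
    by (rule borel_measurable_sum)
  then show ?thesis by (simp add: measurable_cong_sets[OF refl sets_borel_eq_count_space])
qed

lemma measurable_A: "1 \<le> j \<Longrightarrow> A j i \<in> measurable M (count_space UNIV)"
  using measurable_innovation[of "Inl (j, i)"] by (auto simp: innovation_def)

lemma measurable_B: "B i \<in> measurable M (count_space UNIV)"
  using measurable_innovation[of "Inr i"] by (auto simp: innovation_def)

lemma prob_law:
  assumes "Y \<in> measurable M (count_space UNIV)" "distr M (count_space UNIV) Y = measure_pmf p"
  shows "prob {\<omega> \<in> space M. Y \<omega> = y} = pmf p y"
proof -
  have "prob {\<omega> \<in> space M. Y \<omega> = y} = measure (distr M (count_space UNIV) Y) {y}"
    using assms(1) by (subst measure_distr) (auto intro!: arg_cong[where f=prob])
  then show ?thesis by (simp add: assms(2) measure_pmf_single)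
qed

lemma prob_A: "1 \<le> j \<Longrightarrow> prob {\<omega> \<in> space M. A j i \<omega> = y} = pmf pA y"
  using GWI by (intro prob_law measurable_A) (auto simp: stationary_GWI_def)

lemma prob_B: "prob {\<omega> \<in> space M. B i \<omega> = y} = pmf pB y"
  using GWI by (intro prob_law measurable_B) (auto simp: stationary_GWI_def)

lemma sum_innovation_column:
  "(\<Sum>k\<in>Inl ` ({1..x} \<times> {i}). innovation A B k \<omega>) = (\<Sum>j=1..x. A j i \<omega>)"
proof -
  have "Inl ` ({1..x} \<times> {i}) = (\<lambda>j. Inl (j, i)) ` {1..x}" by auto
  show ?thesis
    unfolding \<open>Inl ` ({1..x} \<times> {i}) = (\<lambda>j. Inl (j, i)) ` {1..x}\<close>
    by (subst sum.reindex) (auto simp: inj_on_def innovation_def)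
qed

lemma offspring_sum_event:
  "{\<omega> \<in> space M. (\<Sum>j=1..x. A j i \<omega>) = y} \<in> block_sigma (Inl ` ({1..x} \<times> {i}))"
proof -
  have "(\<Sum>k\<in>Inl ` ({1..x} \<times> {i}). innovation A B k \<omega>) = (\<Sum>j=1..x. A j i \<omega>)" for \<omega>
    by (rule sum_innovation_column)
  with block_measurable_event[of "Inl ` ({1..x} \<times> {i})" "Inl ` ({1..x} \<times> {i})" y] show ?thesis by simp
qed

lemma A_event: "{\<omega> \<in> space M. A j i \<omega> = y} \<in> block_sigma {Inl (j, i)}"
  using block_measurable_event[of "{Inl (j, i)}" "{Inl (j, i)}" y] by (simp add: innovation_def)

lemma B_event: "{\<omega> \<in> space M. B i \<omega> = y} \<in> block_sigma {Inr i}"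
  using block_measurable_event[of "{Inr i}" "{Inr i}" y] by (simp add: innovation_def)

lemma prob_offspring_sum: "prob {\<omega> \<in> space M. (\<Sum>j=1..x. A j i \<omega>) = y} = pmf (offspring_sum pA x) y"
proof (induction x arbitrary: y)
  case 0
  show ?case by (simp add: prob_space indicator_def)
next
  case (Suc x)
  have "prob {\<omega> \<in> space M. (\<Sum>j=1..x. A j i \<omega>) + A (Suc x) i \<omega> = y} = pmf (map_pmf (\<lambda>(u, v). u + v) (pair_pmf (offspring_sum pA x) pA)) y"
  proof (rule prob_sum_independent[OF prob_space_axioms measurable_offspring_sum measurable_A])
    fix u v
    have pa: "prob {\<omega> \<in> space M. A (Suc x) i \<omega> = v} = pmf pA v" by (rule prob_A) simp
    have "prob ({\<omega> \<in> space M. (\<Sum>j=1..x. A j i \<omega>) = u} \<inter> {\<omega> \<in> space M. A (Suc x) i \<omega> = v}) =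
      prob {\<omega> \<in> space M. (\<Sum>j=1..x. A j i \<omega>) = u} * prob {\<omega> \<in> space M. A (Suc x) i \<omega> = v}"
      by (rule block_independent[OF _ _ _ offspring_sum_event A_event]) auto
    then show "prob ({\<omega> \<in> space M. (\<Sum>j=1..x. A j i \<omega>) = u} \<inter> {\<omega> \<in> space M. A (Suc x) i \<omega> = v}) = pmf (offspring_sum pA x) u * pmf pA v"
      by (simp only: Suc.IH pa)
  qed simp
  then show ?case by simp
qed

lemma prob_step: "prob {\<omega> \<in> space M. (\<Sum>j=1..x. A j i \<omega>) + B i \<omega> = y} = pmf (gwi_step pA pB x) y"
  unfolding gwi_step_def
proof (rule prob_sum_independent[OF prob_space_axioms measurable_offspring_sum measurable_B])
  fix u v
  have "prob ({\<omega> \<in> space M. (\<Sum>j=1..x. A j i \<omega>) = u} \<inter> {\<omega> \<in> space M. B i \<omega> = v}) =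
    prob {\<omega> \<in> space M. (\<Sum>j=1..x. A j i \<omega>) = u} * prob {\<omega> \<in> space M. B i \<omega> = v}"
    by (rule block_independent[OF _ _ _ offspring_sum_event B_event]) auto
  then show "prob ({\<omega> \<in> space M. (\<Sum>j=1..x. A j i \<omega>) = u} \<inter> {\<omega> \<in> space M. B i \<omega> = v}) = pmf (offspring_sum pA x) u * pmf pB v"
    by (simp only: prob_offspring_sum prob_B)
qed

lemma step_event:
  "{\<omega> \<in> space M. (\<Sum>j=1..x. A j i \<omega>) + B i \<omega> = y} \<in> block_sigma (({1..} \<times> {i}) <+> {i})"
proof -
  let ?K = "Inl ` ({1..x} \<times> {i}) \<union> {Inr i} :: ((nat \<times> int) + int) set"
  have "(\<Sum>k\<in>?K. innovation A B k \<omega>) = (\<Sum>j=1..x. A j i \<omega>) + B i \<omega>" for \<omega>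
  proof -
    have "(\<Sum>k\<in>?K. innovation A B k \<omega>) = (\<Sum>k\<in>Inl ` ({1..x} \<times> {i}). innovation A B k \<omega>) + innovation A B (Inr i) \<omega>"
      by (subst sum.union_disjoint) auto
    also have "(\<Sum>k\<in>Inl ` ({1..x} \<times> {i}). innovation A B k \<omega>) = (\<Sum>j=1..x. A j i \<omega>)"
      by (rule sum_innovation_column)
    finally show ?thesis by (simp add: innovation_def)
  qed
  with block_measurable_event[of ?K "({1..} \<times> {i}) <+> {i}" y] show ?thesis by fastforce
qed

lemma measurable_observed_path: "observed_path X k \<in> measurable M (count_space UNIV)"
proof (induction k)
  case 0
  show ?case
    using measurable_compose[OF measurable_X[of 0], of "\<lambda>x. [x]" "count_space UNIV"] by simp
next
  case (Suc k)
  have "(\<lambda>\<omega>. (X (int (Suc k)) \<omega>, observed_path X k \<omega>)) \<in> measurable M (count_space UNIV \<Otimes>\<^sub>M count_space UNIV)"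
    by (intro measurable_Pair measurable_X Suc)
  then have "(\<lambda>\<omega>. (X (int (Suc k)) \<omega>, observed_path X k \<omega>)) \<in> measurable M (count_space UNIV)"
    by (subst (asm) pair_measure_countable) auto
  from measurable_compose[OF this, of "\<lambda>(x, xs). x # xs" "count_space UNIV"] show ?case by simp
qed

lemma events_block: "E \<in> block_sigma J \<Longrightarrow> J \<subseteq> ({1..} \<times> UNIV) <+> UNIV \<Longrightarrow> E \<in> events"
proof -
  assume E: "E \<in> block_sigma J" and J: "J \<subseteq> ({1..} \<times> UNIV) <+> UNIV"
  have "{innovation A B k -` S \<inter> space M | k S. k \<in> J} \<subseteq> events"
    using measurable_innovation J by (auto intro!: measurable_sets)
  from sets.sigma_sets_subset[OF this] E show "E \<in> events" unfolding block_sigma_def by auto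
qed

text \<open>The path law and the independence of future innovations are proved together. In the induction
  step, the event that the new state is \<open>y\<close> is, up to a null set and given the old path, an event of
  the innovations at time \<open>k + 1\<close>; it is merged with the later event \<open>E\<close> before the hypothesis is
  applied. The base case is the independence of \<open>X 0\<close> from the innovations at positive times.\<close>

lemma observed_path_future_independent:
  assumes pX: "distr M (count_space UNIV) (X 0) = measure_pmf pX"
    and E: "E \<in> innovation_sigma M A B (int k + 1)"
  shows "prob ({\<omega> \<in> space M. observed_path X k \<omega> = xs} \<inter> E) = pmf (markov_path pX (gwi_step pA pB) k) xs * prob E"
  using E
proof (induction k arbitrary: xs E)
  case 0
  show ?case
  proof (cases "\<exists>x. xs = [x]")
    case True
    then obtain x where x: "xs = [x]" by blast
    have "indep_set {X (1 - 1) -` S \<inter> space M | S. True} (innovation_sigma M A B 1)"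
      using GWI unfolding stationary_GWI_def by blast
    from indep_setD[OF this, of "X 0 -` {x} \<inter> space M" E] 0
    have "prob (X 0 -` {x} \<inter> space M \<inter> E) = prob (X 0 -` {x} \<inter> space M) * prob E" by auto
    moreover have "X 0 -` {x} \<inter> space M = {\<omega> \<in> space M. X 0 \<omega> = x}" by auto
    moreover have "pmf (map_pmf (\<lambda>x. [x]) pX) [x] = pmf pX x"
      by (rule pmf_map_inj') (auto simp: inj_def)
    ultimately show ?thesis
      using prob_law[OF measurable_X pX, of x] by (simp add: x)
  next
    case False
    then have "{\<omega> \<in> space M. observed_path X 0 \<omega> = xs} = {}" by auto
    moreover have "pmf (map_pmf (\<lambda>x. [x]) pX) xs = 0"
      using False by (intro pmf_map_outside) auto
    ultimately show ?thesis by (simp only: markov_path.simps Int_empty_left measure_empty mult_zero_left)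
  qed
next
  case (Suc k)
  show ?case
  proof (cases "\<exists>y ys. xs = y # ys \<and> ys \<noteq> []")
    case True
    then obtain y ys where xs: "xs = y # ys" "ys \<noteq> []" by blast
    let ?i = "int k + 1"
    let ?S = "{\<omega> \<in> space M. (\<Sum>j=1..hd ys. A j ?i \<omega>) + B ?i \<omega> = y}"
    have rec: "AE \<omega> in M. X ?i \<omega> = (\<Sum>j=1..X (?i - 1) \<omega>. A j ?i \<omega>) + B ?i \<omega>"
      using GWI unfolding stationary_GWI_def by blast
    have E2: "E \<in> block_sigma (({1..} \<times> {?i + 1..}) <+> {?i + 1..})"
      using Suc.prems unfolding innovation_sigma_eq by (simp add: ac_simps)
    have SE: "?S \<inter> E \<in> innovation_sigma M A B ?i"
      unfolding innovation_sigma_eq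
      by (intro block_sigma_Int subsetD[OF block_sigma_mono step_event] subsetD[OF block_sigma_mono E2]) auto
    have Eev: "E \<in> events" by (rule events_block[OF E2]) auto
    have Sev: "?S \<in> events" by (rule events_block[OF step_event]) auto
    have Oev: "{\<omega> \<in> space M. observed_path X n \<omega> = zs} \<in> events" for n zs
      using measurable_sets[OF measurable_observed_path, of "{zs}" n] by (simp add: vimage_def Int_def conj_commute)
    have "prob ({\<omega> \<in> space M. observed_path X (Suc k) \<omega> = xs} \<inter> E) = prob ({\<omega> \<in> space M. observed_path X k \<omega> = ys} \<inter> (?S \<inter> E))"
    proof (rule finite_measure_eq_AE)
      show "AE \<omega> in M. \<omega> \<in> {\<omega> \<in> space M. observed_path X (Suc k) \<omega> = xs} \<inter> E \<longleftrightarrow> \<omega> \<in> {\<omega> \<in> space M. observed_path X k \<omega> = ys} \<inter> (?S \<inter> E)"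
        using rec
      proof eventually_elim
        case (elim \<omega>)
        have "hd ys = X (int k) \<omega>" if "observed_path X k \<omega> = ys"
          using that hd_observed_path[of X k \<omega>] by simp
        with elim show ?case by (auto simp: xs add.commute)
      qed
      show "{\<omega> \<in> space M. observed_path X (Suc k) \<omega> = xs} \<inter> E \<in> events" by (rule sets.Int[OF Oev Eev])
      show "{\<omega> \<in> space M. observed_path X k \<omega> = ys} \<inter> (?S \<inter> E) \<in> events" by (intro sets.Int Oev Sev Eev)
    qed
    also have "\<dots> = pmf (markov_path pX (gwi_step pA pB) k) ys * prob (?S \<inter> E)"
      by (rule Suc.IH[OF SE])
    also have "prob (?S \<inter> E) = prob ?S * prob E"
      by (rule block_independent[OF _ _ _ step_event E2]) auto
    also have "prob ?S = pmf (gwi_step pA pB (hd ys)) y" by (rule prob_step)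
    finally show ?thesis by (simp add: xs pmf_markov_path_Suc del: markov_path.simps)
  next
    case False
    then have "{\<omega> \<in> space M. observed_path X (Suc k) \<omega> = xs} = {}" by auto
    moreover have "xs \<notin> set_pmf (markov_path pX (gwi_step pA pB) (Suc k))"
      using False markov_path_nonempty by fastforce
    then have "pmf (markov_path pX (gwi_step pA pB) (Suc k)) xs = 0" by (simp only: pmf_eq_0_set_pmf not_False_eq_True)
    ultimately show ?thesis by (simp only: Int_empty_left measure_empty mult_zero_left)
  qed
qed

theorem observed_path_law:
  assumes pX: "distr M (count_space UNIV) (X 0) = measure_pmf pX"
  shows "distr M (count_space UNIV) (observed_path X k) = measure_pmf (markov_path pX (gwi_step pA pB) k)"
proof (rule law_eq_pmfI[OF prob_space_axioms measurable_observed_path])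
  fix xs
  have "space M \<in> innovation_sigma M A B (int k + 1)"
    unfolding innovation_sigma_eq by (rule block_sigma_space)
  from observed_path_future_independent[OF pX this, of xs]
  have "prob ({\<omega> \<in> space M. observed_path X k \<omega> = xs} \<inter> space M) = pmf (markov_path pX (gwi_step pA pB) k) xs"
    by (simp add: prob_space)
  also have "{\<omega> \<in> space M. observed_path X k \<omega> = xs} \<inter> space M = {\<omega> \<in> space M. observed_path X k \<omega> = xs}" by auto
  finally show "prob {\<omega> \<in> space M. observed_path X k \<omega> = xs} = pmf (markov_path pX (gwi_step pA pB) k) xs" .
qed

lemma X_law_shift: "distr M (count_space UNIV) (X h) = distr M (count_space UNIV) (X 0)"
proof -
  let ?P = "(\<Pi>\<^sub>M i\<in>UNIV. count_space UNIV) :: (int \<Rightarrow> nat) measure"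
  have "distr M ?P (\<lambda>\<omega> i. X (i + h) \<omega>) = distr M ?P (\<lambda>\<omega> i. X i \<omega>)"
    using GWI unfolding stationary_GWI_def strongly_stationary_def by blast
  then have "distr (distr M ?P (\<lambda>\<omega> i. X (i + h) \<omega>)) (count_space UNIV) (\<lambda>f. f 0) = distr (distr M ?P (\<lambda>\<omega> i. X i \<omega>)) (count_space UNIV) (\<lambda>f. f 0)"
    by simp
  moreover have "(\<lambda>\<omega> i. X (i + g) \<omega>) \<in> measurable M ?P" for g
    by (intro measurable_PiM_single') auto
  note this this[of 0]
  moreover have "(\<lambda>f. f 0) \<in> measurable ?P (count_space UNIV)"
    by (rule measurable_component_singleton) simp
  ultimately show ?thesis by (simp add: distr_distr comp_def)
qed

text \<open>Strong stationarity gives \<open>X 1\<close> the law of \<open>X 0\<close>, and the path law identifies the law of \<open>X 1\<close> as one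
  step of the chain.\<close>

theorem stationary_law:
  assumes pX: "distr M (count_space UNIV) (X 0) = measure_pmf pX"
  shows "bind_pmf pX (gwi_step pA pB) = pX"
proof -
  have "measure_pmf (map_pmf hd (markov_path pX (gwi_step pA pB) (Suc 0))) = distr (distr M (count_space UNIV) (observed_path X (Suc 0))) (count_space UNIV) hd"
    unfolding observed_path_law[OF pX] by (rule map_pmf_rep_eq)
  also have "\<dots> = distr M (count_space UNIV) (hd \<circ> observed_path X (Suc 0))"
    by (rule distr_distr[OF _ measurable_observed_path]) simp
  also have "hd \<circ> observed_path X (Suc 0) = X 1" by (auto simp: comp_def)
  also have "distr M (count_space UNIV) (X 1) = measure_pmf pX" using X_law_shift[of 1] pX by simp
  finally have "map_pmf hd (markov_path pX (gwi_step pA pB) (Suc 0)) = pX" by (simp add: measure_pmf_inject)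
  then show ?thesis by (simp add: map_bind_pmf map_pmf_comp bind_map_pmf)
qed

end

section \<open>Poisson points in slices of the Levy measure\<close>

text \<open>The integrand depends on finitely many coordinates of the infinite product, which project to a
  finite product measure.\<close>

lemma integral_PiM_prod:
  fixes H :: "nat \<Rightarrow> 'a \<Rightarrow> complex"
  assumes R: "\<And>k. prob_space (R k)" and H: "\<And>k. H k \<in> borel_measurable (R k)"
    and b: "\<And>k x. norm (H k x) \<le> 1"
  shows "(LINT \<omega>|PiM UNIV R. (\<Prod>k<n. H k (\<omega> k))) = (\<Prod>k<n. LINT x|R k. H k x)"
proof -
  interpret product_prob_space R UNIV
    by (rule product_prob_spaceI) (rule R)
  have i: "integrable (R k) (H k)" for k
    by (rule finite_measure.integrable_const_bound[OF prob_space.finite_measure[OF R], where B=1]) (use b H in auto)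
  note [measurable] = H
  have "(LINT \<omega>|PiM UNIV R. (\<Prod>k<n. H k (\<omega> k))) = (LINT \<omega>|PiM UNIV R. (\<Prod>k<n. H k (restrict \<omega> {..<n} k)))"
    by (intro Bochner_Integration.integral_cong prod.cong) auto
  also have "\<dots> = (LINT x|distr (PiM UNIV R) (PiM {..<n} R) (\<lambda>\<omega>. restrict \<omega> {..<n}). (\<Prod>k<n. H k (x k)))"
    by (subst integral_distr) (auto intro!: measurable_restrict_subset borel_measurable_prod)
  also have "\<dots> = (LINT x|PiM {..<n} R. (\<Prod>k<n. H k (x k)))"
    by (subst distr_PiM_restrict_finite) auto
  also have "\<dots> = (\<Prod>k<n. LINT x|R k. H k x)"
    by (rule product_integral_prod) (auto intro: i)
  finally show ?thesis .
qed

lemma poisson_generating_function: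
  fixes c :: complex
  assumes c: "norm c \<le> 1"
  shows "(LINT n|poisson_pmf 1. c ^ n) = exp (c - 1)"
proof -
  have i: "integrable (poisson_pmf 1) (\<lambda>n. c ^ n)"
    by (rule measure_pmf.integrable_const_bound[where B=1]) (use c in \<open>auto simp: norm_power power_le_one\<close>)
  have "(LINT n|poisson_pmf 1. c ^ n) = (LINT n|count_space UNIV. pmf (poisson_pmf 1) n *\<^sub>R c ^ n)"
    unfolding measure_pmf_eq_density by (subst integral_density) auto
  moreover have "integrable (count_space UNIV) (\<lambda>n. pmf (poisson_pmf 1) n *\<^sub>R c ^ n)"
    using i unfolding measure_pmf_eq_density by (subst (asm) integrable_density) auto
  ultimately have "(\<lambda>n. pmf (poisson_pmf 1) n *\<^sub>R c ^ n) sums (LINT n|poisson_pmf 1. c ^ n)"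
    using sums_integral_count_space_nat by metis
  moreover have "(\<lambda>n. pmf (poisson_pmf 1) n *\<^sub>R c ^ n) sums (exp c * exp (-1))"
    using sums_mult2[OF exp_converges[of c], of "exp (-1)"]
    by (simp add: scaleR_conv_of_real exp_of_real[symmetric] divide_inverse mult_ac of_real_inverse del: exp_of_real)
  moreover have "exp c * exp (-1) = exp (c - 1)" by (simp add: exp_add[symmetric])
  ultimately show ?thesis by (metis sums_unique2)
qed

lemma poisson_mean: "(\<integral>\<^sup>+n. of_nat n \<partial>poisson_pmf 1) = 1"
proof -
  have s: "(\<lambda>n. pmf (poisson_pmf 1) n * real n) sums 1"
  proof -
    have "(\<lambda>n. inverse (fact n) * exp (-1) :: real) sums (exp 1 * exp (-1))"
      using sums_mult2[OF exp_converges[of "1::real"], of "exp (-1)"] by simp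
    moreover have "pmf (poisson_pmf 1) (Suc n) * real (Suc n) = inverse (fact n) * exp (-1)" for n
    proof -
      have "u / (v * w) * e * v = inverse w * e" if "v \<noteq> 0" "u = 1" for u v w e :: real
        using that by (simp add: divide_inverse)
      from this[of "real (Suc n)" "1 ^ Suc n" "fact n" "exp (-1)"] show ?thesis
        by (simp del: of_nat_Suc)
    qed
    ultimately have "(\<lambda>n. pmf (poisson_pmf 1) (Suc n) * real (Suc n)) sums 1"
      by (simp only:) (simp add: exp_add[symmetric])
    then show ?thesis by (subst (asm) sums_Suc_iff) simp
  qed
  have "(\<integral>\<^sup>+n. of_nat n \<partial>poisson_pmf 1) = (\<Sum>n. ennreal (pmf (poisson_pmf 1) n) * of_nat n)"
    by (simp only: nn_integral_measure_pmf nn_integral_count_space_nat)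
  also have "\<dots> = (\<Sum>n. ennreal (pmf (poisson_pmf 1) n * real n))"
  proof -
    have "ennreal p * of_nat n = ennreal (p * real n)" if "0 \<le> p" for p :: real and n
      using ennreal_mult'[OF that, of "real n"] by (simp only: ennreal_of_nat_eq_real_of_nat)
    then show ?thesis by (simp only: pmf_nonneg)
  qed
  also have "\<dots> = ennreal 1" by (rule suminf_ennreal_eq[OF _ s]) simp
  finally show ?thesis by simp
qed

text \<open>A Poisson number of independent points with law \<open>R\<close>: the first component counts them, and only that
  many entries of the sequence are used. This is a Poisson point process with intensity \<open>R\<close>.\<close>

definition poisson_points :: "real measure \<Rightarrow> (nat \<times> (nat \<Rightarrow> real)) measure" where
  "poisson_points R = measure_pmf (poisson_pmf 1) \<Otimes>\<^sub>M PiM UNIV (\<lambda>_. R)"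

lemma prob_space_pair_measure: "prob_space P \<Longrightarrow> prob_space Q \<Longrightarrow> prob_space (P \<Otimes>\<^sub>M Q)"
proof -
  assume "prob_space P" "prob_space Q"
  then interpret pair_prob_space P Q by (simp add: pair_prob_space_def pair_sigma_finite_def prob_space_imp_sigma_finite)
  show ?thesis by unfold_locales
qed

lemma prob_space_poisson_points: "prob_space R \<Longrightarrow> prob_space (poisson_points R)"
  unfolding poisson_points_def
  by (intro prob_space_pair_measure prob_space_measure_pmf prob_space_PiM)

lemma sets_poisson_points:
  "sets R = sets borel \<Longrightarrow> sets (poisson_points R) = sets (count_space UNIV \<Otimes>\<^sub>M PiM UNIV (\<lambda>_. borel))"
  unfolding poisson_points_def by (intro sets_pair_measure_cong sets_PiM_cong) auto

lemma measurable_point_prod: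
  fixes f :: "real \<Rightarrow> complex"
  assumes [measurable]: "f \<in> borel_measurable borel"
  shows "(\<lambda>\<omega>. \<Prod>j<fst \<omega>. f (snd \<omega> j)) \<in> borel_measurable (count_space (UNIV :: nat set) \<Otimes>\<^sub>M PiM (UNIV :: nat set) (\<lambda>_. borel))"
proof -
  let ?N = "count_space (UNIV :: nat set) \<Otimes>\<^sub>M PiM (UNIV :: nat set) (\<lambda>_. borel :: real measure)"
  have 1: "(\<lambda>\<omega>. \<Prod>j<n. f (snd \<omega> j)) \<in> borel_measurable ?N" for n :: nat by measurable
  have 2: "fst \<in> measurable ?N (count_space UNIV)" by measurable
  show ?thesis using measurable_compose_countable[where f="\<lambda>n \<omega>. \<Prod>j<n. f (snd \<omega> j)", OF 1 2] .
qed

lemma measurable_point_sum: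
  fixes f :: "real \<Rightarrow> real"
  assumes [measurable]: "f \<in> borel_measurable borel"
  shows "(\<lambda>\<omega>. \<Sum>j<fst \<omega>. f (snd \<omega> j)) \<in> borel_measurable (count_space (UNIV :: nat set) \<Otimes>\<^sub>M PiM (UNIV :: nat set) (\<lambda>_. borel))"
proof -
  let ?N = "count_space (UNIV :: nat set) \<Otimes>\<^sub>M PiM (UNIV :: nat set) (\<lambda>_. borel :: real measure)"
  have 1: "(\<lambda>\<omega>. \<Sum>j<n. f (snd \<omega> j)) \<in> borel_measurable ?N" for n :: nat by measurable
  have 2: "fst \<in> measurable ?N (count_space UNIV)" by measurable
  show ?thesis using measurable_compose_countable[where f="\<lambda>n \<omega>. \<Sum>j<n. f (snd \<omega> j)", OF 1 2] .
qed

text \<open>The probability generating functional, obtained by conditioning on the number of points.\<close>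

lemma poisson_points_product:
  fixes h :: "real \<Rightarrow> complex"
  assumes R: "prob_space R" "sets R = sets borel" and h: "h \<in> borel_measurable borel" "\<And>y. norm (h y) \<le> 1"
  shows "(LINT \<omega>|poisson_points R. (\<Prod>j<fst \<omega>. h (snd \<omega> j))) = exp ((LINT y|R. h y) - 1)"
proof -
  interpret R: prob_space R by fact
  interpret P: prob_space "PiM UNIV (\<lambda>_::nat. R)" by (rule prob_space_PiM) (rule R)
  interpret Q: pair_prob_space "measure_pmf (poisson_pmf 1)" "PiM UNIV (\<lambda>_::nat. R)" ..
  have hR: "h \<in> borel_measurable R" using h(1) R(2) by (simp cong: measurable_cong_sets)
  have m: "(\<lambda>\<omega>. \<Prod>j<fst \<omega>. h (snd \<omega> j)) \<in> borel_measurable (measure_pmf (poisson_pmf 1) \<Otimes>\<^sub>M PiM UNIV (\<lambda>_. R))"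
    using measurable_point_prod[OF h(1)]
    by (subst measurable_cong_sets[OF sets_poisson_points[OF R(2), unfolded poisson_points_def] refl])
  have i: "integrable (measure_pmf (poisson_pmf 1) \<Otimes>\<^sub>M PiM UNIV (\<lambda>_. R)) (\<lambda>\<omega>. \<Prod>j<fst \<omega>. h (snd \<omega> j))"
    by (rule Q.integrable_const_bound[where B=1]) (use m h in \<open>auto simp: prod_norm[symmetric] intro!: prod_le_1\<close>)
  have n: "norm (LINT y|R. h y) \<le> 1"
  proof -
    have "norm (LINT y|R. h y) \<le> (LINT y|R. norm (h y))" by (rule integral_norm_bound)
    also have "\<dots> \<le> (LINT y|R. 1)"
      using h hR by (intro integral_mono R.integrable_const_bound[where B=1]) auto
    finally show ?thesis by (simp add: R.prob_space)
  qed
  have "(LINT \<omega>|poisson_points R. (\<Prod>j<fst \<omega>. h (snd \<omega> j))) = (LINT n|poisson_pmf 1. LINT y|PiM UNIV (\<lambda>_. R). (\<Prod>j<n. h (y j)))"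
    using Q.integral_fst'[OF i] by (simp add: poisson_points_def)
  also have "\<dots> = (LINT n|poisson_pmf 1. (LINT y|R. h y) ^ n)"
    using integral_PiM_prod[of "\<lambda>_. R" "\<lambda>_. h"] R(1) hR h(2) by simp
  also have "\<dots> = exp ((LINT y|R. h y) - 1)" by (rule poisson_generating_function[OF n])
  finally show ?thesis .
qed

text \<open>Campbell's formula for an intensity of total mass 1.\<close>

lemma poisson_points_mean:
  assumes R: "prob_space R" "sets R = sets borel" and f: "f \<in> borel_measurable borel" "\<And>y. 0 \<le> f y"
  shows "(\<integral>\<^sup>+\<omega>. ennreal (\<Sum>j<fst \<omega>. f (snd \<omega> j)) \<partial>poisson_points R) = (\<integral>\<^sup>+y. ennreal (f y) \<partial>R)"
proof -
  interpret R: prob_space R by fact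
  interpret P: prob_space "PiM UNIV (\<lambda>_::nat. R)" by (rule prob_space_PiM) (rule R)
  interpret PP: product_prob_space "\<lambda>_::nat. R" UNIV by (rule product_prob_spaceI) (rule R)
  have fR[measurable]: "f \<in> borel_measurable R" using f(1) R(2) by (simp cong: measurable_cong_sets)
  have m: "(\<lambda>\<omega>. ennreal (\<Sum>j<fst \<omega>. f (snd \<omega> j))) \<in> borel_measurable (measure_pmf (poisson_pmf 1) \<Otimes>\<^sub>M PiM UNIV (\<lambda>_. R))"
    using measurable_compose[OF measurable_point_sum[OF f(1)] measurable_ennreal]
    by (subst measurable_cong_sets[OF sets_poisson_points[OF R(2), unfolded poisson_points_def] refl])
  have c: "(\<integral>\<^sup>+y. ennreal (f (y j)) \<partial>PiM UNIV (\<lambda>_::nat. R)) = (\<integral>\<^sup>+y. ennreal (f y) \<partial>R)" for j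
  proof -
    have "(\<integral>\<^sup>+y. ennreal (f y) \<partial>R) = (\<integral>\<^sup>+y. ennreal (f y) \<partial>distr (PiM UNIV (\<lambda>_::nat. R)) R (\<lambda>\<omega>. \<omega> j))"
      by (subst distr_PiM_component) (auto intro: R)
    also have "\<dots> = (\<integral>\<^sup>+y. ennreal (f (y j)) \<partial>PiM UNIV (\<lambda>_::nat. R))"
      by (subst nn_integral_distr) auto
    finally show ?thesis by simp
  qed
  have "(\<integral>\<^sup>+\<omega>. ennreal (\<Sum>j<fst \<omega>. f (snd \<omega> j)) \<partial>poisson_points R) =
    (\<integral>\<^sup>+n. \<integral>\<^sup>+y. ennreal (\<Sum>j<n. f (y j)) \<partial>PiM UNIV (\<lambda>_. R) \<partial>poisson_pmf 1)"
    unfolding poisson_points_def by (subst P.nn_integral_fst[OF m, symmetric]) simp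
  also have "\<dots> = (\<integral>\<^sup>+n. of_nat n * (\<integral>\<^sup>+y. ennreal (f y) \<partial>R) \<partial>poisson_pmf 1)"
  proof (rule nn_integral_cong)
    fix n
    have "(\<integral>\<^sup>+y. ennreal (\<Sum>j<n. f (y j)) \<partial>PiM UNIV (\<lambda>_::nat. R)) = (\<integral>\<^sup>+y. (\<Sum>j<n. ennreal (f (y j))) \<partial>PiM UNIV (\<lambda>_::nat. R))"
      using f(2) by (simp add: sum_ennreal)
    also have "\<dots> = (\<Sum>j<n. \<integral>\<^sup>+y. ennreal (f (y j)) \<partial>PiM UNIV (\<lambda>_::nat. R))"
      by (rule nn_integral_sum) measurable
    finally show "(\<integral>\<^sup>+y. ennreal (\<Sum>j<n. f (y j)) \<partial>PiM UNIV (\<lambda>_::nat. R)) = of_nat n * (\<integral>\<^sup>+y. ennreal (f y) \<partial>R)"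
      by (simp add: c)
  qed
  also have "\<dots> = (\<integral>\<^sup>+y. ennreal (f y) \<partial>R)"
    by (simp add: nn_integral_multc poisson_mean)
  finally show ?thesis .
qed

text \<open>The level above which \<open>\<kappa>\<close> times the Levy measure has mass \<open>k\<close>. Consecutive levels bound slices of mass
  1, in each of which the points of the Poisson process with intensity \<open>\<kappa>\<close> times the Levy measure form
  a \<open>poisson_points\<close> of the normalised restriction.\<close>

definition slice_bound :: "real \<Rightarrow> real \<Rightarrow> nat \<Rightarrow> real" where
  "slice_bound \<kappa> \<alpha> k = (real k / \<kappa>) powr (- 1 / \<alpha>)"

text \<open>For \<open>k = 0\<close> the level would be infinite, whereas \<open>slice_bound\<close> takes the value 0 there.\<close>

definition above_slice :: "real \<Rightarrow> real \<Rightarrow> nat \<Rightarrow> real set" where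
  "above_slice \<kappa> \<alpha> k = (if k = 0 then {} else {slice_bound \<kappa> \<alpha> k<..})"

definition slice :: "real \<Rightarrow> real \<Rightarrow> nat \<Rightarrow> real set" where
  "slice \<kappa> \<alpha> k = above_slice \<kappa> \<alpha> (Suc k) - above_slice \<kappa> \<alpha> k"

context
  fixes \<kappa> \<alpha> :: real
  assumes \<kappa>: "0 < \<kappa>" and \<alpha>: "0 < \<alpha>" "\<alpha> < 2"
begin

lemma sets_above_slice [measurable]: "above_slice \<kappa> \<alpha> k \<in> sets borel"
  by (simp add: above_slice_def)

lemma sets_slice [measurable]: "slice \<kappa> \<alpha> k \<in> sets borel"
  unfolding slice_def by measurable

lemma slice_bound_pos: "0 < k \<Longrightarrow> 0 < slice_bound \<kappa> \<alpha> k"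
  using \<kappa> by (simp add: slice_bound_def)

lemma emeasure_above_slice: "emeasure (stable_levy \<alpha>) (above_slice \<kappa> \<alpha> k) = ennreal (real k / \<kappa>)"
proof (cases "k = 0")
  case False
  then have "slice_bound \<kappa> \<alpha> k powr (- \<alpha>) = real k / \<kappa>"
    using \<kappa> \<alpha> by (simp add: slice_bound_def powr_powr)
  then show ?thesis
    using False emeasure_stable_levy_tail[OF \<alpha>(1) slice_bound_pos[of k]] by (simp add: above_slice_def)
qed (simp add: above_slice_def)

lemma above_slice_mono: "k \<le> l \<Longrightarrow> above_slice \<kappa> \<alpha> k \<subseteq> above_slice \<kappa> \<alpha> l"
proof -
  assume kl: "k \<le> l"
  show ?thesis
  proof (cases "k = 0")
    case False
    then have "slice_bound \<kappa> \<alpha> l \<le> slice_bound \<kappa> \<alpha> k"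
      unfolding slice_bound_def using kl \<kappa> \<alpha> by (intro powr_mono2') (auto simp: divide_right_mono)
    then show ?thesis using False kl by (auto simp: above_slice_def)
  qed (simp add: above_slice_def)
qed

lemma emeasure_slice: "emeasure (stable_levy \<alpha>) (slice \<kappa> \<alpha> k) = ennreal (1 / \<kappa>)"
proof -
  have "emeasure (stable_levy \<alpha>) (slice \<kappa> \<alpha> k) = emeasure (stable_levy \<alpha>) (above_slice \<kappa> \<alpha> (Suc k)) - emeasure (stable_levy \<alpha>) (above_slice \<kappa> \<alpha> k)"
    unfolding slice_def by (rule emeasure_Diff) (auto simp: emeasure_above_slice above_slice_mono)
  also have "\<dots> = ennreal (real (Suc k) / \<kappa> - real k / \<kappa>)"
    unfolding emeasure_above_slice using \<kappa> by (intro ennreal_minus[symmetric, THEN sym]) auto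
  also have "real (Suc k) / \<kappa> - real k / \<kappa> = 1 / \<kappa>" by (simp add: add_divide_distrib)
  finally show ?thesis .
qed

definition slice_law :: "nat \<Rightarrow> real measure" where
  "slice_law k = uniform_measure (stable_levy \<alpha>) (slice \<kappa> \<alpha> k)"

lemma slice_nontrivial: "emeasure (stable_levy \<alpha>) (slice \<kappa> \<alpha> k) \<noteq> 0" "emeasure (stable_levy \<alpha>) (slice \<kappa> \<alpha> k) \<noteq> \<infinity>"
  using \<kappa> by (simp_all add: emeasure_slice)

lemma prob_space_slice_law: "prob_space (slice_law k)"
  unfolding slice_law_def by (rule prob_space_uniform_measure[OF slice_nontrivial])

lemma sets_slice_law: "sets (slice_law k) = sets borel"
  by (simp add: slice_law_def)

lemma sum_indicator_slice: "(\<Sum>k<n. indicat_real (slice \<kappa> \<alpha> k) y) = indicator (above_slice \<kappa> \<alpha> n) y"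
proof (induction n)
  case (Suc n)
  then show ?case
    using above_slice_mono[of n "Suc n"] by (auto simp: slice_def indicator_def)
qed (simp add: above_slice_def)

lemma integral_slice_law:
  fixes h :: "real \<Rightarrow> complex"
  assumes h: "h \<in> borel_measurable borel"
  shows "(LINT y|slice_law k. h y) = \<kappa> *\<^sub>R (LINT y|stable_levy \<alpha>. indicator (slice \<kappa> \<alpha> k) y *\<^sub>R h y)"
proof -
  have "measure (stable_levy \<alpha>) (slice \<kappa> \<alpha> k) = 1 / \<kappa>"
    using \<kappa> by (simp add: measure_def emeasure_slice)
  then show ?thesis
    unfolding slice_law_def by (subst integral_uniform_measure[OF slice_nontrivial]) (use h in auto)
qed

lemma sum_integral_slice_law:
  fixes h :: "real \<Rightarrow> complex"
  assumes h: "h \<in> borel_measurable borel" "\<And>y. norm (h y) \<le> 1"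
  shows "(\<Sum>k<n. (LINT y|slice_law k. h y) - 1) = \<kappa> *\<^sub>R (LINT y|stable_levy \<alpha>. indicator (above_slice \<kappa> \<alpha> n) y *\<^sub>R (h y - 1))"
proof -
  have i: "integrable (stable_levy \<alpha>) (\<lambda>y. indicat_real (slice \<kappa> \<alpha> k) y *\<^sub>R (h y - 1))" for k
  proof (rule Bochner_Integration.integrable_bound)
    have "emeasure (stable_levy \<alpha>) (slice \<kappa> \<alpha> k) < \<infinity>" by (simp add: emeasure_slice)
    then show "integrable (stable_levy \<alpha>) (\<lambda>y. 2 * indicat_real (slice \<kappa> \<alpha> k) y)" by (simp add: integrable_indicator_iff)
    have "norm (h y - 1) \<le> 2" for y using norm_triangle_ineq4[of "h y" 1] h(2)[of y] by simp
    then show "AE y in stable_levy \<alpha>. norm (indicat_real (slice \<kappa> \<alpha> k) y *\<^sub>R (h y - 1)) \<le> norm (2 * indicat_real (slice \<kappa> \<alpha> k) y)"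
      by (intro AE_I2) (auto simp: indicator_def)
  qed (use h in auto)
  have "(LINT y|slice_law k. h y) - 1 = \<kappa> *\<^sub>R (LINT y|stable_levy \<alpha>. indicat_real (slice \<kappa> \<alpha> k) y *\<^sub>R (h y - 1))" for k
  proof -
    interpret prob_space "slice_law k" by (rule prob_space_slice_law)
    have "integrable (slice_law k) h"
      by (rule integrable_const_bound[where B=1]) (use h sets_slice_law[of k] in \<open>auto cong: measurable_cong_sets\<close>)
    then have "(LINT y|slice_law k. h y) - 1 = (LINT y|slice_law k. h y - 1)"
      by (simp add: prob_space)
    also have "\<dots> = \<kappa> *\<^sub>R (LINT y|stable_levy \<alpha>. indicat_real (slice \<kappa> \<alpha> k) y *\<^sub>R (h y - 1))"
      by (rule integral_slice_law) (use h in auto)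
    finally show ?thesis .
  qed
  then have "(\<Sum>k<n. (LINT y|slice_law k. h y) - 1) = \<kappa> *\<^sub>R (LINT y|stable_levy \<alpha>. (\<Sum>k<n. indicat_real (slice \<kappa> \<alpha> k) y *\<^sub>R (h y - 1)))"
    using i by (simp only: scaleR_sum_right Bochner_Integration.integral_sum)
  then show ?thesis by (simp only: scaleR_sum_left[symmetric] sum_indicator_slice)
qed

text \<open>The sets \<open>above_slice\<close> exhaust the positive half-line; dominated convergence applies.\<close>

lemma slice_sums_tendsto:
  fixes h :: "real \<Rightarrow> complex"
  assumes h: "h \<in> borel_measurable borel" "\<And>y. norm (h y) \<le> 1"
    and i: "integrable (stable_levy \<alpha>) (\<lambda>y. h y - 1)"
  shows "(\<lambda>n. \<Sum>k<n. (LINT y|slice_law k. h y) - 1) \<longlonglongrightarrow> of_real \<kappa> * (LINT y|stable_levy \<alpha>. h y - 1)"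
proof -
  have "(\<lambda>n. LINT y|stable_levy \<alpha>. indicat_real (above_slice \<kappa> \<alpha> n) y *\<^sub>R (h y - 1)) \<longlonglongrightarrow> (LINT y|stable_levy \<alpha>. h y - 1)"
  proof (rule integral_dominated_convergence[where w="\<lambda>y. norm (h y - 1)"])
    show "AE y in stable_levy \<alpha>. (\<lambda>n. indicat_real (above_slice \<kappa> \<alpha> n) y *\<^sub>R (h y - 1)) \<longlonglongrightarrow> h y - 1"
      using AE_stable_levy_pos[of \<alpha>]
    proof eventually_elim
      case (elim y)
      have "(slice_bound \<kappa> \<alpha>) \<longlonglongrightarrow> 0"
        unfolding slice_bound_def using \<alpha> \<kappa>
        by (intro tendsto_neg_powr filterlim_tendsto_pos_mult_at_top[OF tendsto_const, of "1 / \<kappa>", simplified] filterlim_real_sequentially) auto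
      then have "eventually (\<lambda>n. slice_bound \<kappa> \<alpha> n < y) sequentially"
        using elim by (intro order_tendstoD) auto
      then have "eventually (\<lambda>n. indicat_real (above_slice \<kappa> \<alpha> n) y *\<^sub>R (h y - 1) = h y - 1) sequentially"
        using eventually_gt_at_top[of 0] by eventually_elim (simp add: above_slice_def)
      then show ?case by (rule tendsto_eventually)
    qed
  qed (use h i in \<open>auto simp: indicator_def\<close>)
  then show ?thesis
    unfolding sum_integral_slice_law[OF h] scaleR_conv_of_real by (intro tendsto_intros) (simp add: scaleR_conv_of_real)
qed

end

section \<open>The limit vector\<close>

definition point_sum :: "(real \<Rightarrow> real) \<Rightarrow> nat \<times> (nat \<Rightarrow> real) \<Rightarrow> real" where
  "point_sum f x = (\<Sum>j<fst x. f (snd x j))"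

definition point_prod :: "(real \<Rightarrow> complex) \<Rightarrow> nat \<times> (nat \<Rightarrow> real) \<Rightarrow> complex" where
  "point_prod h x = (\<Prod>j<fst x. h (snd x j))"

definition poisson_process :: "real \<Rightarrow> real \<Rightarrow> (nat \<Rightarrow> nat \<times> (nat \<Rightarrow> real)) measure" where
  "poisson_process \<kappa> \<alpha> = PiM UNIV (\<lambda>k. poisson_points (slice_law \<kappa> \<alpha> k))"

context
  fixes \<kappa> \<alpha> :: real
  assumes \<kappa>: "0 < \<kappa>" and \<alpha>: "0 < \<alpha>" "\<alpha> < 2"
begin

interpretation slice: prob_space "slice_law \<kappa> \<alpha> k" for k
  by (rule prob_space_slice_law[OF \<kappa> \<alpha>])

lemma prob_space_points: "prob_space (poisson_points (slice_law \<kappa> \<alpha> k))"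
  by (rule prob_space_poisson_points) (rule prob_space_slice_law[OF \<kappa> \<alpha>])

interpretation P: product_prob_space "\<lambda>k::nat. poisson_points (slice_law \<kappa> \<alpha> k)" UNIV
  by (rule product_prob_spaceI) (rule prob_space_points)

interpretation PP: prob_space "poisson_process \<kappa> \<alpha>"
  unfolding poisson_process_def by (rule prob_space_PiM) (rule prob_space_points)

lemma sets_slice_points: "sets (poisson_points (slice_law \<kappa> \<alpha> k)) = sets (count_space UNIV \<Otimes>\<^sub>M PiM UNIV (\<lambda>_. borel))"
  by (rule sets_poisson_points) (rule sets_slice_law[OF \<kappa> \<alpha>])

lemma measurable_point_sum': "f \<in> borel_measurable borel \<Longrightarrow> point_sum f \<in> borel_measurable (poisson_points (slice_law \<kappa> \<alpha> k))"
  unfolding point_sum_def[abs_def]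
  by (subst measurable_cong_sets[OF sets_slice_points refl]) (rule measurable_point_sum)

lemma measurable_point_prod': "h \<in> borel_measurable borel \<Longrightarrow> point_prod h \<in> borel_measurable (poisson_points (slice_law \<kappa> \<alpha> k))"
  unfolding point_prod_def[abs_def]
  by (subst measurable_cong_sets[OF sets_slice_points refl]) (rule measurable_point_prod)

lemma measurable_slice_component: "(\<lambda>\<omega>. \<omega> k) \<in> measurable (poisson_process \<kappa> \<alpha>) (poisson_points (slice_law \<kappa> \<alpha> k))"
  unfolding poisson_process_def by (rule measurable_component_singleton) simp

lemma measurable_component_sum [measurable]: "f \<in> borel_measurable borel \<Longrightarrow> (\<lambda>\<omega>. point_sum f (\<omega> k)) \<in> borel_measurable (poisson_process \<kappa> \<alpha>)"
  by (rule measurable_compose[OF measurable_slice_component measurable_point_sum'])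

lemma measurable_component_prod [measurable]: "h \<in> borel_measurable borel \<Longrightarrow> (\<lambda>\<omega>. point_prod h (\<omega> k)) \<in> borel_measurable (poisson_process \<kappa> \<alpha>)"
  by (rule measurable_compose[OF measurable_slice_component measurable_point_prod'])

lemma norm_point_prod: "(\<And>y. norm (h y) \<le> 1) \<Longrightarrow> norm (point_prod h x) \<le> 1"
  unfolding point_prod_def prod_norm[symmetric] by (rule prod_le_1) auto

text \<open>Independence of the slices turns the product into a product of generating functionals.\<close>

lemma poisson_process_product:
  assumes h: "h \<in> borel_measurable borel" "\<And>y. norm (h y) \<le> 1"
  shows "(LINT \<omega>|poisson_process \<kappa> \<alpha>. (\<Prod>k<n. point_prod h (\<omega> k))) = exp (\<Sum>k<n. (LINT y|slice_law \<kappa> \<alpha> k. h y) - 1)"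
proof -
  have "(LINT \<omega>|poisson_process \<kappa> \<alpha>. (\<Prod>k<n. point_prod h (\<omega> k))) = (\<Prod>k<n. LINT x|poisson_points (slice_law \<kappa> \<alpha> k). point_prod h x)"
    unfolding poisson_process_def
    by (rule integral_PiM_prod) (auto intro: prob_space_points measurable_point_prod' norm_point_prod h)
  also have "\<dots> = (\<Prod>k<n. exp ((LINT y|slice_law \<kappa> \<alpha> k. h y) - 1))"
    unfolding point_prod_def
    by (intro prod.cong refl poisson_points_product h prob_space_slice_law[OF \<kappa> \<alpha>] sets_slice_law[OF \<kappa> \<alpha>])
  finally show ?thesis by (simp add: exp_sum)
qed

text \<open>By Campbell's formula the expected contribution of slice \<open>k\<close> is at most \<open>b k\<close>, so the sum over all
  slices but the first has finite expectation. The first slice is unbounded, so no bound is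
  available for it; it adds a single summand.\<close>

lemma AE_summable_point_sums:
  assumes f: "f \<in> borel_measurable borel" "\<And>y. 0 \<le> f y"
    and b: "\<And>k y. 0 < k \<Longrightarrow> y \<in> slice \<kappa> \<alpha> k \<Longrightarrow> f y \<le> b k" "summable b"
  shows "AE \<omega> in poisson_process \<kappa> \<alpha>. summable (\<lambda>k. point_sum f (\<omega> k))"
proof -
  have b': "f y \<le> \<bar>b (Suc k)\<bar>" if "y \<in> slice \<kappa> \<alpha> (Suc k)" for k y using b(1)[of "Suc k" y] that by simp
  have bs: "summable (\<lambda>k. b (Suc k))" using b(2) by (simp add: summable_Suc_iff)
  have bpos: "0 \<le> b (Suc k)" for k
  proof -
    have "slice \<kappa> \<alpha> (Suc k) \<noteq> {}" using slice_nontrivial(1)[OF \<kappa> \<alpha>, of "Suc k"] by auto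
    then obtain y where "y \<in> slice \<kappa> \<alpha> (Suc k)" by blast
    then show ?thesis using b(1)[of "Suc k" y] f(2)[of y] by simp
  qed
  have one: "(\<integral>\<^sup>+\<omega>. ennreal (point_sum f (\<omega> (Suc k))) \<partial>poisson_process \<kappa> \<alpha>) \<le> ennreal (b (Suc k))" for k
  proof -
    have "(\<integral>\<^sup>+\<omega>. ennreal (point_sum f (\<omega> (Suc k))) \<partial>poisson_process \<kappa> \<alpha>) =
      (\<integral>\<^sup>+x. ennreal (point_sum f x) \<partial>distr (poisson_process \<kappa> \<alpha>) (poisson_points (slice_law \<kappa> \<alpha> (Suc k))) (\<lambda>\<omega>. \<omega> (Suc k)))"
      by (subst nn_integral_distr[OF measurable_slice_component])
         (auto intro: measurable_compose[OF measurable_point_sum'[OF f(1)] measurable_ennreal])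
    also have "\<dots> = (\<integral>\<^sup>+x. ennreal (point_sum f x) \<partial>poisson_points (slice_law \<kappa> \<alpha> (Suc k)))"
      unfolding poisson_process_def by (subst distr_PiM_component) (auto intro: prob_space_points)
    also have "\<dots> = (\<integral>\<^sup>+y. ennreal (f y) \<partial>slice_law \<kappa> \<alpha> (Suc k))"
      unfolding point_sum_def
      by (intro poisson_points_mean f prob_space_slice_law[OF \<kappa> \<alpha>] sets_slice_law[OF \<kappa> \<alpha>])
    also have "\<dots> \<le> (\<integral>\<^sup>+y. ennreal (b (Suc k)) \<partial>slice_law \<kappa> \<alpha> (Suc k))"
    proof (rule nn_integral_mono_AE)
      show "AE y in slice_law \<kappa> \<alpha> (Suc k). ennreal (f y) \<le> ennreal (b (Suc k))"
        unfolding slice_law_def[OF \<kappa> \<alpha>]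
        by (rule AE_uniform_measureI) (use b(1)[of "Suc k"] sets_slice[OF \<kappa> \<alpha>] in \<open>auto intro!: AE_I2 ennreal_leI\<close>)
    qed
    also have "\<dots> = ennreal (b (Suc k))" by (simp add: slice.emeasure_space_1)
    finally show ?thesis .
  qed
  have "(\<integral>\<^sup>+\<omega>. (\<Sum>k. ennreal (point_sum f (\<omega> (Suc k)))) \<partial>poisson_process \<kappa> \<alpha>) =
    (\<Sum>k. \<integral>\<^sup>+\<omega>. ennreal (point_sum f (\<omega> (Suc k))) \<partial>poisson_process \<kappa> \<alpha>)"
    by (rule nn_integral_suminf) (use f in measurable)
  also have "\<dots> \<le> (\<Sum>k. ennreal (b (Suc k)))"
    by (intro suminf_le one summableI)
  also have "\<dots> = ennreal (\<Sum>k. b (Suc k))"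
    by (rule suminf_ennreal2[OF bpos bs])
  also have "\<dots> < \<infinity>" by simp
  finally have fin: "(\<integral>\<^sup>+\<omega>. (\<Sum>k. ennreal (point_sum f (\<omega> (Suc k)))) \<partial>poisson_process \<kappa> \<alpha>) \<noteq> \<infinity>" by simp
  have "AE \<omega> in poisson_process \<kappa> \<alpha>. (\<Sum>k. ennreal (point_sum f (\<omega> (Suc k)))) \<noteq> \<infinity>"
    by (rule nn_integral_PInf_AE[OF _ fin]) (use f in measurable)
  then show ?thesis
  proof eventually_elim
    case (elim \<omega>)
    have "summable (\<lambda>k. point_sum f (\<omega> (Suc k)))"
      by (rule summable_suminf_not_top) (use elim f in \<open>auto simp: point_sum_def intro!: sum_nonneg\<close>)
    then show ?case using summable_Suc_iff[of "\<lambda>k. point_sum f (\<omega> k)"] by blast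
  qed
qed

lemma slice_upper: "0 < k \<Longrightarrow> y \<in> slice \<kappa> \<alpha> k \<Longrightarrow> \<bar>y\<bar> \<le> slice_bound \<kappa> \<alpha> k"
  using slice_bound_pos[OF \<kappa> \<alpha>, of "Suc k"] by (auto simp: slice_def above_slice_def)

text \<open>The exponent of \<open>k\<close> is \<open>- m / \<alpha> < - 1\<close>, since \<open>\<alpha> < 2\<close>.\<close>

lemma summable_slice_bound_power:
  assumes "2 \<le> m"
  shows "summable (\<lambda>k. C * slice_bound \<kappa> \<alpha> k ^ m)"
proof -
  have "C * slice_bound \<kappa> \<alpha> k ^ m = C * (1 / \<kappa>) powr (- real m / \<alpha>) * real k powr (- real m / \<alpha>)" for k
  proof (cases "k = 0")
    case True
    then show ?thesis using assms by (simp add: slice_bound_def)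
  next
    case False
    have "slice_bound \<kappa> \<alpha> k ^ m = (real k * (1 / \<kappa>)) powr (- real m / \<alpha>)"
      using False \<kappa> by (simp add: slice_bound_def powr_powr powr_realpow[symmetric])
    also have "\<dots> = real k powr (- real m / \<alpha>) * (1 / \<kappa>) powr (- real m / \<alpha>)"
      by (rule powr_mult)
    finally show ?thesis by simp
  qed
  moreover have "- real m / \<alpha> < -1" using assms \<alpha> by (simp add: field_simps)
  then have "summable (\<lambda>k. real k powr (- real m / \<alpha>))" by (simp add: summable_real_powr_iff)
  ultimately show ?thesis by (simp only: summable_mult)
qed

text \<open>Almost surely there is at least one point. The product over the points of the indicator of \<open>{0}\<close>
  equals 1 only if there are no points other than 0, and slices do not contain 0; the first \<open>n\<close> slices
  are void with probability \<open>exp (- n)\<close>.\<close>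

lemma AE_no_void_process:
  "AE \<omega> in poisson_process \<kappa> \<alpha>. \<not> (\<forall>n. (\<Prod>k<n. point_prod (indicator {0}) (\<omega> k)) = 1)"
proof -
  let ?h = "indicator {0} :: real \<Rightarrow> complex"
  let ?I = "\<lambda>n \<omega>. \<Prod>k<n. point_prod ?h (\<omega> k)"
  let ?A = "{\<omega> \<in> space (poisson_process \<kappa> \<alpha>). \<forall>n. ?I n \<omega> = 1}"
  have h: "?h \<in> borel_measurable borel" "norm (?h y) \<le> 1" for y
    by (auto simp: indicator_def)
  have m[measurable]: "?I n \<in> borel_measurable (poisson_process \<kappa> \<alpha>)" for n
    using h by measurable
  have A: "?A \<in> sets (poisson_process \<kappa> \<alpha>)" by measurable
  have z: "(LINT y|slice_law \<kappa> \<alpha> k. ?h y) = 0" for k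
  proof -
    have "(LINT y|slice_law \<kappa> \<alpha> k. ?h y) = \<kappa> *\<^sub>R (LINT y|stable_levy \<alpha>. indicator (slice \<kappa> \<alpha> k) y *\<^sub>R ?h y)"
      by (rule integral_slice_law[OF \<kappa> \<alpha> h(1)])
    also have "(\<lambda>y. indicat_real (slice \<kappa> \<alpha> k) y *\<^sub>R ?h y) = (\<lambda>y. 0)"
      using slice_bound_pos[OF \<kappa> \<alpha>, of "Suc k"] by (auto simp: indicator_def slice_def above_slice_def)
    finally show ?thesis by simp
  qed
  have nI: "norm (?I n \<omega>) \<le> 1" for n \<omega>
    unfolding prod_norm[symmetric] by (rule prod_le_1) (auto intro: norm_point_prod h(2))
  have le: "PP.prob ?A \<le> exp (- real n)" for n
  proof -
    have i: "integrable (poisson_process \<kappa> \<alpha>) (?I n)"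
      by (rule PP.integrable_const_bound[where B=1]) (auto intro: nI)
    have "PP.prob ?A = (LINT \<omega>|poisson_process \<kappa> \<alpha>. indicat_real ?A \<omega>)" using A by simp
    also have "\<dots> \<le> (LINT \<omega>|poisson_process \<kappa> \<alpha>. norm (?I n \<omega>))"
    proof (intro integral_mono integrable_norm i)
      show "integrable (poisson_process \<kappa> \<alpha>) (indicat_real ?A)"
        using A by (simp add: integrable_indicator_iff PP.emeasure_eq_measure)
    qed (auto simp: indicator_def)
    also have "\<dots> = (LINT \<omega>|poisson_process \<kappa> \<alpha>. Re (?I n \<omega>))"
    proof (intro Bochner_Integration.integral_cong refl)
      fix \<omega>
      have "?I n \<omega> \<in> {0, 1}"
      proof -
        have "point_prod ?h x \<in> {0, 1}" for x
          by (cases "\<forall>j<fst x. snd x j = 0") (auto simp: point_prod_def indicator_def)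
        note 01 = this
        show ?thesis
        proof (cases "\<forall>k<n. point_prod ?h (\<omega> k) = 1")
          case False
          then obtain k where "k < n" "point_prod ?h (\<omega> k) = 0" using 01 by blast
          then have "?I n \<omega> = 0" by (intro prod_zero) auto
          then show ?thesis by simp
        qed simp
      qed
      then have "?I n \<omega> = 0 \<or> ?I n \<omega> = 1" by blast
      then show "norm (?I n \<omega>) = Re (?I n \<omega>)"
        by (elim disjE) (simp_all only: norm_zero norm_one zero_complex.sel one_complex.sel)
    qed
    also have "\<dots> = Re (LINT \<omega>|poisson_process \<kappa> \<alpha>. ?I n \<omega>)" using integral_Re[OF i] by simp
    also have "(LINT \<omega>|poisson_process \<kappa> \<alpha>. ?I n \<omega>) = exp (\<Sum>k<n. 0 - 1)"
      by (subst poisson_process_product[OF h]) (simp only: z)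
    also have "Re \<dots> = exp (- real n)" by (simp add: Re_exp)
    finally show ?thesis .
  qed
  have "(\<lambda>n. exp (- real n)) \<longlonglongrightarrow> 0"
    by (rule filterlim_compose[OF exp_at_bot]) (simp add: filterlim_uminus_at_bot filterlim_real_sequentially)
  then have "PP.prob ?A \<le> 0" by (rule LIMSEQ_le_const) (use le in auto)
  then have "?A \<in> null_sets (poisson_process \<kappa> \<alpha>)"
    using A measure_nonneg[of "poisson_process \<kappa> \<alpha>" ?A] by (auto simp: null_sets_def PP.emeasure_eq_measure)
  from AE_not_in[OF this] AE_space show ?thesis by eventually_elim auto
qed

text \<open>With \<open>y\<^sub>j\<close> the points of the process, the components are \<open>V1 = c * \<Sum>y\<^sub>j\<^sup>2\<close> and
  \<open>V2 = sqrt (v * \<Sum>y\<^sub>j\<^sup>3) * Z\<close> with \<open>Z\<close> standard normal and independent of the process. Integrating over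
  \<open>Z\<close> leaves the expectation of a product over the points, which the generating functional evaluates.\<close>

theorem exists_stable_vector:
  assumes c: "0 < c" and v: "0 \<le> v"
  shows "\<exists>(N :: ((nat \<Rightarrow> nat \<times> (nat \<Rightarrow> real)) \<times> real) measure) V1 V2.
     prob_space N \<and> V1 \<in> borel_measurable N \<and> V2 \<in> borel_measurable N \<and> (AE \<omega> in N. V1 \<omega> > 0) \<and>
     (\<forall>s t :: real. (LINT \<omega>|N. exp (\<i> * complex_of_real (s * V1 \<omega> + t * V2 \<omega>))) =
        exp (of_real \<kappa> * (LINT y|stable_levy \<alpha>. cluster_cf (s * c) (t\<^sup>2 * v / 2) y - 1)))"
proof -
  define f1 f2 :: "real \<Rightarrow> real" where "f1 y = c * y\<^sup>2" and "f2 y = v * \<bar>y\<bar> ^ 3" for y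
  have f1[measurable]: "f1 \<in> borel_measurable borel" and f2[measurable]: "f2 \<in> borel_measurable borel"
    by (simp_all add: f1_def[abs_def] f2_def[abs_def])
  have f0: "0 \<le> f1 y" "0 \<le> f2 y" for y using c v by (simp_all add: f1_def f2_def)
  let ?P = "poisson_process \<kappa> \<alpha>"
  have s1: "AE \<omega> in ?P. summable (\<lambda>k. point_sum f1 (\<omega> k))"
  proof (rule AE_summable_point_sums[OF f1 f0(1)])
    show "f1 y \<le> c * slice_bound \<kappa> \<alpha> k ^ 2" if "0 < k" "y \<in> slice \<kappa> \<alpha> k" for k y
      unfolding f1_def using power_mono[OF slice_upper[OF that], of 2] c by (intro mult_left_mono) auto
    show "summable (\<lambda>k. c * slice_bound \<kappa> \<alpha> k ^ 2)" by (rule summable_slice_bound_power) simp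
  qed
  have s2: "AE \<omega> in ?P. summable (\<lambda>k. point_sum f2 (\<omega> k))"
  proof (rule AE_summable_point_sums[OF f2 f0(2)])
    show "f2 y \<le> v * slice_bound \<kappa> \<alpha> k ^ 3" if "0 < k" "y \<in> slice \<kappa> \<alpha> k" for k y
      unfolding f2_def using power_mono[OF slice_upper[OF that], of 3] v by (intro mult_left_mono) auto
    show "summable (\<lambda>k. v * slice_bound \<kappa> \<alpha> k ^ 3)" by (rule summable_slice_bound_power) simp
  qed
  define U1 where "U1 \<omega> = (\<Sum>k. point_sum f1 (\<omega> k))" for \<omega> :: "nat \<Rightarrow> nat \<times> (nat \<Rightarrow> real)"
  define W where "W \<omega> = (\<Sum>k. point_sum f2 (\<omega> k))" for \<omega> :: "nat \<Rightarrow> nat \<times> (nat \<Rightarrow> real)"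
  have U1[measurable]: "U1 \<in> borel_measurable ?P" and W[measurable]: "W \<in> borel_measurable ?P"
    unfolding U1_def[abs_def] W_def[abs_def] by measurable
  have pn: "0 \<le> point_sum f1 x" "0 \<le> point_sum f2 x" for x
    using f0 by (auto simp: point_sum_def intro!: sum_nonneg)
  have U1_pos: "AE \<omega> in ?P. 0 < U1 \<omega>"
    using s1 AE_no_void_process
  proof eventually_elim
    case (elim \<omega>)
    have "U1 \<omega> \<noteq> 0"
    proof
      assume "U1 \<omega> = 0"
      then have z: "point_sum f1 (\<omega> k) = 0" for k
        using suminf_eq_zero_iff[OF elim(1)] pn(1) by (simp add: U1_def)
      have "point_prod (indicator {0}) (\<omega> k) = (1::complex)" for k
      proof -
        have "f1 (snd (\<omega> k) j) = 0" if "j < fst (\<omega> k)" for j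
          using z[of k] that f0(1) by (auto simp: point_sum_def sum_nonneg_eq_0_iff)
        then show ?thesis using c by (auto simp: point_prod_def f1_def indicator_def)
      qed
      then show False using elim(2) by simp
    qed
    moreover have "0 \<le> U1 \<omega>" unfolding U1_def by (rule suminf_nonneg[OF elim(1) pn(1)])
    ultimately show ?case by simp
  qed
  have W_nonneg: "AE \<omega> in ?P. 0 \<le> W \<omega>"
    using s2 by eventually_elim (unfold W_def, intro suminf_nonneg pn)
  have cf: "(LINT \<omega>|?P. exp (\<i> * of_real (s * U1 \<omega>) - of_real (t\<^sup>2 / 2 * W \<omega>))) =
      exp (of_real \<kappa> * (LINT y|stable_levy \<alpha>. cluster_cf (s * c) (t\<^sup>2 * v / 2) y - 1))" for s t
  proof -
    let ?g = "cluster_cf (s * c) (t\<^sup>2 * v / 2)"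
    have v': "0 \<le> t\<^sup>2 * v / 2" using v by simp
    have g: "?g \<in> borel_measurable borel"
      by (intro borel_measurable_continuous_onI continuous_at_imp_continuous_on ballI isCont_cluster_cf)
    note ng = norm_cluster_cf[OF v', of "s * c"]
    have ig: "integrable (stable_levy \<alpha>) (\<lambda>y. ?g y - 1)"
    proof -
      define L where "L = max 2 (\<bar>s * c\<bar> + 3 / 2 * (t\<^sup>2 * v / 2 + 1))"
      show ?thesis
      proof (rule integrable_stable_levy[OF \<alpha>, where C=L])
        show "norm (?g y - 1) \<le> L" for y
          using norm_triangle_ineq4[of "?g y" 1] ng[of y] by (simp add: L_def)
        show "norm (?g y - 1) \<le> L * y\<^sup>2" if "0 \<le> y" for y
        proof -
          have "norm (?g y - ?g 0) \<le> (\<bar>s * c\<bar> + 3 / 2 * (t\<^sup>2 * v / 2 + 1)) * \<bar>y\<^sup>2 - 0\<^sup>2\<bar>"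
            by (rule cluster_cf_lipschitz_square[OF v' that]) simp
          also have "\<dots> \<le> L * \<bar>y\<^sup>2 - 0\<^sup>2\<bar>" by (intro mult_right_mono) (auto simp: L_def)
          finally show ?thesis by simp
        qed
      qed (use g in auto)
    qed
    have pp: "point_prod ?g x = exp (\<i> * of_real (s * point_sum f1 x) - of_real (t\<^sup>2 / 2 * point_sum f2 x))" for x
    proof -
      have "point_prod ?g x = exp (\<Sum>j<fst x. \<i> * of_real (s * c * (snd x j)\<^sup>2) - of_real (t\<^sup>2 * v / 2 * \<bar>snd x j\<bar> ^ 3))"
        by (simp only: point_prod_def cluster_cf_def exp_sum[OF finite_lessThan])
      also have "(\<Sum>j<fst x. \<i> * of_real (s * c * (snd x j)\<^sup>2) - of_real (t\<^sup>2 * v / 2 * \<bar>snd x j\<bar> ^ 3)) =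
        \<i> * of_real (s * point_sum f1 x) - of_real (t\<^sup>2 / 2 * point_sum f2 x)"
        by (simp add: point_sum_def f1_def f2_def sum_subtractf sum_distrib_left mult_ac)
      finally show ?thesis .
    qed
    have "(\<lambda>n. LINT \<omega>|?P. (\<Prod>k<n. point_prod ?g (\<omega> k))) \<longlonglongrightarrow> (LINT \<omega>|?P. exp (\<i> * of_real (s * U1 \<omega>) - of_real (t\<^sup>2 / 2 * W \<omega>)))"
    proof (rule integral_dominated_convergence[where w="\<lambda>_. 1"])
      show "AE \<omega> in ?P. (\<lambda>n. \<Prod>k<n. point_prod ?g (\<omega> k)) \<longlonglongrightarrow> exp (\<i> * of_real (s * U1 \<omega>) - of_real (t\<^sup>2 / 2 * W \<omega>))"
        using s1 s2
      proof eventually_elim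
        case (elim \<omega>)
        have 1: "(\<lambda>n. \<Sum>k<n. point_sum f1 (\<omega> k)) \<longlonglongrightarrow> U1 \<omega>" "(\<lambda>n. \<Sum>k<n. point_sum f2 (\<omega> k)) \<longlonglongrightarrow> W \<omega>"
          unfolding U1_def W_def by (rule summable_LIMSEQ elim)+
        have "(\<Prod>k<n. point_prod ?g (\<omega> k)) = exp (\<i> * of_real (s * (\<Sum>k<n. point_sum f1 (\<omega> k))) - of_real (t\<^sup>2 / 2 * (\<Sum>k<n. point_sum f2 (\<omega> k))))" for n
          unfolding pp exp_sum[OF finite_lessThan, symmetric] by (simp add: sum_subtractf sum_distrib_left)
        then show ?case by (simp only:) (intro tendsto_intros 1)
      qed
      show "AE \<omega> in ?P. norm (\<Prod>k<n. point_prod ?g (\<omega> k)) \<le> 1" for n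
        unfolding prod_norm[symmetric] by (intro AE_I2 prod_le_1) (auto intro: norm_point_prod ng)
    qed (use g in measurable)
    moreover have "(\<lambda>n. LINT \<omega>|?P. (\<Prod>k<n. point_prod ?g (\<omega> k))) \<longlonglongrightarrow> exp (of_real \<kappa> * (LINT y|stable_levy \<alpha>. ?g y - 1))"
      unfolding poisson_process_product[OF g ng]
      by (intro tendsto_exp slice_sums_tendsto[OF \<kappa> \<alpha> g ng ig])
    ultimately show ?thesis by (rule LIMSEQ_unique)
  qed
  let ?Z = "std_normal_distribution"
  interpret Z: prob_space ?Z by (rule prob_space_normal_density) simp
  interpret N: pair_prob_space ?P ?Z ..
  \<comment> \<open>The value 1 is taken on a null set only; it makes \<open>V1\<close> positive everywhere.\<close>
  define V1 where "V1 z = (if 0 < U1 (fst z) then U1 (fst z) else 1)" for z :: "(nat \<Rightarrow> nat \<times> (nat \<Rightarrow> real)) \<times> real"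
  define V2 where "V2 z = sqrt (W (fst z)) * snd z" for z :: "(nat \<Rightarrow> nat \<times> (nat \<Rightarrow> real)) \<times> real"
  have V1[measurable]: "V1 \<in> borel_measurable (?P \<Otimes>\<^sub>M ?Z)" and V2[measurable]: "V2 \<in> borel_measurable (?P \<Otimes>\<^sub>M ?Z)"
    unfolding V1_def[abs_def] V2_def[abs_def] by measurable
  have "(LINT z|(?P \<Otimes>\<^sub>M ?Z). exp (\<i> * complex_of_real (s * V1 z + t * V2 z))) =
      exp (of_real \<kappa> * (LINT y|stable_levy \<alpha>. cluster_cf (s * c) (t\<^sup>2 * v / 2) y - 1))" for s t
  proof -
    have i: "integrable (?P \<Otimes>\<^sub>M ?Z) (\<lambda>z. exp (\<i> * complex_of_real (s * V1 z + t * V2 z)))"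
      by (rule N.integrable_const_bound[where B=1]) auto
    have "(LINT z|(?P \<Otimes>\<^sub>M ?Z). exp (\<i> * complex_of_real (s * V1 z + t * V2 z))) =
      (LINT \<omega>|?P. LINT x|?Z. exp (\<i> * complex_of_real (s * V1 (\<omega>, x) + t * V2 (\<omega>, x))))"
      using N.integral_fst'[OF i] by simp
    also have "\<dots> = (LINT \<omega>|?P. exp (\<i> * of_real (s * U1 \<omega>) - of_real (t\<^sup>2 / 2 * W \<omega>)))"
    proof (rule integral_cong_AE)
      show "(\<lambda>\<omega>. LINT x|?Z. exp (\<i> * complex_of_real (s * V1 (\<omega>, x) + t * V2 (\<omega>, x)))) \<in> borel_measurable ?P"
        by (rule Z.borel_measurable_lebesgue_integral) measurable
      show "AE \<omega> in ?P. (LINT x|?Z. exp (\<i> * complex_of_real (s * V1 (\<omega>, x) + t * V2 (\<omega>, x)))) = exp (\<i> * of_real (s * U1 \<omega>) - of_real (t\<^sup>2 / 2 * W \<omega>))"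
        using U1_pos W_nonneg
      proof eventually_elim
        case (elim \<omega>)
        have "exp (\<i> * complex_of_real (s * V1 (\<omega>, x) + t * V2 (\<omega>, x))) = exp (\<i> * of_real (s * U1 \<omega>)) * iexp ((t * sqrt (W \<omega>)) * x)" for x
          using elim by (simp add: V1_def V2_def exp_add[symmetric] algebra_simps)
        then have "(LINT x|?Z. exp (\<i> * complex_of_real (s * V1 (\<omega>, x) + t * V2 (\<omega>, x)))) = exp (\<i> * of_real (s * U1 \<omega>)) * char ?Z (t * sqrt (W \<omega>))"
          by (simp only: char_def integral_mult_right_zero)
        also have "char ?Z (t * sqrt (W \<omega>)) = exp (- of_real (t\<^sup>2 / 2 * W \<omega>))"
        proof -
          have "(t * sqrt (W \<omega>))\<^sup>2 = t\<^sup>2 * W \<omega>" using elim by (simp add: power_mult_distrib)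
          then have "- ((t * sqrt (W \<omega>))\<^sup>2) / 2 = - (t\<^sup>2 / 2 * W \<omega>)" by simp
          then show ?thesis
            unfolding char_std_normal_distribution by (simp only: exp_of_real[symmetric] of_real_minus)
        qed
        finally show ?case by (simp only: exp_add[symmetric] add_uminus_conv_diff)
      qed
    qed measurable
    also have "\<dots> = exp (of_real \<kappa> * (LINT y|stable_levy \<alpha>. cluster_cf (s * c) (t\<^sup>2 * v / 2) y - 1))" by (rule cf)
    finally show ?thesis .
  qed
  moreover have "AE z in ?P \<Otimes>\<^sub>M ?Z. V1 z > 0" by (intro AE_I2) (simp add: V1_def)
  moreover have "prob_space (?P \<Otimes>\<^sub>M ?Z)" by unfold_locales
  ultimately show ?thesis using V1 V2 by blast
qed

end

section \<open>Convergence of the estimator\<close>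

lemma stable_levy_integral_lborel:
  "(LINT y|stable_levy \<alpha>. cluster_cf s v y - 1) =
   (LINT y:{0<..}|lborel. (exp (\<i> * complex_of_real (s * y\<^sup>2) - complex_of_real (v * y ^ 3)) - 1) * complex_of_real (\<alpha> * y powr (- \<alpha> - 1)))"
  if "0 < \<alpha>"
proof -
  have [measurable]: "cluster_cf s v \<in> borel_measurable borel"
    by (intro borel_measurable_continuous_onI continuous_at_imp_continuous_on ballI isCont_cluster_cf)
  have "(LINT y|stable_levy \<alpha>. cluster_cf s v y - 1) =
    (LINT y|lborel. (indicator {0<..} y * (\<alpha> * y powr (- \<alpha> - 1))) *\<^sub>R (cluster_cf s v y - 1))"
    unfolding stable_levy_def using that by (intro integral_density) auto
  then show ?thesis
    unfolding set_lebesgue_integral_def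
    by (auto intro!: Bochner_Integration.integral_cong simp: indicator_def cluster_cf_def scaleR_conv_of_real mult.commute)
qed

text \<open>Transports the vector to its law on the plane.\<close>

lemma exists_limit_vector:
  fixes \<kappa> \<alpha> c v :: real
  assumes \<kappa>: "0 < \<kappa>" and \<alpha>: "0 < \<alpha>" "\<alpha> < 2" and c: "0 < c" and v: "0 \<le> v"
  obtains N :: "(real \<times> real) measure" and V1 V2 where
    "prob_space N" "V1 \<in> borel_measurable N" "V2 \<in> borel_measurable N" "AE \<omega> in N. V1 \<omega> > 0"
    "\<And>s t :: real. (LINT \<omega>|N. exp (\<i> * complex_of_real (s * V1 \<omega> + t * V2 \<omega>))) =
        exp (of_real \<kappa> * (LINT y|stable_levy \<alpha>. cluster_cf (s * c) (t\<^sup>2 * v / 2) y - 1))"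
proof -
  from exists_stable_vector[OF \<kappa> \<alpha> c v]
  obtain N0 :: "((nat \<Rightarrow> nat \<times> (nat \<Rightarrow> real)) \<times> real) measure" and U1 U2 where
    N0: "prob_space N0" "U1 \<in> borel_measurable N0" "U2 \<in> borel_measurable N0" "AE \<omega> in N0. U1 \<omega> > 0"
      "\<And>s t :: real. (LINT \<omega>|N0. exp (\<i> * complex_of_real (s * U1 \<omega> + t * U2 \<omega>))) =
        exp (of_real \<kappa> * (LINT y|stable_levy \<alpha>. cluster_cf (s * c) (t\<^sup>2 * v / 2) y - 1))"
    by blast
  note [measurable] = N0(2,3)
  let ?N = "distr N0 borel (\<lambda>\<omega>. (U1 \<omega>, U2 \<omega>))"
  have m: "(\<lambda>\<omega>. (U1 \<omega>, U2 \<omega>)) \<in> borel_measurable N0" by measurable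
  show ?thesis
  proof (rule that[of ?N fst snd])
    show "prob_space ?N" by (rule prob_space.prob_space_distr[OF N0(1) m])
    show "fst \<in> borel_measurable ?N" "snd \<in> borel_measurable ?N"
      by (simp_all add: borel_measurable_continuous_onI continuous_on_fst continuous_on_snd)
    show "AE \<omega> in ?N. 0 < fst \<omega>"
      by (subst AE_distr_iff[OF m]) (use N0(4) in \<open>auto simp: borel_prod[symmetric]\<close>)
    show "(LINT \<omega>|?N. exp (\<i> * complex_of_real (s * fst \<omega> + t * snd \<omega>))) =
        exp (of_real \<kappa> * (LINT y|stable_levy \<alpha>. cluster_cf (s * c) (t\<^sup>2 * v / 2) y - 1))" for s t
    proof (subst integral_distr[OF m])
      show "(\<lambda>\<omega>. exp (\<i> * complex_of_real (s * fst \<omega> + t * snd \<omega>))) \<in> borel_measurable borel"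
        unfolding borel_prod[symmetric] by measurable
      show "(LINT \<omega>|N0. exp (\<i> * complex_of_real (s * fst (U1 \<omega>, U2 \<omega>) + t * snd (U1 \<omega>, U2 \<omega>)))) =
        exp (of_real \<kappa> * (LINT y|stable_levy \<alpha>. cluster_cf (s * c) (t\<^sup>2 * v / 2) y - 1))"
        unfolding fst_conv snd_conv by (rule N0(5))
    qed
  qed
qed

lemma path_sum_observed_path:
  "path_sum f (observed_path X n \<omega>) = (\<Sum>k<n. f (X (int k) \<omega>) (X (int k + 1) \<omega>))"
  by (induction n) (auto simp: add.commute)

lemma sum_int_interval: "(\<Sum>i=1..int n. F i) = (\<Sum>k<n. F (int k + 1))"
proof (induction n)
  case (Suc n)
  have "{1..int (Suc n)} = insert (int n + 1) {1..int n}" by auto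
  then show ?case using Suc by (simp add: add.commute)
qed simp

context stationary_GWI_process
begin

lemma measurable_cls_denominator [measurable]: "cls_denominator X n \<in> borel_measurable M"
  unfolding cls_denominator_def[abs_def] by measurable

lemma measurable_cls_numerator [measurable]: "cls_numerator m X n \<in> borel_measurable M"
  unfolding cls_numerator_def[abs_def] by measurable

lemma tail_stationary_law:
  assumes pX: "distr M (count_space UNIV) (X 0) = measure_pmf pX"
  shows "tail pX x = prob {\<omega> \<in> space M. real (X 0 \<omega>) > x}"
proof -
  have "tail pX x = measure (distr M (count_space UNIV) (X 0)) {k. real k > x}"
    by (simp add: pX tail_def)
  also have "\<dots> = prob {\<omega> \<in> space M. real (X 0 \<omega>) > x}"
    by (subst measure_distr) (auto intro!: arg_cong[where f=prob])
  finally show ?thesis .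
qed

end

theorem theorem5p1:
  fixes M :: "'a measure"
    and A :: "nat \<Rightarrow> int \<Rightarrow> 'a \<Rightarrow> nat" and B X :: "int \<Rightarrow> 'a \<Rightarrow> nat"
    and p_A p_B :: "nat pmf"
    and \<alpha> \<mu>\<^sub>A \<sigma>\<^sub>A \<mu>\<^sub>B :: real
    and a :: "nat \<Rightarrow> real"
    and muhat :: "nat \<Rightarrow> 'a \<Rightarrow> real"
  assumes process: "stationary_GWI M p_A p_B A B X"
    and mu_A: "\<mu>\<^sub>A = measure_pmf.expectation p_A real" "0 < \<mu>\<^sub>A" "\<mu>\<^sub>A < 1"
    and sigma_A: "integrable (measure_pmf p_A) (\<lambda>k. (real k)\<^sup>2)"
      "\<sigma>\<^sub>A\<^sup>2 = measure_pmf.variance p_A real" "0 < \<sigma>\<^sub>A"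
    and alpha: "1 < \<alpha>" "\<alpha> < 2" "regularly_varying \<alpha> p_B"
    and mu_B: "\<mu>\<^sub>B = measure_pmf.expectation p_B real"
    and a: "\<And>n. n \<ge> 1 \<Longrightarrow> 0 < a n"
      "filterlim a at_top sequentially"
      "(\<lambda>n. real n * measure M {\<omega> \<in> space M. real (X 0 \<omega>) > a n}) \<longlonglongrightarrow> 1"
    and estimator: "is_cls_estimator M \<mu>\<^sub>B X muhat"
  shows "(\<lambda>n. measure M {\<omega> \<in> space M. cls_denominator X n \<omega> > 0}) \<longlonglongrightarrow> 1 \<and>
    (\<exists>(N :: (real \<times> real) measure) V1 V2.
       prob_space N \<and> V1 \<in> borel_measurable N \<and> V2 \<in> borel_measurable N \<and>
       (AE \<omega> in N. V1 \<omega> > 0) \<and>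
       (\<forall>s t :: real.
          (LINT \<omega>|N. exp (\<i> * complex_of_real (s * V1 \<omega> + t * V2 \<omega>))) =
          exp (complex_of_real (1 - \<mu>\<^sub>A powr \<alpha>) *
            (LINT y:{0<..}|lborel.
               (exp (\<i> * complex_of_real (s / (1 - \<mu>\<^sub>A\<^sup>2) * y\<^sup>2)
                     - complex_of_real (\<sigma>\<^sub>A\<^sup>2 * t\<^sup>2 / (2 * (1 - \<mu>\<^sub>A ^ 3)) * y ^ 3)) - 1)
               * complex_of_real (\<alpha> * y powr (- \<alpha> - 1))))) \<and>
       weak_conv_m (\<lambda>n. distr M borel (\<lambda>\<omega>. sqrt (a n) * (muhat n \<omega> - \<mu>\<^sub>A)))
                   (distr N borel (\<lambda>\<omega>. V2 \<omega> / V1 \<omega>)))"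
proof -
  interpret G: stationary_GWI_process M p_A p_B A B X by unfold_locales (rule process)
  obtain pX where pX: "distr M (count_space UNIV) (X 0) = measure_pmf pX"
    by (rule pmf_of_countable_law[OF G.prob_space_axioms G.measurable_X])
  interpret L: gwi_law p_A p_B pX \<alpha> \<mu>\<^sub>A \<sigma>\<^sub>A \<mu>\<^sub>B
    by unfold_locales (rule mu_A sigma_A alpha mu_B G.stationary_law[OF pX])+
  have tail_a: "(\<lambda>n. real n * tail pX (a n)) \<longlonglongrightarrow> 1"
    using a(3) by (simp add: G.tail_stationary_law[OF pX])
  define \<phi> where "\<phi> s t = exp (of_real (1 - \<mu>\<^sub>A powr \<alpha>) * (LINT y|stable_levy \<alpha>. L.limit_cf s t y - 1))" for s t
  have \<kappa>: "0 < 1 - \<mu>\<^sub>A powr \<alpha>" using L.\<mu>_powr_less_1 by simp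
  have \<alpha>0: "0 < \<alpha>" using alpha(1) by simp
  have c0: "0 < 1 / (1 - \<mu>\<^sub>A\<^sup>2)" "0 \<le> \<sigma>\<^sub>A\<^sup>2 / (1 - \<mu>\<^sub>A ^ 3)" using L.one_minus_\<mu>_pos by simp_all
  obtain N :: "(real \<times> real) measure" and V1 V2 where
    N: "prob_space N" and V1[measurable]: "V1 \<in> borel_measurable N" and V2[measurable]: "V2 \<in> borel_measurable N"
    and V1_pos: "AE \<omega> in N. V1 \<omega> > 0"
    and cf: "\<And>s t :: real. (LINT \<omega>|N. exp (\<i> * complex_of_real (s * V1 \<omega> + t * V2 \<omega>))) =
        exp (of_real (1 - \<mu>\<^sub>A powr \<alpha>) * (LINT y|stable_levy \<alpha>. cluster_cf (s * (1 / (1 - \<mu>\<^sub>A\<^sup>2))) (t\<^sup>2 * (\<sigma>\<^sub>A\<^sup>2 / (1 - \<mu>\<^sub>A ^ 3)) / 2) y - 1))"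
    by (rule exists_limit_vector[OF \<kappa> \<alpha>0 alpha(2) c0]) (rule that)
  interpret N: prob_space N by (rule N)
  have limit_cf: "L.limit_cf s t = cluster_cf (s * (1 / (1 - \<mu>\<^sub>A\<^sup>2))) (t\<^sup>2 * (\<sigma>\<^sub>A\<^sup>2 / (1 - \<mu>\<^sub>A ^ 3)) / 2)" for s t
    unfolding L.limit_cf_def by (simp add: mult.commute)
  have cf\<phi>: "(LINT \<omega>|N. exp (\<i> * complex_of_real (s * V1 \<omega> + t * V2 \<omega>))) = \<phi> s t" for s t
    unfolding cf \<phi>_def limit_cf ..
  define D where "D n \<omega> = cls_denominator X n \<omega> / (a n)\<^sup>2" for n \<omega>
  define R where "R n \<omega> = (cls_numerator \<mu>\<^sub>B X n \<omega> - \<mu>\<^sub>A * cls_denominator X n \<omega>) / (a n * sqrt (a n))" for n \<omega>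
  have D[measurable]: "D n \<in> borel_measurable M" and R[measurable]: "R n \<in> borel_measurable M" for n
    unfolding D_def[abs_def] R_def[abs_def] by measurable
  have path: "path_sum (L.increment (a n) s t) (observed_path X n \<omega>) = s * D n \<omega> + t * R n \<omega>" for n s t \<omega>
  proof -
    let ?x = "\<lambda>k. real (X (int k) \<omega>)" and ?y = "\<lambda>k. real (X (int k + 1) \<omega>)"
    have D_sum: "D n \<omega> = (\<Sum>k<n. (?x k)\<^sup>2 / (a n)\<^sup>2)"
      unfolding D_def cls_denominator_def sum_int_interval by (simp add: sum_divide_distrib)
    have "cls_numerator \<mu>\<^sub>B X n \<omega> - \<mu>\<^sub>A * cls_denominator X n \<omega> = (\<Sum>k<n. ?x k * (?y k - \<mu>\<^sub>B) - \<mu>\<^sub>A * (?x k)\<^sup>2)"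
      unfolding cls_denominator_def cls_numerator_def sum_int_interval by (simp add: sum_subtractf sum_distrib_left)
    then have R_sum: "R n \<omega> = (\<Sum>k<n. (?x k * (?y k - \<mu>\<^sub>B) - \<mu>\<^sub>A * (?x k)\<^sup>2) / (a n * sqrt (a n)))"
      unfolding R_def by (simp add: sum_divide_distrib)
    show ?thesis
      unfolding path_sum_observed_path L.increment_def D_sum R_sum sum_distrib_left sum.distrib[symmetric]
      by (intro sum.cong refl) (simp add: power2_eq_square diff_divide_distrib algebra_simps)
  qed
  have joint: "(\<lambda>n. LINT \<omega>|M. iexp (s * D n \<omega> + t * R n \<omega>)) \<longlonglongrightarrow> \<phi> s t" for s t
  proof -
    have "(LINT \<omega>|M. iexp (s * D n \<omega> + t * R n \<omega>)) =
      measure_pmf.expectation (L.path n) (\<lambda>xs. iexp (path_sum (L.increment (a n) s t) xs))" for n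
      unfolding G.observed_path_law[OF pX, symmetric]
      by (subst integral_distr[OF G.measurable_observed_path]) (simp_all add: path)
    then show ?thesis
      using L.path_cf_tendsto[OF a(2) tail_a, of s t] by (simp only: \<phi>_def)
  qed
  have weak: "weak_conv_m (\<lambda>n. distr M borel (\<lambda>\<omega>. s * D n \<omega> + t * R n \<omega>)) (distr N borel (\<lambda>\<omega>. s * V1 \<omega> + t * V2 \<omega>))" for s t
  proof (rule levy_continuity)
    fix u
    have "char (distr M borel (\<lambda>\<omega>. s * D n \<omega> + t * R n \<omega>)) u = (LINT \<omega>|M. iexp ((u * s) * D n \<omega> + (u * t) * R n \<omega>))" for n
      unfolding char_def by (subst integral_distr) (auto simp: algebra_simps)
    moreover have "char (distr N borel (\<lambda>\<omega>. s * V1 \<omega> + t * V2 \<omega>)) u = \<phi> (u * s) (u * t)"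
      unfolding char_def cf\<phi>[symmetric] by (subst integral_distr) (auto simp: algebra_simps)
    ultimately show "(\<lambda>n. char (distr M borel (\<lambda>\<omega>. s * D n \<omega> + t * R n \<omega>)) u) \<longlonglongrightarrow> char (distr N borel (\<lambda>\<omega>. s * V1 \<omega> + t * V2 \<omega>)) u"
      using joint[of "u * s" "u * t"] by (simp only:)
  qed auto
  \<comment> \<open>The distribution function of the limit is continuous at 0 as soon as the limit has no atom
      there.\<close>
  have cdf_lim: "(\<lambda>n. measure M {\<omega> \<in> space M. s * D n \<omega> + t * R n \<omega> \<le> 0}) \<longlonglongrightarrow> measure N {\<omega> \<in> space N. s * V1 \<omega> + t * V2 \<omega> \<le> 0}"
    if "AE \<omega> in N. s * V1 \<omega> + t * V2 \<omega> \<noteq> 0" for s t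
  proof -
    let ?L = "distr N borel (\<lambda>\<omega>. s * V1 \<omega> + t * V2 \<omega>)"
    interpret LL: real_distribution ?L by (rule N.real_distribution_distr) measurable
    have "measure ?L {0} = measure N {\<omega> \<in> space N. s * V1 \<omega> + t * V2 \<omega> = 0}"
      by (subst measure_distr) (auto intro!: arg_cong[where f="measure N"])
    also have "\<dots> = 0"
      using that by (subst N.prob_eq_0) auto
    finally have "isCont (cdf ?L) 0" by (simp add: LL.isCont_cdf)
    then have "(\<lambda>n. cdf (distr M borel (\<lambda>\<omega>. s * D n \<omega> + t * R n \<omega>)) 0) \<longlonglongrightarrow> cdf ?L 0"
      using weak[of s t] unfolding weak_conv_m_def weak_conv_def by blast
    moreover have "cdf (distr M borel (\<lambda>\<omega>. s * D n \<omega> + t * R n \<omega>)) 0 = measure M {\<omega> \<in> space M. s * D n \<omega> + t * R n \<omega> \<le> 0}" for n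
      unfolding cdf_def by (subst measure_distr) (auto intro!: arg_cong[where f="measure M"])
    moreover have "cdf ?L 0 = measure N {\<omega> \<in> space N. s * V1 \<omega> + t * V2 \<omega> \<le> 0}"
      unfolding cdf_def by (subst measure_distr) (auto intro!: arg_cong[where f="measure N"])
    ultimately show ?thesis by simp
  qed
  have posD: "(\<lambda>n. measure M {\<omega> \<in> space M. cls_denominator X n \<omega> > 0}) \<longlonglongrightarrow> 1"
  proof -
    have "AE \<omega> in N. 1 * V1 \<omega> + 0 * V2 \<omega> \<noteq> 0" using V1_pos by eventually_elim simp
    from cdf_lim[OF this] have "(\<lambda>n. measure M {\<omega> \<in> space M. D n \<omega> \<le> 0}) \<longlonglongrightarrow> measure N {\<omega> \<in> space N. V1 \<omega> \<le> 0}" by simp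
    moreover have "measure N {\<omega> \<in> space N. V1 \<omega> \<le> 0} = 0"
      using V1_pos by (subst N.prob_eq_0) (auto simp: not_le)
    ultimately have 0: "(\<lambda>n. measure M {\<omega> \<in> space M. D n \<omega> \<le> 0}) \<longlonglongrightarrow> 0" by simp
    have "(\<lambda>n. 1 - measure M {\<omega> \<in> space M. D n \<omega> \<le> 0}) \<longlonglongrightarrow> 1 - 0" by (intro tendsto_intros 0)
    moreover have "eventually (\<lambda>n. 1 - measure M {\<omega> \<in> space M. D n \<omega> \<le> 0} = measure M {\<omega> \<in> space M. cls_denominator X n \<omega> > 0}) sequentially"
      using eventually_ge_at_top[of 1]
    proof eventually_elim
      case (elim n)
      have "D n \<omega> \<le> 0 \<longleftrightarrow> \<not> cls_denominator X n \<omega> > 0" for \<omega>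
        using a(1)[OF elim] by (simp add: D_def divide_le_0_iff not_less)
      then have "{\<omega> \<in> space M. cls_denominator X n \<omega> > 0} = space M - {\<omega> \<in> space M. D n \<omega> \<le> 0}" by auto
      then show ?case by (simp add: G.prob_compl)
    qed
    ultimately show ?thesis by (simp add: Lim_transform_eventually)
  qed
  have muhat: "muhat n \<in> borel_measurable M"
      "\<And>\<omega>. \<omega> \<in> space M \<Longrightarrow> cls_denominator X n \<omega> > 0 \<Longrightarrow> muhat n \<omega> = cls_numerator \<mu>\<^sub>B X n \<omega> / cls_denominator X n \<omega>"
    if "1 \<le> n" for n
    using estimator that unfolding is_cls_estimator_def by auto
  have conv: "weak_conv_m (\<lambda>n. distr M borel (\<lambda>\<omega>. sqrt (a n) * (muhat n \<omega> - \<mu>\<^sub>A))) (distr N borel (\<lambda>\<omega>. V2 \<omega> / V1 \<omega>))"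
    unfolding weak_conv_m_def weak_conv_def
  proof (intro allI impI)
    fix x
    let ?L = "distr N borel (\<lambda>\<omega>. V2 \<omega> / V1 \<omega>)"
    assume cont: "isCont (cdf ?L) x"
    interpret LL: real_distribution ?L by (rule N.real_distribution_distr) measurable
    have "measure ?L {x} = measure N {\<omega> \<in> space N. V2 \<omega> / V1 \<omega> = x}"
      by (subst measure_distr) (auto intro!: arg_cong[where f="measure N"])
    with cont have "measure N {\<omega> \<in> space N. V2 \<omega> / V1 \<omega> = x} = 0" by (simp add: LL.isCont_cdf)
    then have "AE \<omega> in N. V2 \<omega> / V1 \<omega> \<noteq> x" by (subst (asm) N.prob_eq_0) auto
    then have "AE \<omega> in N. (-x) * V1 \<omega> + 1 * V2 \<omega> \<noteq> 0"
      using V1_pos by eventually_elim (auto simp: field_simps)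
    from cdf_lim[OF this]
    have lim: "(\<lambda>n. measure M {\<omega> \<in> space M. - x * D n \<omega> + 1 * R n \<omega> \<le> 0}) \<longlonglongrightarrow> measure N {\<omega> \<in> space N. - x * V1 \<omega> + 1 * V2 \<omega> \<le> 0}" .
    have cdfL: "cdf ?L x = measure N {\<omega> \<in> space N. - x * V1 \<omega> + 1 * V2 \<omega> \<le> 0}"
    proof -
      have "cdf ?L x = measure N {\<omega> \<in> space N. V2 \<omega> / V1 \<omega> \<le> x}"
        unfolding cdf_def by (subst measure_distr) (auto intro!: arg_cong[where f="measure N"])
      also have "\<dots> = measure N {\<omega> \<in> space N. - x * V1 \<omega> + 1 * V2 \<omega> \<le> 0}"
      proof (rule N.finite_measure_eq_AE)
        show "AE \<omega> in N. \<omega> \<in> {\<omega> \<in> space N. V2 \<omega> / V1 \<omega> \<le> x} \<longleftrightarrow> \<omega> \<in> {\<omega> \<in> space N. - x * V1 \<omega> + 1 * V2 \<omega> \<le> 0}"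
          using V1_pos by eventually_elim (auto simp: divide_le_eq)
      qed measurable
      finally show ?thesis .
    qed
    let ?c = "\<lambda>n. cdf (distr M borel (\<lambda>\<omega>. sqrt (a n) * (muhat n \<omega> - \<mu>\<^sub>A))) x"
    let ?r = "\<lambda>n. measure M {\<omega> \<in> space M. - x * D n \<omega> + 1 * R n \<omega> \<le> 0}"
    \<comment> \<open>Where the denominator is positive, the error is at most \<open>x\<close> exactly when \<open>R n \<le> x * D n\<close>;
        elsewhere the estimator is arbitrary, but this has vanishing probability.\<close>
    have diff: "(\<lambda>n. ?c n - ?r n) \<longlonglongrightarrow> 0"
    proof (rule Lim_null_comparison)
      show "(\<lambda>n. 1 - measure M {\<omega> \<in> space M. cls_denominator X n \<omega> > 0}) \<longlonglongrightarrow> 0"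
        using tendsto_diff[OF tendsto_const[of 1] posD] by simp
      show "eventually (\<lambda>n. norm (?c n - ?r n) \<le> 1 - measure M {\<omega> \<in> space M. cls_denominator X n \<omega> > 0}) sequentially"
        using eventually_ge_at_top[of 1]
      proof eventually_elim
        case (elim n)
        note [measurable] = muhat(1)[OF elim]
        have an: "0 < a n" by (rule a(1)[OF elim])
        let ?E = "{\<omega> \<in> space M. sqrt (a n) * (muhat n \<omega> - \<mu>\<^sub>A) \<le> x}"
        let ?F = "{\<omega> \<in> space M. - x * D n \<omega> + 1 * R n \<omega> \<le> 0}"
        let ?Z = "space M - {\<omega> \<in> space M. cls_denominator X n \<omega> > 0}"
        have cn: "?c n = measure M ?E"
          unfolding cdf_def by (subst measure_distr) (auto intro!: arg_cong[where f="measure M"])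
        have same: "\<omega> \<in> ?E \<longleftrightarrow> \<omega> \<in> ?F" if \<omega>: "\<omega> \<in> space M" "cls_denominator X n \<omega> > 0" for \<omega>
        proof -
          define d m where "d = cls_denominator X n \<omega>" and "m = cls_numerator \<mu>\<^sub>B X n \<omega>"
          define b where "b = sqrt (a n)"
          have b: "0 < b" "a n = b * b" using an by (simp_all add: b_def)
          have d: "0 < d" using \<omega>(2) by (simp add: d_def)
          have "sqrt (a n) * (muhat n \<omega> - \<mu>\<^sub>A) = b * (m - \<mu>\<^sub>A * d) / d"
            using muhat(2)[OF elim \<omega>] d by (simp add: d_def[symmetric] m_def[symmetric] b_def[symmetric] field_simps)
          also have "\<dots> \<le> x \<longleftrightarrow> b * (m - \<mu>\<^sub>A * d) \<le> x * d"
            using d by (simp add: divide_le_eq)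
          also have "\<dots> \<longleftrightarrow> - x * (d / (a n)\<^sup>2) + 1 * ((m - \<mu>\<^sub>A * d) / (a n * b)) \<le> 0"
          proof -
            have "- x * (d / (a n)\<^sup>2) + 1 * ((m - \<mu>\<^sub>A * d) / (a n * b)) = (b * (m - \<mu>\<^sub>A * d) - x * d) / (b * b * b * b)"
              using b(1) unfolding b(2) by (simp add: power2_eq_square field_simps)
            moreover have "0 < b * b * b * b" using b(1) by simp
            ultimately show ?thesis by (simp add: divide_le_0_iff not_le[symmetric])
          qed
          finally show ?thesis using \<omega>(1) by (simp add: D_def R_def d_def m_def b_def)
        qed
        have EF: "?E \<in> sets M" "?F \<in> sets M" "?Z \<in> sets M" by measurable
        have "measure M ?E \<le> measure M (?F \<union> ?Z)" "measure M ?F \<le> measure M (?E \<union> ?Z)"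
          using same EF by (auto intro!: G.finite_measure_mono)
        moreover have "measure M (?F \<union> ?Z) \<le> measure M ?F + measure M ?Z" "measure M (?E \<union> ?Z) \<le> measure M ?E + measure M ?Z"
          using EF by (auto intro!: measure_Un_le)
        moreover have "measure M ?Z = 1 - measure M {\<omega> \<in> space M. cls_denominator X n \<omega> > 0}"
          by (rule G.prob_compl) measurable
        ultimately show ?case unfolding cn by (simp add: abs_le_iff)
      qed
    qed
    have "(\<lambda>n. (?c n - ?r n) + ?r n) \<longlonglongrightarrow> 0 + cdf ?L x"
      unfolding cdfL by (intro tendsto_add diff lim)
    then show "(\<lambda>n. ?c n) \<longlonglongrightarrow> cdf ?L x" by simp
  qed
  have final_cf: "(LINT \<omega>|N. exp (\<i> * complex_of_real (s * V1 \<omega> + t * V2 \<omega>))) =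
          exp (complex_of_real (1 - \<mu>\<^sub>A powr \<alpha>) *
            (LINT y:{0<..}|lborel.
               (exp (\<i> * complex_of_real (s / (1 - \<mu>\<^sub>A\<^sup>2) * y\<^sup>2)
                     - complex_of_real (\<sigma>\<^sub>A\<^sup>2 * t\<^sup>2 / (2 * (1 - \<mu>\<^sub>A ^ 3)) * y ^ 3)) - 1)
               * complex_of_real (\<alpha> * y powr (- \<alpha> - 1))))" for s t
    unfolding cf\<phi> \<phi>_def L.limit_cf_def stable_levy_integral_lborel[OF \<alpha>0] ..
  show ?thesis
    using posD N V1 V2 V1_pos final_cf conv by blast
qed

end
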